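(* Let $(V_1(t),\dots,V_N(t))_{t\ge 0}$ be the collisional particle system described in the context. Then, pathwise (i.e. almost surely), the total momentum and the total energy $$p(t):=\sum_{i=1}^N V_i(t),\qquad \mathcal{E}(t):=\frac12\sum_{i=1}^N |V_i(t)|^2$$ remain constant in time $t\ge 0$.
   Context: Let $d\ge 2$, $\Lambda>0$, $\gamma\in(-d-1,1]$, let $I_d$ be the $d\times d$ identity matrix, and for $z\in\mathbb{R}^d\setminus\{0\}$ put $$A(z)=\Lambda|z|^{\gamma}\big(|z|^2I_d-z\otimes z\big),\qquad \sigma(z)=\sqrt{A(z)}=\sqrt{\Lambda}\,|z|^{\gamma/2+1}\Big(I_d-\frac{z\otimes z}{|z|^2}\Big).$$ Collisional particle system: let $N$ be an even positive integer, $\Delta t>0$ a time step, and $t_m=m\Delta t$ for integers $m\ge0$. At time $t_0=0$, the velocities $V_1(0),\dots,V_N(0)\in\mathbb{R}^d$ are sampled independently from an initial probability density $f_0$ on $\mathbb{R}^d$. At each time $t_m$, the $N$ particles are randomly divided into $N/2$ pairs (independently of everything else); the partner of particle $i$ is denoted $\theta(i)$ (so $\theta$ depends on $m$, $\theta(\theta(i))=i$ and $\theta(i)\ne i$). During $[t_m,t_{m+1})$ each pair $(i,\theta(i))$ evolves, continuously in time (also across the times $t_m$), according to $$\mathrm{d}V_i=-\mathrm{d}V_{\theta(i)}=\sigma(V_i-V_{\theta(i)})\circ \mathrm{d}W_i,$$ where $W_i=-W_{\theta(i)}$ is a $d$-dimensional Brownian motion independent of those of the other pairs, and $\circ$ denotes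 the Stratonovich integral. *)

theory Defs
  imports "HOL-Probability.Probability" "HOL-Combinatorics.Permutations"
begin

section \<open>The collision matrix and its square root\<close>

definition outer :: "real ^ 'd \<Rightarrow> real ^ 'd \<Rightarrow> real ^ 'd ^ 'd" where
  "outer x y = (\<chi> i j. x $ i * y $ j)"

definition collision_matrix :: "real \<Rightarrow> real \<Rightarrow> real ^ 'd \<Rightarrow> real ^ 'd ^ 'd" where
  "collision_matrix \<Lambda> \<gamma> z =
     (\<Lambda> * norm z powr \<gamma>) *\<^sub>R ((norm z)\<^sup>2 *\<^sub>R mat 1 - outer z z)"

text \<open>
  The closed form of the square root is used; that it is the nonnegative symmetric square root of
  the collision matrix is checked below.  At \<open>z = 0\<close>, where the formula makes no sense in
  general, the conventions \<open>0 powr a = 0\<close> and \<open>x / 0 = 0\<close> give the value \<open>0\<close>.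
\<close>
definition sigma_matrix :: "real \<Rightarrow> real \<Rightarrow> real ^ 'd \<Rightarrow> real ^ 'd ^ 'd" where
  "sigma_matrix \<Lambda> \<gamma> z =
     (sqrt \<Lambda> * norm z powr (\<gamma> / 2 + 1)) *\<^sub>R (mat 1 - (1 / (norm z)\<^sup>2) *\<^sub>R outer z z)"

lemma outer_vec: "outer x y *v v = (y \<bullet> v) *\<^sub>R x"
  by (simp add: vec_eq_iff outer_def matrix_vector_mult_def inner_vec_def sum_distrib_left
      sum_distrib_right ac_simps)

lemma scaleR_matrix_vec: "(c *\<^sub>R A) *v v = c *\<^sub>R (A *v v)" for A :: "real ^ 'n ^ 'm"
  by (simp add: scaleR_matrix_vector_assoc)

lemma sigma_matrix_vec:
  "sigma_matrix \<Lambda> \<gamma> z *v v =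
     (sqrt \<Lambda> * norm z powr (\<gamma> / 2 + 1)) *\<^sub>R (v - ((z \<bullet> v) / (norm z)\<^sup>2) *\<^sub>R z)"
  by (simp add: sigma_matrix_def scaleR_matrix_vec matrix_vector_mult_diff_rdistrib outer_vec)

lemma sigma_matrix_symmetric: "transpose (sigma_matrix \<Lambda> \<gamma> z) = sigma_matrix \<Lambda> \<gamma> z"
  by (simp add: vec_eq_iff transpose_def sigma_matrix_def outer_def mat_def ac_simps)

lemma sigma_matrix_nonneg:
  assumes "\<Lambda> \<ge> 0"
  shows "0 \<le> v \<bullet> (sigma_matrix \<Lambda> \<gamma> z *v v)"
proof -
  have "(z \<bullet> v)\<^sup>2 / (norm z)\<^sup>2 \<le> v \<bullet> v"
  proof (cases "z = 0")
    case False
    have "(z \<bullet> v)\<^sup>2 \<le> (z \<bullet> z) * (v \<bullet> v)"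
      by (rule Cauchy_Schwarz_ineq)
    with False show ?thesis
      by (simp add: power2_norm_eq_inner divide_le_eq mult.commute)
  qed auto
  with assms show ?thesis
    by (simp add: sigma_matrix_vec inner_diff_right inner_commute[of v z] power2_eq_square)
qed

lemma sigma_matrix_square:
  fixes z :: "real ^ 'd"
  assumes "\<Lambda> \<ge> 0" "z \<noteq> 0"
  shows "sigma_matrix \<Lambda> \<gamma> z ** sigma_matrix \<Lambda> \<gamma> z = collision_matrix \<Lambda> \<gamma> z"
proof -
  let ?c = "sqrt \<Lambda> * norm z powr (\<gamma> / 2 + 1)"
  have nz: "norm z > 0" "z \<bullet> z \<noteq> 0" using assms by auto
  have pw: "norm z powr (\<gamma> / 2 + 1) * norm z powr (\<gamma> / 2 + 1) = norm z powr \<gamma> * (norm z)\<^sup>2"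
  proof -
    have "norm z powr (\<gamma> / 2 + 1) * norm z powr (\<gamma> / 2 + 1) = norm z powr (\<gamma> + 2)"
      by (simp add: powr_add[symmetric])
    also have "\<dots> = norm z powr \<gamma> * (norm z)\<^sup>2"
      using nz by (simp add: powr_add powr_numeral)
    finally show ?thesis .
  qed
  have cc: "?c * ?c = \<Lambda> * norm z powr \<gamma> * (norm z)\<^sup>2"
  proof -
    have "?c * ?c = (sqrt \<Lambda> * sqrt \<Lambda>) *
        (norm z powr (\<gamma> / 2 + 1) * norm z powr (\<gamma> / 2 + 1))"
      by (simp only: ac_simps)
    also have "\<dots> = \<Lambda> * norm z powr \<gamma> * (norm z)\<^sup>2"
      unfolding pw using assms by simp
    finally show ?thesis .
  qed
  have "sigma_matrix \<Lambda> \<gamma> z *v (sigma_matrix \<Lambda> \<gamma> z *v v) = collision_matrix \<Lambda> \<gamma> z *v v" for v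
  proof -
    let ?w = "v - ((z \<bullet> v) / (norm z)\<^sup>2) *\<^sub>R z"
    have orth: "z \<bullet> ?w = 0"
      using nz by (simp add: inner_diff_right power2_norm_eq_inner)
    have "sigma_matrix \<Lambda> \<gamma> z *v (sigma_matrix \<Lambda> \<gamma> z *v v) = (?c * ?c) *\<^sub>R ?w"
      unfolding sigma_matrix_vec[of \<Lambda> \<gamma> z v] sigma_matrix_vec[of \<Lambda> \<gamma> z "_ *\<^sub>R _"]
        inner_scaleR_right orth by simp
    also have "\<dots> = (\<Lambda> * norm z powr \<gamma>) *\<^sub>R ((norm z)\<^sup>2 *\<^sub>R ?w)"
      unfolding cc by simp
    also have "(norm z)\<^sup>2 *\<^sub>R ?w = (norm z)\<^sup>2 *\<^sub>R v - (z \<bullet> v) *\<^sub>R z"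
      using nz by (simp add: scaleR_diff_right)
    also have "(\<Lambda> * norm z powr \<gamma>) *\<^sub>R \<dots> = collision_matrix \<Lambda> \<gamma> z *v v"
      by (simp add: collision_matrix_def scaleR_matrix_vec matrix_vector_mult_diff_rdistrib outer_vec)
    finally show ?thesis .
  qed
  then show ?thesis
    by (simp add: matrix_eq matrix_vector_mul_assoc)
qed

section \<open>Continuous semimartingales\<close>

text \<open>
  Processes are functions of time and sample point and only their values at times \<open>t \<ge> 0\<close> matter.
\<close>

definition partition_of :: "real \<Rightarrow> real \<Rightarrow> nat \<Rightarrow> (nat \<Rightarrow> real) \<Rightarrow> bool" where
  "partition_of a b K s \<longleftrightarrow> s 0 = a \<and> s K = b \<and> (\<forall>k<K. s k \<le> s (Suc k))"

definition bounded_variation :: "(real \<Rightarrow> real) \<Rightarrow> real \<Rightarrow> real \<Rightarrow> bool" where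
  "bounded_variation f a b \<longleftrightarrow>
     (\<exists>C. \<forall>K s. partition_of a b K s \<longrightarrow> (\<Sum>k<K. \<bar>f (s (Suc k)) - f (s k)\<bar>) \<le> C)"

definition adapted :: "(real \<Rightarrow> 'a measure) \<Rightarrow> (real \<Rightarrow> 'a \<Rightarrow> 'b::topological_space) \<Rightarrow> bool" where
  "adapted F X \<longleftrightarrow> (\<forall>t\<ge>0. X t \<in> borel_measurable (F t))"

definition continuous_paths :: "'a measure \<Rightarrow> (real \<Rightarrow> 'a \<Rightarrow> 'b::topological_space) \<Rightarrow> bool" where
  "continuous_paths M X \<longleftrightarrow> (AE \<omega> in M. continuous_on {0..} (\<lambda>t. X t \<omega>))"

definition martingale ::
  "'a measure \<Rightarrow> (real \<Rightarrow> 'a measure) \<Rightarrow> (real \<Rightarrow> 'a \<Rightarrow> real) \<Rightarrow> bool" where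
  "martingale M F X \<longleftrightarrow> adapted F X \<and> (\<forall>t\<ge>0. integrable M (X t)) \<and>
     (\<forall>s t. 0 \<le> s \<longrightarrow> s \<le> t \<longrightarrow> (AE \<omega> in M. real_cond_exp M (F s) (X t) \<omega> = X s \<omega>))"

definition continuous_local_martingale ::
  "'a measure \<Rightarrow> (real \<Rightarrow> 'a measure) \<Rightarrow> (real \<Rightarrow> 'a \<Rightarrow> real) \<Rightarrow> bool" where
  "continuous_local_martingale M F X \<longleftrightarrow> adapted F X \<and> continuous_paths M X \<and>
     (\<exists>T :: nat \<Rightarrow> 'a \<Rightarrow> real.
        (\<forall>n. stopping_time F (T n)) \<and> (\<forall>n. \<forall>\<omega>\<in>space M. 0 \<le> T n \<omega>) \<and>
        (AE \<omega> in M. incseq (\<lambda>n. T n \<omega>) \<and> filterlim (\<lambda>n. T n \<omega>) at_top sequentially) \<and>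
        (\<forall>n. martingale M F (\<lambda>t \<omega>. X (min t (T n \<omega>)) \<omega> - X 0 \<omega>)))"

definition continuous_semimartingale ::
  "'a measure \<Rightarrow> (real \<Rightarrow> 'a measure) \<Rightarrow> (real \<Rightarrow> 'a \<Rightarrow> real) \<Rightarrow> bool" where
  "continuous_semimartingale M F X \<longleftrightarrow>
     adapted F X \<and> continuous_paths M X \<and>
     (\<exists>L A. continuous_local_martingale M F L \<and>
        adapted F A \<and> continuous_paths M A \<and>
        (AE \<omega> in M. \<forall>t\<ge>0. bounded_variation (\<lambda>u. A u \<omega>) 0 t) \<and>
        (AE \<omega> in M. \<forall>t\<ge>0. X t \<omega> = L t \<omega> + A t \<omega>))"

section \<open>The Stratonovich integral\<close>

text \<open>
  The integral of a matrix-valued process \<open>Y\<close> against a vector-valued process \<open>X\<close> over \<open>[a, b]\<close> is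
  the limit in probability, as the mesh tends to \<open>0\<close>, of the sums in which the integrand is averaged
  over the two endpoints of each partition interval.  Such a sum is the left-endpoint (Ito) sum plus
  one half of the sum of the products of the increments of \<open>Y\<close> and \<open>X\<close>, so that for continuous
  semimartingales the limit is the Ito integral plus one half of the bracket of \<open>Y\<close> and \<open>X\<close>.
\<close>

definition stratonovich_sum ::
  "(real \<Rightarrow> 'a \<Rightarrow> real ^ 'n ^ 'm) \<Rightarrow> (real \<Rightarrow> 'a \<Rightarrow> real ^ 'n) \<Rightarrow> nat \<Rightarrow> (nat \<Rightarrow> real) \<Rightarrow> 'a \<Rightarrow> real ^ 'm"
where
  "stratonovich_sum Y X K s \<omega> =
     (\<Sum>k<K. ((1 / 2) *\<^sub>R (Y (s k) \<omega> + Y (s (Suc k)) \<omega>)) *v (X (s (Suc k)) \<omega> - X (s k) \<omega>))"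

definition has_stratonovich_integral ::
  "'a measure \<Rightarrow> (real \<Rightarrow> 'a \<Rightarrow> real ^ 'n ^ 'm) \<Rightarrow> (real \<Rightarrow> 'a \<Rightarrow> real ^ 'n) \<Rightarrow>
     real \<Rightarrow> real \<Rightarrow> ('a \<Rightarrow> real ^ 'm) \<Rightarrow> bool"
where
  "has_stratonovich_integral M Y X a b I \<longleftrightarrow>
     (\<forall>\<epsilon>>0. \<forall>\<eta>>0. \<exists>\<delta>>0. \<forall>K s. partition_of a b K s \<longrightarrow> (\<forall>k<K. s (Suc k) - s k < \<delta>) \<longrightarrow>
        measure M {\<omega> \<in> space M. dist (stratonovich_sum Y X K s \<omega>) (I \<omega>) > \<epsilon>} < \<eta>)"

section \<open>Independent Brownian motions\<close>

text \<open>The density of the centred Gaussian law with covariance matrix \<open>v I\<close>.\<close>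

definition gaussian_density :: "real \<Rightarrow> real ^ 'd \<Rightarrow> real" where
  "gaussian_density v x = (\<Prod>j\<in>UNIV. normal_density 0 (sqrt v) (x $ j))"

text \<open>
  A family, indexed by \<open>I\<close>, of mutually independent Brownian motions relative to the filtration \<open>F\<close>,
  on the time interval \<open>[a, b]\<close> and started from \<open>0\<close> at time \<open>a\<close>: over every \<open>[s, t]\<close> the past \<open>F s\<close>
  and the increments of all members of the family are mutually independent.
\<close>

definition brownian_family ::
  "'a measure \<Rightarrow> (real \<Rightarrow> 'a measure) \<Rightarrow> real \<Rightarrow> real \<Rightarrow> 'i set \<Rightarrow> ('i \<Rightarrow> real \<Rightarrow> 'a \<Rightarrow> real ^ 'd) \<Rightarrow> bool"
where
  "brownian_family P F a b I B \<longleftrightarrow> prob_space P \<and>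
     (\<forall>i\<in>I. (\<forall>t\<in>{a..b}. B i t \<in> borel_measurable (F t)) \<and>
        (AE \<omega> in P. B i a \<omega> = 0) \<and> (AE \<omega> in P. continuous_on {a..b} (\<lambda>t. B i t \<omega>))) \<and>
     (\<forall>s t. a \<le> s \<longrightarrow> s < t \<longrightarrow> t \<le> b \<longrightarrow>
        (\<forall>i\<in>I. distributed P lborel (\<lambda>\<omega>. B i t \<omega> - B i s \<omega>)
           (\<lambda>x. ennreal (gaussian_density (t - s) x))) \<and>
        prob_space.indep_sets P
          (case_option (sets (F s))
             (\<lambda>i. {(\<lambda>\<omega>. B i t \<omega> - B i s \<omega>) -` S \<inter> space P | S. S \<in> sets borel}))
          (insert None (Some ` I)))"

section \<open>The collisional particle system\<close>

definition pairings :: "nat \<Rightarrow> (nat \<Rightarrow> nat) set" where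
  "pairings N = {\<pi>. \<pi> permutes {1..N} \<and> (\<forall>i\<in>{1..N}. \<pi> i \<noteq> i \<and> \<pi> (\<pi> i) = i)}"

text \<open>
  \<open>\<theta> m \<omega> i\<close> is the partner of particle \<open>i\<close> during the \<open>m\<close>-th time step, and \<open>W m i\<close> is the noise
  driving particle \<open>i\<close> during that time step, started from \<open>0\<close> at its beginning.  The pairing is
  uniformly distributed.  Since \<open>\<theta> m\<close> is random, the law of the noise is prescribed conditionally on
  \<open>\<theta> m = \<pi>\<close>, each pair being represented by its smaller member \<open>i < \<pi> i\<close>.  The filtration \<open>F\<close>
  carries the available information, with \<open>\<theta> m\<close> being revealed at time \<open>m \<Delta>t\<close>.  As usual for
  stochastic differential equations, the velocities are required to be continuous semimartingales;
  of the integrand only the existence of the integral is required.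
\<close>

locale collisional_particle_system = prob_space M + filtration "space M" F
  for M :: "'a measure" and F :: "real \<Rightarrow> 'a measure" +
  fixes \<Lambda> \<gamma> \<Delta>t :: real
    and N :: nat
    and f0 :: "real ^ 'd \<Rightarrow> real"
    and \<theta> :: "nat \<Rightarrow> 'a \<Rightarrow> nat \<Rightarrow> nat"
    and W :: "nat \<Rightarrow> nat \<Rightarrow> real \<Rightarrow> 'a \<Rightarrow> real ^ 'd"
    and V :: "nat \<Rightarrow> real \<Rightarrow> 'a \<Rightarrow> real ^ 'd"
  assumes F_events: "sets (F t) \<subseteq> events"
    and initial_law: "i \<in> {1..N} \<Longrightarrow> distributed M lborel (V i 0) (\<lambda>x. ennreal (f0 x))"
    and initial_indep: "indep_vars (\<lambda>_. borel) (\<lambda>i. V i 0) {1..N}"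
    and pairing_measurable: "\<theta> m \<in> F (real m * \<Delta>t) \<rightarrow>\<^sub>M count_space (pairings N)"
    and pairing_uniform:
      "distr M (count_space (pairings N)) (\<theta> m) = uniform_count_measure (pairings N)"
    and pairing_indep:
      "indep_set {\<theta> m -` S \<inter> space M | S. S \<subseteq> pairings N}
         (sigma_sets (space M)
            ((\<Union>s\<in>{0..<real m * \<Delta>t}. sets (F s)) \<union>
             (\<Union>i\<in>{1..N}. {V i 0 -` S \<inter> space M | S. S \<in> sets borel})))"
    and noise_adapted: "i \<in> {1..N} \<Longrightarrow> t \<in> {real m * \<Delta>t..real (Suc m) * \<Delta>t} \<Longrightarrow>
      W m i t \<in> borel_measurable (F t)"
    and noise_antisym: "i \<in> {1..N} \<Longrightarrow>
      AE \<omega> in M. \<forall>t\<in>{real m * \<Delta>t..real (Suc m) * \<Delta>t}. W m i t \<omega> = - W m (\<theta> m \<omega> i) t \<omega>"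
    and noise_brownian: "\<pi> \<in> pairings N \<Longrightarrow>
      brownian_family (uniform_measure M {\<omega> \<in> space M. \<theta> m \<omega> = \<pi>}) F
        (real m * \<Delta>t) (real (Suc m) * \<Delta>t) {i \<in> {1..N}. i < \<pi> i} (W m)"
    and velocity_semimartingale: "i \<in> {1..N} \<Longrightarrow>
      continuous_semimartingale M F (\<lambda>t \<omega>. V i t \<omega> $ j)"
    and velocity_antisym: "i \<in> {1..N} \<Longrightarrow> t \<in> {real m * \<Delta>t..real (Suc m) * \<Delta>t} \<Longrightarrow>
      AE \<omega> in M. V i t \<omega> - V i (real m * \<Delta>t) \<omega> =
        - (V (\<theta> m \<omega> i) t \<omega> - V (\<theta> m \<omega> i) (real m * \<Delta>t) \<omega>)"
    and velocity_sde: "i \<in> {1..N} \<Longrightarrow> t \<in> {real m * \<Delta>t..real (Suc m) * \<Delta>t} \<Longrightarrow>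
      has_stratonovich_integral M
        (\<lambda>s \<omega>. sigma_matrix \<Lambda> \<gamma> (V i s \<omega> - V (\<theta> m \<omega> i) s \<omega>)) (W m i)
        (real m * \<Delta>t) t (\<lambda>\<omega>. V i t \<omega> - V i (real m * \<Delta>t) \<omega>)"

definition total_momentum :: "nat \<Rightarrow> (nat \<Rightarrow> real \<Rightarrow> 'a \<Rightarrow> real ^ 'd) \<Rightarrow> real \<Rightarrow> 'a \<Rightarrow> real ^ 'd" where
  "total_momentum N V t \<omega> = (\<Sum>i=1..N. V i t \<omega>)"

definition total_energy :: "nat \<Rightarrow> (nat \<Rightarrow> real \<Rightarrow> 'a \<Rightarrow> real ^ 'd) \<Rightarrow> real \<Rightarrow> 'a \<Rightarrow> real" where
  "total_energy N V t \<omega> = 1 / 2 * (\<Sum>i=1..N. (norm (V i t \<omega>))\<^sup>2)"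

end

theory Submission
  imports Defs
begin

text \<open>
  Momentum.  During one time step the increments of the two members of a pair are opposite, and the
  pairing permutes the particles, so the increments sum to zero.  This holds almost surely at each
  fixed time, hence at all rational times simultaneously, hence at all times by continuity.

  Energy.  By the parallelogram identity the energy of a pair is determined by the sum of the two
  velocities, which is constant during a step, and by the length of the relative velocity \<open>z\<close>.  On the
  event that the pairing is a given one, \<open>dz = s(z) \<circ> dW\<close> with \<open>s = 2 \<sigma>\<close>, and \<open>s(z) w\<close> is orthogonal
  to \<open>z\<close> for every \<open>w\<close>.  As the Stratonovich integral obeys the ordinary chain rule,
  \<open>d|z|\<^sup>2 = 2 z \<circ> dz = 2 (z \<bullet> s(z)) \<circ> dW = 0\<close>.  What has to be justified is this computation, starting
  from an integral that is only a limit in probability of trapezoidal sums, and with a field \<open>s\<close> that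
  may be singular at the origin.

  Let \<open>R\<^sub>k\<close> be the defect of the equation on the \<open>k\<close>-th interval of a partition, that is, the increment
  of \<open>z\<close> minus the trapezoidal approximation of the integral.  The increment of a smooth function of
  \<open>|z|\<^sup>2\<close> is, up to third-order terms, a sum of \<open>h(z) \<bullet> R\<^sub>k\<close> and of terms bounded by the product of the
  increment of \<open>z\<close> with \<open>R\<^sub>k\<close> (\<open>cutoff_energy_increment\<close>).  Three facts make these sums small.

  First, the sum of the defects over any subset of a fine partition is small in probability, uniformly
  in the subset, because the partition can be refined outside the subset until the contribution of the
  complement disappears (\<open>vanishing_subset_sums\<close>).  Taking the subset to be a block on which \<open>h(z)\<close> is
  nearly constant handles the main part of the sum of \<open>h(z) \<bullet> R\<^sub>k\<close>.

  Second, averaging over all choices of signs turns smallness of all the signed sums of the defects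
  into smallness of the sum of their squares (\<open>sum_squares_small\<close>).  With the Cauchy-Schwarz inequality
  this disposes of the products of increments.

  Third, semimartingales and Brownian motions are good integrators: sums of their increments with
  adapted coefficients are bounded in probability by a multiple of the bound of the coefficients.
  This controls the variation of \<open>h(z)\<close> inside the blocks, and it also bounds the sums of squared
  increments.  For a local martingale, which need only be integrable when stopped, it is a weak-type
  inequality obtained by truncation (\<open>martingale_transform_truncated\<close>).

  The singularity is avoided by following \<open>(|z|\<^sup>2 - \<alpha>)\<^sub>+\<^sup>3\<close> in place of \<open>|z|\<^sup>2\<close>, whose derivative
  vanishes near the origin; letting \<open>\<alpha>\<close> tend to zero recovers \<open>|z|\<close>.
\<close>

section \<open>Statements that hold up to a small probability\<close>

text \<open>
  Statements of this form combine by adding the exceptional probabilities, require no measurability of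
  \<open>\<phi>\<close>, and leave a pathwise inequality to prove off the exceptional event.
\<close>
definition whp :: "'a measure \<Rightarrow> real \<Rightarrow> ('a \<Rightarrow> bool) \<Rightarrow> bool" where
  "whp P \<epsilon> \<phi> \<longleftrightarrow> (\<exists>E\<in>sets P. measure P E \<le> \<epsilon> \<and> (\<forall>\<omega>\<in>space P - E. \<phi> \<omega>))"

lemma whp_mono:
  assumes "whp P \<epsilon> \<phi>" "\<epsilon> \<le> \<delta>" "\<And>\<omega>. \<omega> \<in> space P \<Longrightarrow> \<phi> \<omega> \<Longrightarrow> \<psi> \<omega>"
  shows "whp P \<delta> \<psi>"
  using assms unfolding whp_def by (meson DiffD1 order_trans)

context finite_measure
begin

lemma whp_conj:
  assumes "whp M \<epsilon> \<phi>" "whp M \<delta> \<psi>"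
  shows "whp M (\<epsilon> + \<delta>) (\<lambda>\<omega>. \<phi> \<omega> \<and> \<psi> \<omega>)"
proof -
  obtain A B where AB: "A \<in> sets M" "measure M A \<le> \<epsilon>" "\<forall>\<omega>\<in>space M - A. \<phi> \<omega>"
    "B \<in> sets M" "measure M B \<le> \<delta>" "\<forall>\<omega>\<in>space M - B. \<psi> \<omega>"
    using assms unfolding whp_def by auto
  have "measure M (A \<union> B) \<le> \<epsilon> + \<delta>"
    using measure_subadditive[of A M B] AB by (simp add: emeasure_eq_measure)
  with AB show ?thesis
    unfolding whp_def by (intro bexI[of _ "A \<union> B"]) auto
qed

lemma whp_ball:
  assumes "finite I" "\<And>i. i \<in> I \<Longrightarrow> whp M \<epsilon> (\<phi> i)"
  shows "whp M (real (card I) * \<epsilon>) (\<lambda>\<omega>. \<forall>i\<in>I. \<phi> i \<omega>)"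
  using assms
proof (induction I rule: finite_induct)
  case empty
  then show ?case unfolding whp_def by (intro bexI[of _ "{}"]) auto
next
  case (insert x I)
  have "whp M (\<epsilon> + real (card I) * \<epsilon>) (\<lambda>\<omega>. \<phi> x \<omega> \<and> (\<forall>i\<in>I. \<phi> i \<omega>))"
    using insert by (intro whp_conj) auto
  then show ?case
    by (rule whp_mono) (use insert in \<open>auto simp: algebra_simps\<close>)
qed

lemma whp_of_AE:
  assumes "AE \<omega> in M. \<phi> \<omega>" "0 \<le> \<epsilon>"
  shows "whp M \<epsilon> \<phi>"
proof -
  obtain N where "{\<omega>\<in>space M. \<not> \<phi> \<omega>} \<subseteq> N" "emeasure M N = 0" "N \<in> sets M"
    using assms(1) by (rule AE_E)
  with assms(2) show ?thesis
    unfolding whp_def by (intro bexI[of _ N]) (auto simp: measure_def)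
qed

lemma AE_of_whp:
  assumes "\<And>\<epsilon>. 0 < \<epsilon> \<Longrightarrow> whp M \<epsilon> \<phi>"
  shows "AE \<omega> in M. \<phi> \<omega>"
proof -
  have "\<exists>E\<in>sets M. measure M E \<le> inverse (Suc n) \<and> (\<forall>\<omega>\<in>space M - E. \<phi> \<omega>)" for n
    using assms[of "inverse (Suc n)"] unfolding whp_def by simp
  then obtain E where E: "\<And>n. E n \<in> sets M" "\<And>n. measure M (E n) \<le> inverse (Suc n)"
    "\<And>n \<omega>. \<omega> \<in> space M - E n \<Longrightarrow> \<phi> \<omega>"
    by metis
  have le: "measure M (\<Inter>n. E n) \<le> inverse (Suc n)" for n
  proof -
    have "measure M (\<Inter>n. E n) \<le> measure M (E n)"
      using E(1) by (intro finite_measure_mono) auto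
    with E(2)[of n] show ?thesis by linarith
  qed
  have "measure M (\<Inter>n. E n) \<le> 0"
    by (rule LIMSEQ_le_const[OF LIMSEQ_inverse_real_of_nat]) (use le in auto)
  then have "measure M (\<Inter>n. E n) = 0"
    using measure_nonneg[of M "\<Inter>n. E n"] by linarith
  then have "(\<Inter>n. E n) \<in> null_sets M"
    using E by (intro null_setsI) (auto simp: emeasure_eq_measure)
  then show ?thesis
  proof (rule AE_I')
    show "{\<omega> \<in> space M. \<not> \<phi> \<omega>} \<subseteq> (\<Inter>n. E n)"
      using E(3) by auto
  qed
qed

lemma whp_of_prob_le:
  assumes "{\<omega> \<in> space M. \<not> \<phi> \<omega>} \<in> sets M" "measure M {\<omega> \<in> space M. \<not> \<phi> \<omega>} \<le> \<epsilon>"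
  shows "whp M \<epsilon> \<phi>"
  using assms unfolding whp_def by (intro bexI[of _ "{\<omega> \<in> space M. \<not> \<phi> \<omega>}"]) auto

text \<open>
  Almost every path satisfies the increasing conditions \<open>\<phi> m\<close> from some \<open>m\<close> on; continuity from above of the
  measure makes one \<open>m\<close> work for most paths.  Bounds and moduli of continuity of random paths are
  replaced by deterministic ones in this way.
\<close>
lemma whp_eventually:
  assumes meas: "\<And>m. {\<omega> \<in> space M. \<not> \<phi> m \<omega>} \<in> sets M"
    and mono: "\<And>m \<omega>. \<omega> \<in> space M \<Longrightarrow> \<phi> m \<omega> \<Longrightarrow> \<phi> (Suc m) \<omega>"
    and ex: "AE \<omega> in M. \<exists>m. \<phi> m \<omega>" and "0 < \<epsilon>"
  shows "\<exists>m::nat. whp M \<epsilon> (\<phi> m)"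
proof -
  let ?E = "\<lambda>m. {\<omega> \<in> space M. \<not> \<phi> m \<omega>}"
  have "(\<Inter>m. ?E m) \<in> null_sets M"
  proof (rule AE_iff_null_sets[THEN iffD2])
    show "(\<Inter>m. ?E m) \<in> sets M" using meas by auto
    show "AE \<omega> in M. \<omega> \<notin> (\<Inter>m. ?E m)" using ex by eventually_elim auto
  qed
  then have z: "measure M (\<Inter>m. ?E m) = 0"
    by (simp add: measure_def null_setsD1)
  have "(\<lambda>m. measure M (?E m)) \<longlonglongrightarrow> measure M (\<Inter>m. ?E m)"
    using meas mono by (intro finite_Lim_measure_decseq) (auto intro!: decseq_SucI)
  then have "eventually (\<lambda>m. measure M (?E m) < \<epsilon>) sequentially"
    using z \<open>0 < \<epsilon>\<close> by (simp add: order_tendstoD)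
  then obtain m where "measure M (?E m) < \<epsilon>"
    by (auto simp: eventually_sequentially)
  then show ?thesis
    using meas by (intro exI[of _ m] whp_of_prob_le) auto
qed

lemma whp_of_expectation_le:
  fixes f :: "'a \<Rightarrow> real"
  assumes int: "integrable M f" and nn: "\<And>\<omega>. \<omega> \<in> space M \<Longrightarrow> 0 \<le> f \<omega>"
    and le: "(\<integral>\<omega>. f \<omega> \<partial>M) \<le> m" and c: "0 < c"
  shows "whp M (m / c) (\<lambda>\<omega>. f \<omega> \<le> c)"
proof (rule whp_of_prob_le)
  have [measurable]: "f \<in> borel_measurable M" using int by auto
  show "{\<omega> \<in> space M. \<not> f \<omega> \<le> c} \<in> sets M" by measurable
  have "measure M {\<omega> \<in> space M. \<not> f \<omega> \<le> c} \<le> measure M {\<omega> \<in> space M. c \<le> f \<omega>}"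
    by (rule finite_measure_mono) auto
  also have "\<dots> \<le> (\<integral>\<omega>. f \<omega> \<partial>M) / c"
    using nn c by (intro integral_Markov_inequality_measure[where A="{}"] int AE_I2) auto
  also have "\<dots> \<le> m / c" using le c by (simp add: divide_right_mono)
  finally show "measure M {\<omega> \<in> space M. \<not> f \<omega> \<le> c} \<le> m / c" .
qed

end

text \<open>
  Conditioning on an event of positive probability only rescales exceptional probabilities, so that
  estimates for the particle system pass to the conditional law given the pairing.  If \<open>A\<close> is a null set,
  the uniform measure is zero, in agreement with \<open>\<epsilon> / 0 = 0\<close>.
\<close>
lemma whp_uniform_measure:
  assumes "whp M \<epsilon> \<phi>" and A: "A \<in> sets M" and fin: "finite_measure M"
  shows "whp (uniform_measure M A) (\<epsilon> / measure M A) \<phi>"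
proof -
  interpret finite_measure M by fact
  obtain E where E: "E \<in> sets M" "measure M E \<le> \<epsilon>" "\<forall>\<omega>\<in>space M - E. \<phi> \<omega>"
    using assms unfolding whp_def by auto
  have "measure (uniform_measure M A) E \<le> \<epsilon> / measure M A"
  proof (cases "measure M A = 0")
    case True
    have "measure M (A \<inter> E) \<le> measure M A"
      using A E by (intro finite_measure_mono) auto
    then have "measure M (A \<inter> E) = 0"
      using True measure_nonneg[of M "A \<inter> E"] by linarith
    then have "emeasure M (A \<inter> E) = 0"
      by (simp add: emeasure_eq_measure)
    then have "emeasure (uniform_measure M A) E = 0"
      using A E by (simp add: emeasure_uniform_measure)
    then show ?thesis using True by (simp add: measure_def)
  next
    case False
    then have "emeasure M A \<noteq> 0" "emeasure M A \<noteq> \<infinity>"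
      by (auto simp: emeasure_eq_measure)
    then have "measure (uniform_measure M A) E = measure M (A \<inter> E) / measure M A"
      using E(1) by (rule measure_uniform_measure)
    also have "\<dots> \<le> \<epsilon> / measure M A"
      using finite_measure_mono[of "A \<inter> E" E] E by (intro divide_right_mono) auto
    finally show ?thesis .
  qed
  with E show ?thesis unfolding whp_def by (intro bexI[of _ E]) auto
qed

section \<open>Martingale transforms in discrete time\<close>

definition clip :: "real \<Rightarrow> real \<Rightarrow> real" where
  "clip \<kappa> x = max (- \<kappa>) (min \<kappa> x)"

lemma clip_measurable [measurable]: "clip \<kappa> \<in> borel_measurable borel"
  unfolding clip_def by measurable

context prob_space
begin

lemma integrable_mult_of_square_integrable:
  fixes f g :: "'a \<Rightarrow> real"
  assumes [measurable]: "f \<in> borel_measurable M" "g \<in> borel_measurable M"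
    and "integrable M (\<lambda>\<omega>. (f \<omega>)\<^sup>2)" "integrable M (\<lambda>\<omega>. (g \<omega>)\<^sup>2)"
  shows "integrable M (\<lambda>\<omega>. f \<omega> * g \<omega>)"
proof (rule Bochner_Integration.integrable_bound)
  show "integrable M (\<lambda>\<omega>. (f \<omega>)\<^sup>2 + (g \<omega>)\<^sup>2)" using assms by simp
  have "\<bar>x * y\<bar> \<le> x\<^sup>2 + y\<^sup>2" for x y :: real
    using sum_squares_bound[of "\<bar>x\<bar>" "\<bar>y\<bar>"] mult_nonneg_nonneg[OF abs_ge_zero[of x] abs_ge_zero[of y]]
    unfolding abs_mult power2_abs by linarith
  then show "AE \<omega> in M. norm (f \<omega> * g \<omega>) \<le> norm ((f \<omega>)\<^sup>2 + (g \<omega>)\<^sup>2)"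
    by (intro AE_I2) (simp add: abs_mult)
qed simp

text \<open>
  In the square of the sum the product of the partial sum up to \<open>n\<close> with the coefficient \<open>c n\<close> belongs to
  the past of \<open>\<xi> n\<close>, so all cross terms vanish.  The second moment of the transform is therefore at most
  the sum of the second moments of the increments, however many there are.
\<close>
lemma orthogonal_sum_second_moment:
  fixes \<xi> c :: "nat \<Rightarrow> 'a \<Rightarrow> real" and G :: "nat \<Rightarrow> 'a measure"
  assumes sub: "\<And>k. k \<le> K \<Longrightarrow> subalgebra M (G k)"
    and mono: "\<And>k. k < K \<Longrightarrow> subalgebra (G (Suc k)) (G k)"
    and adapted: "\<And>k. k < K \<Longrightarrow> \<xi> k \<in> borel_measurable (G (Suc k))"
    and square: "\<And>k. k < K \<Longrightarrow> integrable M (\<lambda>\<omega>. (\<xi> k \<omega>)\<^sup>2)"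
    and orth: "\<And>k H. k < K \<Longrightarrow> H \<in> borel_measurable (G k) \<Longrightarrow> integrable M (\<lambda>\<omega>. (H \<omega>)\<^sup>2) \<Longrightarrow>
      (\<integral>\<omega>. H \<omega> * \<xi> k \<omega> \<partial>M) = 0"
    and c_meas: "\<And>k. k < K \<Longrightarrow> c k \<in> borel_measurable (G k)"
    and c_bound: "\<And>k \<omega>. k < K \<Longrightarrow> \<omega> \<in> space M \<Longrightarrow> \<bar>c k \<omega>\<bar> \<le> 1"
    and "n \<le> K"
  shows "(\<lambda>\<omega>. \<Sum>k<n. c k \<omega> * \<xi> k \<omega>) \<in> borel_measurable (G n) \<and>
    integrable M (\<lambda>\<omega>. (\<Sum>k<n. c k \<omega> * \<xi> k \<omega>)\<^sup>2) \<and>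
    (\<integral>\<omega>. (\<Sum>k<n. c k \<omega> * \<xi> k \<omega>)\<^sup>2 \<partial>M) \<le> (\<Sum>k<n. \<integral>\<omega>. (\<xi> k \<omega>)\<^sup>2 \<partial>M)"
  using \<open>n \<le> K\<close>
proof (induction n)
  case 0
  then show ?case by simp
next
  case (Suc n)
  define S where "S = (\<lambda>\<omega>. \<Sum>k<n. c k \<omega> * \<xi> k \<omega>)"
  from Suc have n: "n < K" by simp
  with Suc have IH: "S \<in> borel_measurable (G n)" "integrable M (\<lambda>\<omega>. (S \<omega>)\<^sup>2)"
    "(\<integral>\<omega>. (S \<omega>)\<^sup>2 \<partial>M) \<le> (\<Sum>k<n. \<integral>\<omega>. (\<xi> k \<omega>)\<^sup>2 \<partial>M)" by (auto simp: S_def)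
  have S_meas: "S \<in> borel_measurable (G (Suc n))" "S \<in> borel_measurable M"
    using measurable_from_subalg[OF mono[OF n] IH(1)]
      measurable_from_subalg[OF sub[of n] IH(1)] n by auto
  have c': "c n \<in> borel_measurable (G (Suc n))" "c n \<in> borel_measurable M"
    using measurable_from_subalg[OF mono[OF n] c_meas[OF n]]
      measurable_from_subalg[OF sub[of n] c_meas[OF n]] n by auto
  have xi: "\<xi> n \<in> borel_measurable M"
    using measurable_from_subalg[OF sub[of "Suc n"] adapted[OF n]] n by auto
  have c2: "(c n \<omega>)\<^sup>2 \<le> 1" if "\<omega> \<in> space M" for \<omega>
    using c_bound[OF n that] by (simp add: abs_square_le_1)
  note [measurable] = S_meas(2) c'(2) xi
  have cS: "integrable M (\<lambda>\<omega>. (S \<omega> * c n \<omega>)\<^sup>2)"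
  proof (rule Bochner_Integration.integrable_bound[OF IH(2)])
    show "AE \<omega> in M. norm ((S \<omega> * c n \<omega>)\<^sup>2) \<le> norm ((S \<omega>)\<^sup>2)"
    proof (rule AE_I2)
      fix \<omega> assume "\<omega> \<in> space M"
      then show "norm ((S \<omega> * c n \<omega>)\<^sup>2) \<le> norm ((S \<omega>)\<^sup>2)"
        using mult_left_mono[OF c2[of \<omega>], of "(S \<omega>)\<^sup>2"] by (simp add: power_mult_distrib)
    qed
  qed measurable
  have c_xi: "integrable M (\<lambda>\<omega>. (c n \<omega> * \<xi> n \<omega>)\<^sup>2)"
  proof (rule Bochner_Integration.integrable_bound[OF square[OF n]])
    show "AE \<omega> in M. norm ((c n \<omega> * \<xi> n \<omega>)\<^sup>2) \<le> norm ((\<xi> n \<omega>)\<^sup>2)"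
    proof (rule AE_I2)
      fix \<omega> assume "\<omega> \<in> space M"
      then show "norm ((c n \<omega> * \<xi> n \<omega>)\<^sup>2) \<le> norm ((\<xi> n \<omega>)\<^sup>2)"
        using mult_right_mono[OF c2[of \<omega>], of "(\<xi> n \<omega>)\<^sup>2"] by (simp add: power_mult_distrib)
    qed
  qed measurable
  have cross: "integrable M (\<lambda>\<omega>. (S \<omega> * c n \<omega>) * \<xi> n \<omega>)"
    using integrable_mult_of_square_integrable[OF _ xi cS square[OF n]] by simp
  have zero: "(\<integral>\<omega>. (S \<omega> * c n \<omega>) * \<xi> n \<omega> \<partial>M) = 0"
    using orth[OF n _ cS] IH(1) c_meas[OF n] by simp
  have expand: "(\<Sum>k<Suc n. c k \<omega> * \<xi> k \<omega>)\<^sup>2 =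
      (S \<omega>)\<^sup>2 + 2 * ((S \<omega> * c n \<omega>) * \<xi> n \<omega>) + (c n \<omega> * \<xi> n \<omega>)\<^sup>2" for \<omega>
    by (simp add: S_def power2_sum algebra_simps)
  have "integrable M (\<lambda>\<omega>. (\<Sum>k<Suc n. c k \<omega> * \<xi> k \<omega>)\<^sup>2)"
    unfolding expand using IH(2) cross c_xi by simp
  moreover have "(\<integral>\<omega>. (\<Sum>k<Suc n. c k \<omega> * \<xi> k \<omega>)\<^sup>2 \<partial>M) =
      (\<integral>\<omega>. (S \<omega>)\<^sup>2 \<partial>M) + (\<integral>\<omega>. (c n \<omega> * \<xi> n \<omega>)\<^sup>2 \<partial>M)"
    unfolding expand using IH(2) cross c_xi zero by simp
  moreover have "(\<integral>\<omega>. (c n \<omega> * \<xi> n \<omega>)\<^sup>2 \<partial>M) \<le> (\<integral>\<omega>. (\<xi> n \<omega>)\<^sup>2 \<partial>M)"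
  proof (rule integral_mono[OF c_xi square[OF n]])
    fix \<omega> assume "\<omega> \<in> space M"
    then show "(c n \<omega> * \<xi> n \<omega>)\<^sup>2 \<le> (\<xi> n \<omega>)\<^sup>2"
      using mult_right_mono[OF c2[of \<omega>], of "(\<xi> n \<omega>)\<^sup>2"] by (simp add: power_mult_distrib)
  qed
  moreover have "(\<lambda>\<omega>. \<Sum>k<Suc n. c k \<omega> * \<xi> k \<omega>) \<in> borel_measurable (G (Suc n))"
    using S_meas(1) c'(1) adapted[OF n] by (simp add: S_def)
  ultimately show ?case using IH(3) by (simp add: S_def)
qed

text \<open>
  A weak-type inequality for transforms of a martingale without second moments.  Up to the first time
  at which \<open>\<bar>X\<bar>\<close> exceeds \<open>\<kappa>\<close> the increments are replaced by their truncations \<open>d k\<close>.  Truncation creates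
  a drift \<open>e k\<close>, the conditional mean of \<open>d k\<close>, which is minus the conditional mean of the overshoot
  \<open>r k\<close>.  An overshoot occurs only at the exit time, and the conditional mean of \<open>\<bar>X K\<bar>\<close> dominates
  \<open>\<bar>X\<bar>\<close> there, so the overshoots and the drifts have total mean at most \<open>m\<close>.  The increments \<open>\<xi> k\<close>
  freed from their drift are orthogonal, and telescoping the squares of the truncated martingale bounds
  their total second moment by \<open>\<kappa>\<^sup>2 + 2 \<kappa> m\<close>.
\<close>
lemma martingale_transform_truncated:
  fixes X c :: "nat \<Rightarrow> 'a \<Rightarrow> real" and G :: "nat \<Rightarrow> 'a measure"
  assumes sub: "\<And>k. k \<le> K \<Longrightarrow> subalgebra M (G k)"
    and mono: "\<And>k. k < K \<Longrightarrow> subalgebra (G (Suc k)) (G k)"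
    and adapted: "\<And>k. k \<le> K \<Longrightarrow> X k \<in> borel_measurable (G k)"
    and int: "\<And>k. k \<le> K \<Longrightarrow> integrable M (X k)"
    and mart: "\<And>j k. j \<le> k \<Longrightarrow> k \<le> K \<Longrightarrow> AE \<omega> in M. real_cond_exp M (G j) (X k) \<omega> = X j \<omega>"
    and c_meas: "\<And>k. k < K \<Longrightarrow> c k \<in> borel_measurable (G k)"
    and c_bound: "\<And>k \<omega>. k < K \<Longrightarrow> \<omega> \<in> space M \<Longrightarrow> \<bar>c k \<omega>\<bar> \<le> 1"
    and lam: "0 < \<kappa>" and mu: "0 < \<mu>"
    and m: "m = (\<integral>\<omega>. \<bar>X K \<omega>\<bar> \<partial>M)"
  shows "whp M ((\<kappa>\<^sup>2 + 2 * \<kappa> * m) / (\<mu> / 2)\<^sup>2 + m / (\<mu> / 2))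
    (\<lambda>\<omega>. (\<forall>k\<le>K. \<bar>X k \<omega>\<bar> \<le> \<kappa>) \<longrightarrow> \<bar>\<Sum>k<K. c k \<omega> * (X (Suc k) \<omega> - X k \<omega>)\<bar> \<le> \<mu>)"
proof -
  have sfs: "sigma_finite_subalgebra M (G k)" if "k \<le> K" for k
    using sub[OF that] finite_measure_subalgebra_is_sigma_finite[of M "G k"]
    by (simp add: finite_measure_axioms finite_measure_subalgebra_axioms.intro finite_measure_subalgebra_def)
  have fromG: "f \<in> borel_measurable M" if "f \<in> borel_measurable (G k)" "k \<le> K" for f k
    using measurable_from_subalg[OF sub[OF that(2)] that(1)] .
  have up: "f \<in> borel_measurable (G (Suc k))" if "f \<in> borel_measurable (G k)" "k < K" for f :: "'a \<Rightarrow> real" and k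
    using measurable_from_subalg[OF mono[OF that(2)] that(1)] .
  have up': "f \<in> borel_measurable (G k)" if "f \<in> borel_measurable (G j)" "j \<le> k" "k \<le> K" for f :: "'a \<Rightarrow> real" and j k
    using that(2,3,1) by (induction k rule: dec_induct) (auto intro: up)
  have XM: "X k \<in> borel_measurable M" if "k \<le> K" for k
    using fromG adapted that by blast
  \<comment> \<open>the martingale property tested against bounded functions\<close>
  have test: "integrable M (\<lambda>\<omega>. H \<omega> * X k \<omega>)"
    "(\<integral>\<omega>. H \<omega> * X k \<omega> \<partial>M) = (\<integral>\<omega>. H \<omega> * X j \<omega> \<partial>M)"
    if jk: "j \<le> k" "k \<le> K" and H: "H \<in> borel_measurable (G j)" "\<And>\<omega>. \<omega> \<in> space M \<Longrightarrow> \<bar>H \<omega>\<bar> \<le> B" for H j k B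
  proof -
    interpret sigma_finite_subalgebra M "G j" using sfs jk by auto
    have HM: "H \<in> borel_measurable M" using fromG[OF H(1)] jk by auto
    show *: "integrable M (\<lambda>\<omega>. H \<omega> * X k \<omega>)"
    proof (rule Bochner_Integration.integrable_bound)
      show "integrable M (\<lambda>\<omega>. B * X k \<omega>)" using int jk by auto
      show "AE \<omega> in M. norm (H \<omega> * X k \<omega>) \<le> norm (B * X k \<omega>)"
        using H(2) by (intro AE_I2) (fastforce simp: abs_mult intro: mult_right_mono)
    qed (use HM XM jk in auto)
    have "(\<integral>\<omega>. H \<omega> * X k \<omega> \<partial>M) = (\<integral>\<omega>. H \<omega> * real_cond_exp M (G j) (X k) \<omega> \<partial>M)"
      using real_cond_exp_intg(2)[OF * H(1) XM[OF jk(2)]] by simp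
    also have "\<dots> = (\<integral>\<omega>. H \<omega> * X j \<omega> \<partial>M)"
      by (rule integral_cong_AE) (use mart[OF jk] HM XM jk fromG[OF borel_measurable_cond_exp] in auto)
    finally show "(\<integral>\<omega>. H \<omega> * X k \<omega> \<partial>M) = (\<integral>\<omega>. H \<omega> * X j \<omega> \<partial>M)" .
  qed
  define I where "I k \<omega> = (if \<forall>j\<le>k. \<bar>X j \<omega>\<bar> \<le> \<kappa> then 1 else 0 :: real)" for k \<omega>
  define d where "d k \<omega> = I k \<omega> * (clip \<kappa> (X (Suc k) \<omega>) - X k \<omega>)" for k \<omega>
  define r where "r k \<omega> = I k \<omega> * (X (Suc k) \<omega> - clip \<kappa> (X (Suc k) \<omega>))" for k \<omega>
  define e where "e k = real_cond_exp M (G k) (d k)" for k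
  define \<xi> where "\<xi> k \<omega> = d k \<omega> - e k \<omega>" for k \<omega>
  have I01: "I k \<omega> = 0 \<or> I k \<omega> = 1" for k \<omega> by (auto simp: I_def)
  have I_meas: "I k \<in> borel_measurable (G k)" if "k \<le> K" for k
  proof -
    have [measurable]: "X j \<in> borel_measurable (G k)" if "j \<in> {..k}" for j
      using up'[OF adapted] that \<open>k \<le> K\<close> by auto
    have "(\<lambda>\<omega>. if \<forall>j\<in>{..k}. \<bar>X j \<omega>\<bar> \<le> \<kappa> then 1 else 0 :: real) \<in> borel_measurable (G k)"
      by measurable
    then show ?thesis unfolding I_def[abs_def] by simp
  qed
  have d_meas: "d k \<in> borel_measurable (G (Suc k))" if "k < K" for k
  proof -
    have [measurable]: "I k \<in> borel_measurable (G (Suc k))" "X (Suc k) \<in> borel_measurable (G (Suc k))"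
      "X k \<in> borel_measurable (G (Suc k))"
      using up[OF I_meas that] adapted[of "Suc k"] up[OF adapted that] that by auto
    show ?thesis unfolding d_def[abs_def] using that by measurable
  qed
  have r_meas: "r k \<in> borel_measurable (G (Suc k))" if "k < K" for k
  proof -
    have [measurable]: "I k \<in> borel_measurable (G (Suc k))" "X (Suc k) \<in> borel_measurable (G (Suc k))"
      using up[OF I_meas that] adapted[of "Suc k"] that by auto
    show ?thesis unfolding r_def[abs_def] using that by measurable
  qed
  have dM: "d k \<in> borel_measurable M" if "k < K" for k using fromG[OF d_meas] that by auto
  have rM: "r k \<in> borel_measurable M" if "k < K" for k using fromG[OF r_meas] that by auto
  have d_bound: "\<bar>d k \<omega>\<bar> \<le> 2 * \<kappa>" for k \<omega>
  proof (cases "I k \<omega> = 1")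
    case True
    then have "\<bar>X k \<omega>\<bar> \<le> \<kappa>" by (auto simp: I_def split: if_splits)
    moreover have "\<bar>clip \<kappa> (X (Suc k) \<omega>)\<bar> \<le> \<kappa>" using lam by (auto simp: clip_def)
    ultimately show ?thesis using True by (simp add: d_def)
  next
    case False
    then show ?thesis using I01[of k \<omega>] lam by (simp add: d_def)
  qed
  have d_int: "integrable M (d k)" if "k < K" for k
    by (rule integrable_const_bound[where B="2 * \<kappa>"]) (use d_bound dM that in auto)
  have e_meas: "e k \<in> borel_measurable (G k)" for k unfolding e_def by simp
  have eM: "e k \<in> borel_measurable M" if "k \<le> K" for k using fromG[OF e_meas that] .
  have e_bound: "AE \<omega> in M. \<bar>e k \<omega>\<bar> \<le> 2 * \<kappa>" if "k < K" for k
  proof -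
    interpret sigma_finite_subalgebra M "G k" using sfs that by auto
    have d: "d k \<omega> \<le> 2 * \<kappa>" "- (2 * \<kappa>) \<le> d k \<omega>" for \<omega>
      using d_bound[of k \<omega>] by (auto simp: abs_le_iff)
    have "AE \<omega> in M. e k \<omega> \<le> 2 * \<kappa>"
      unfolding e_def using d by (intro real_cond_exp_le_c d_int that) auto
    moreover have "AE \<omega> in M. - (2 * \<kappa>) \<le> e k \<omega>"
      unfolding e_def using d by (intro real_cond_exp_ge_c d_int that) auto
    ultimately show ?thesis by eventually_elim auto
  qed
  have e_int: "integrable M (e k)" if "k < K" for k
    by (rule integrable_const_bound[where B="2 * \<kappa>"]) (use e_bound eM that in auto)
  have e_test: "(\<integral>\<omega>. H \<omega> * e k \<omega> \<partial>M) = (\<integral>\<omega>. H \<omega> * d k \<omega> \<partial>M)"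
    if "k < K" "H \<in> borel_measurable (G k)" "integrable M H" for H k
  proof -
    interpret sigma_finite_subalgebra M "G k" using sfs that by auto
    have "integrable M (\<lambda>\<omega>. H \<omega> * d k \<omega>)"
    proof (rule Bochner_Integration.integrable_bound)
      show "integrable M (\<lambda>\<omega>. 2 * \<kappa> * H \<omega>)" using that by auto
      show "AE \<omega> in M. norm (H \<omega> * d k \<omega>) \<le> norm (2 * \<kappa> * H \<omega>)"
        using lam mult_left_mono[OF d_bound[of k]] by (intro AE_I2) (auto simp: abs_mult mult.commute)
    qed (use fromG[OF that(2)] dM that in auto)
    then show ?thesis unfolding e_def using real_cond_exp_intg(2) that dM by blast
  qed
  have sq_int: "integrable M (\<lambda>\<omega>. (f \<omega>)\<^sup>2)"
    if "f \<in> borel_measurable M" "AE \<omega> in M. \<bar>f \<omega>\<bar> \<le> B" for f :: "'a \<Rightarrow> real" and B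
  proof (rule integrable_const_bound[where B="B\<^sup>2"])
    show "AE \<omega> in M. norm ((f \<omega>)\<^sup>2) \<le> B\<^sup>2"
      using that(2)
    proof eventually_elim
      case (elim \<omega>)
      from power_mono[OF this abs_ge_zero, of 2] show ?case by simp
    qed
  qed (use that in measurable)
  have d2: "integrable M (\<lambda>\<omega>. (d k \<omega>)\<^sup>2)" if "k < K" for k
    using sq_int[OF dM[OF that], of "2 * \<kappa>"] d_bound by auto
  have e2: "integrable M (\<lambda>\<omega>. (e k \<omega>)\<^sup>2)" if "k < K" for k
    using sq_int[OF eM, of k "2 * \<kappa>"] e_bound that by auto
  have ed: "integrable M (\<lambda>\<omega>. e k \<omega> * d k \<omega>)" if "k < K" for k
    using integrable_mult_of_square_integrable eM dM e2 d2 that by auto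
  have xi_expand: "(\<xi> k \<omega>)\<^sup>2 = (d k \<omega>)\<^sup>2 - 2 * (e k \<omega> * d k \<omega>) + (e k \<omega>)\<^sup>2" for k \<omega>
    by (simp add: \<xi>_def power2_diff)
  have xi2: "integrable M (\<lambda>\<omega>. (\<xi> k \<omega>)\<^sup>2)" if "k < K" for k
    unfolding xi_expand using d2 e2 ed that by auto
  have xi2_le: "(\<integral>\<omega>. (\<xi> k \<omega>)\<^sup>2 \<partial>M) \<le> (\<integral>\<omega>. (d k \<omega>)\<^sup>2 \<partial>M)" if "k < K" for k
  proof -
    have "(\<integral>\<omega>. (\<xi> k \<omega>)\<^sup>2 \<partial>M) =
      (\<integral>\<omega>. (d k \<omega>)\<^sup>2 \<partial>M) - 2 * (\<integral>\<omega>. e k \<omega> * d k \<omega> \<partial>M) + (\<integral>\<omega>. (e k \<omega>)\<^sup>2 \<partial>M)"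
      unfolding xi_expand using d2 e2 ed that by auto
    also have "(\<integral>\<omega>. e k \<omega> * d k \<omega> \<partial>M) = (\<integral>\<omega>. (e k \<omega>)\<^sup>2 \<partial>M)"
      using e_test[OF that e_meas e_int[OF that]] by (simp add: power2_eq_square)
    finally show ?thesis
      using integral_nonneg_AE[of "\<lambda>\<omega>. (e k \<omega>)\<^sup>2" M] by simp
  qed
  \<comment> \<open>\<open>I k - I (Suc k)\<close> indicates that \<open>Suc k\<close> is the exit time, so it lies in the past of \<open>X K\<close>\<close>
  have r_le: "\<bar>r k \<omega>\<bar> \<le> (I k \<omega> - I (Suc k) \<omega>) * \<bar>X (Suc k) \<omega>\<bar>" for k \<omega>
    using lam unfolding r_def I_def clip_def by (auto simp: le_Suc_eq abs_if min_def max_def)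
  have r_int: "integrable M (r k)" if "k < K" for k
  proof (rule Bochner_Integration.integrable_bound[OF int[of "Suc k"]])
    show "AE \<omega> in M. norm (r k \<omega>) \<le> norm (X (Suc k) \<omega>)"
      using lam unfolding r_def I_def clip_def by (intro AE_I2) (auto simp: abs_if min_def max_def)
  qed (use rM that in auto)
  have r_mean: "(\<integral>\<omega>. \<bar>r k \<omega>\<bar> \<partial>M) \<le> (\<integral>\<omega>. (I k \<omega> - I (Suc k) \<omega>) * \<bar>X K \<omega>\<bar> \<partial>M)" if "k < K" for k
  proof -
    let ?H = "\<lambda>\<omega>. (I k \<omega> - I (Suc k) \<omega>) * sgn (X (Suc k) \<omega>)"
    have I_diff: "0 \<le> I k \<omega> - I (Suc k) \<omega>" "I k \<omega> - I (Suc k) \<omega> \<le> 1" for \<omega>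
      unfolding I_def by auto
    have H: "?H \<in> borel_measurable (G (Suc k))" "\<And>\<omega>. \<bar>?H \<omega>\<bar> \<le> 1"
    proof -
      have [measurable]: "I k \<in> borel_measurable (G (Suc k))" "X (Suc k) \<in> borel_measurable (G (Suc k))"
        "I (Suc k) \<in> borel_measurable (G (Suc k))"
        using up[OF I_meas that] adapted[of "Suc k"] I_meas[of "Suc k"] that by auto
      show "?H \<in> borel_measurable (G (Suc k))" using that by measurable
      show "\<bar>?H \<omega>\<bar> \<le> 1" for \<omega> using I_diff[of \<omega>] by (auto simp: abs_mult sgn_if)
    qed
    have HM: "?H \<in> borel_measurable M" "(\<lambda>\<omega>. I k \<omega> - I (Suc k) \<omega>) \<in> borel_measurable M"
      using fromG[OF H(1)] fromG[OF I_meas[of k]] fromG[OF I_meas[of "Suc k"]] that by auto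
    have "(\<integral>\<omega>. \<bar>r k \<omega>\<bar> \<partial>M) \<le> (\<integral>\<omega>. ?H \<omega> * X (Suc k) \<omega> \<partial>M)"
    proof (rule integral_mono)
      show "integrable M (\<lambda>\<omega>. ?H \<omega> * X (Suc k) \<omega>)"
        using test(1)[of "Suc k" "Suc k" ?H 1] H that by auto
      show "\<bar>r k \<omega>\<bar> \<le> ?H \<omega> * X (Suc k) \<omega>" for \<omega>
      proof -
        have "sgn x * x = \<bar>x\<bar>" for x :: real by (simp add: sgn_if)
        then show ?thesis using r_le[of k \<omega>] by (simp only: mult.assoc)
      qed
    qed (use r_int that in auto)
    also have "\<dots> = (\<integral>\<omega>. ?H \<omega> * X K \<omega> \<partial>M)"
      using test(2)[of "Suc k" K ?H 1] H that by auto
    also have "\<dots> \<le> (\<integral>\<omega>. (I k \<omega> - I (Suc k) \<omega>) * \<bar>X K \<omega>\<bar> \<partial>M)"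
    proof (rule integral_mono)
      show "integrable M (\<lambda>\<omega>. ?H \<omega> * X K \<omega>)"
        using test(1)[of "Suc k" K ?H 1] H that by auto
      show "integrable M (\<lambda>\<omega>. (I k \<omega> - I (Suc k) \<omega>) * \<bar>X K \<omega>\<bar>)"
      proof (rule Bochner_Integration.integrable_bound[OF int[of K]])
        show "AE \<omega> in M. norm ((I k \<omega> - I (Suc k) \<omega>) * \<bar>X K \<omega>\<bar>) \<le> norm (X K \<omega>)"
          using I_diff by (intro AE_I2) (auto simp: abs_mult intro: mult_left_le_one_le)
      qed (use HM XM that in auto)
      fix \<omega>
      have "sgn (X (Suc k) \<omega>) * X K \<omega> \<le> \<bar>X K \<omega>\<bar>" by (auto simp: sgn_if)
      from mult_left_mono[OF this I_diff(1)[of \<omega>]]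
      show "?H \<omega> * X K \<omega> \<le> (I k \<omega> - I (Suc k) \<omega>) * \<bar>X K \<omega>\<bar>"
        by (simp add: mult.assoc)
    qed
    finally show ?thesis .
  qed
  have sum_r: "(\<Sum>k<K. \<integral>\<omega>. \<bar>r k \<omega>\<bar> \<partial>M) \<le> m"
  proof -
    have int1: "integrable M (\<lambda>\<omega>. I k \<omega> * \<bar>X K \<omega>\<bar>)" if "k \<le> K" for k
    proof (rule Bochner_Integration.integrable_bound[OF int[of K]])
      show "AE \<omega> in M. norm (I k \<omega> * \<bar>X K \<omega>\<bar>) \<le> norm (X K \<omega>)"
        by (intro AE_I2) (auto simp: I_def)
    qed (use fromG[OF I_meas] XM that in auto)
    have "(\<Sum>k<K. \<integral>\<omega>. \<bar>r k \<omega>\<bar> \<partial>M) \<le>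
        (\<Sum>k<K. (\<integral>\<omega>. I k \<omega> * \<bar>X K \<omega>\<bar> \<partial>M) - (\<integral>\<omega>. I (Suc k) \<omega> * \<bar>X K \<omega>\<bar> \<partial>M))"
      using r_mean int1 by (intro sum_mono) (auto simp: left_diff_distrib)
    also have "\<dots> = (\<integral>\<omega>. I 0 \<omega> * \<bar>X K \<omega>\<bar> \<partial>M) - (\<integral>\<omega>. I K \<omega> * \<bar>X K \<omega>\<bar> \<partial>M)"
      by (rule sum_lessThan_telescope')
    also have "\<dots> \<le> (\<integral>\<omega>. I 0 \<omega> * \<bar>X K \<omega>\<bar> \<partial>M)"
      by (simp add: integral_nonneg_AE I_def)
    also have "\<dots> \<le> m" unfolding m
    proof (rule integral_mono)
      show "I 0 \<omega> * \<bar>X K \<omega>\<bar> \<le> \<bar>X K \<omega>\<bar>" for \<omega> by (simp add: I_def)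
    qed (use int1 int in auto)
    finally show ?thesis .
  qed
  have e_le: "(\<integral>\<omega>. \<bar>e k \<omega>\<bar> \<partial>M) \<le> (\<integral>\<omega>. \<bar>r k \<omega>\<bar> \<partial>M)" if "k < K" for k
  proof -
    let ?H = "\<lambda>\<omega>. sgn (e k \<omega>)"
    have Hm: "?H \<in> borel_measurable (G k)" "?H \<in> borel_measurable M"
      using e_meas[of k] eM[of k] that by auto
    have Hi: "integrable M ?H"
      by (rule integrable_const_bound[where B=1]) (use Hm in \<open>auto simp: sgn_if\<close>)
    have HI: "(\<lambda>\<omega>. ?H \<omega> * I k \<omega>) \<in> borel_measurable (G k)" "\<And>\<omega>. \<bar>?H \<omega> * I k \<omega>\<bar> \<le> 1"
    proof -
      show "(\<lambda>\<omega>. ?H \<omega> * I k \<omega>) \<in> borel_measurable (G k)"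
        using Hm(1) I_meas[of k] that by (intro borel_measurable_times) auto
      show "\<bar>?H \<omega> * I k \<omega>\<bar> \<le> 1" for \<omega>
        using I01[of k \<omega>] by (auto simp: sgn_if)
    qed
    have Hr: "integrable M (\<lambda>\<omega>. ?H \<omega> * r k \<omega>)"
      by (rule Bochner_Integration.integrable_bound[OF r_int[OF that]])
        (use Hm rM that in \<open>auto simp: sgn_if\<close>)
    have "(\<integral>\<omega>. \<bar>e k \<omega>\<bar> \<partial>M) = (\<integral>\<omega>. ?H \<omega> * e k \<omega> \<partial>M)"
      by (simp add: abs_sgn mult.commute)
    also have "\<dots> = (\<integral>\<omega>. ?H \<omega> * d k \<omega> \<partial>M)"
      by (rule e_test[OF that Hm(1) Hi])
    also have "(\<lambda>\<omega>. ?H \<omega> * d k \<omega>) =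
        (\<lambda>\<omega>. (?H \<omega> * I k \<omega>) * X (Suc k) \<omega> - (?H \<omega> * I k \<omega>) * X k \<omega> - ?H \<omega> * r k \<omega>)"
      by (simp add: d_def r_def fun_eq_iff algebra_simps)
    also have "(\<integral>\<omega>. (?H \<omega> * I k \<omega>) * X (Suc k) \<omega> - (?H \<omega> * I k \<omega>) * X k \<omega> - ?H \<omega> * r k \<omega> \<partial>M) =
        - (\<integral>\<omega>. ?H \<omega> * r k \<omega> \<partial>M)"
      using test(1)[OF _ _ HI, of "Suc k"] test(1)[OF _ _ HI, of k] test(2)[OF _ _ HI, of "Suc k"] Hr that
      by auto
    also have "\<dots> \<le> (\<integral>\<omega>. \<bar>r k \<omega>\<bar> \<partial>M)"
      using Hr r_int[OF that] unfolding integral_minus[symmetric]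
      by (intro integral_mono) (auto simp: sgn_if)
    finally show ?thesis .
  qed
  have sum_e: "(\<Sum>k<K. \<integral>\<omega>. \<bar>e k \<omega>\<bar> \<partial>M) \<le> m"
    using sum_mono[of "{..<K}" "\<lambda>k. \<integral>\<omega>. \<bar>e k \<omega>\<bar> \<partial>M" "\<lambda>k. \<integral>\<omega>. \<bar>r k \<omega>\<bar> \<partial>M"] e_le sum_r by auto
  have sum_d2: "(\<Sum>k<K. \<integral>\<omega>. (d k \<omega>)\<^sup>2 \<partial>M) \<le> \<kappa>\<^sup>2 + 2 * \<kappa> * m"
  proof -
    \<comment> \<open>\<open>U\<close> is the square of the truncated and stopped martingale; it remains at \<open>\<kappa>\<^sup>2\<close> after the exit\<close>
    define U where "U k \<omega> = (if I k \<omega> = 1 then (X k \<omega>)\<^sup>2 else \<kappa>\<^sup>2)" for k \<omega>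
    have IX: "(\<lambda>\<omega>. I k \<omega> * X k \<omega>) \<in> borel_measurable (G k)" "\<bar>I k \<omega> * X k \<omega>\<bar> \<le> \<kappa>" if "k \<le> K" for k \<omega>
    proof -
      show "(\<lambda>\<omega>. I k \<omega> * X k \<omega>) \<in> borel_measurable (G k)"
        by (rule borel_measurable_times[OF I_meas[OF that] adapted[OF that]])
      show "\<bar>I k \<omega> * X k \<omega>\<bar> \<le> \<kappa>"
        using lam by (simp add: I_def)
    qed
    have IX_int: "integrable M (\<lambda>\<omega>. I k \<omega> * X k \<omega>)" if "k \<le> K" for k
      by (rule integrable_const_bound[where B=\<kappa>]) (use IX[OF that] fromG that in auto)
    have pt: "(d k \<omega>)\<^sup>2 = U (Suc k) \<omega> - U k \<omega> - 2 * (I k \<omega> * X k \<omega> * d k \<omega>)" for k \<omega>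
    proof (cases "I k \<omega> = 1")
      case True
      then have "(clip \<kappa> (X (Suc k) \<omega>))\<^sup>2 = U (Suc k) \<omega>"
        using lam by (auto simp: I_def U_def clip_def le_Suc_eq abs_if min_def max_def split: if_splits)
      then show ?thesis
        using True by (simp add: d_def U_def power2_eq_square algebra_simps)
    next
      case False
      then have Ik: "I k \<omega> = 0" using I01[of k \<omega>] by simp
      moreover have "I (Suc k) \<omega> \<le> I k \<omega>" unfolding I_def by auto
      ultimately have "I (Suc k) \<omega> = 0" using I01[of "Suc k" \<omega>] by auto
      with Ik show ?thesis by (simp add: d_def U_def)
    qed
    have Xd_int: "integrable M (\<lambda>\<omega>. I k \<omega> * X k \<omega> * d k \<omega>)" if "k < K" for k
    proof (rule integrable_mult_of_square_integrable)
      show "integrable M (\<lambda>\<omega>. (I k \<omega> * X k \<omega>)\<^sup>2)"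
        using IX[of k] fromG[OF IX(1)] that by (intro sq_int[of _ \<kappa>]) auto
    qed (use d2 dM fromG[OF IX(1)] that in auto)
    have Xe_int: "integrable M (\<lambda>\<omega>. I k \<omega> * X k \<omega> * e k \<omega>)" if "k < K" for k
    proof (rule integrable_mult_of_square_integrable)
      show "integrable M (\<lambda>\<omega>. (I k \<omega> * X k \<omega>)\<^sup>2)"
        using IX[of k] fromG[OF IX(1)] that by (intro sq_int[of _ \<kappa>]) auto
    qed (use e2 eM fromG[OF IX(1)] that in auto)
    have drift: "- 2 * (\<integral>\<omega>. I k \<omega> * X k \<omega> * d k \<omega> \<partial>M) \<le> 2 * \<kappa> * (\<integral>\<omega>. \<bar>e k \<omega>\<bar> \<partial>M)" if "k < K" for k
    proof -
      have "(\<integral>\<omega>. I k \<omega> * X k \<omega> * d k \<omega> \<partial>M) = (\<integral>\<omega>. I k \<omega> * X k \<omega> * e k \<omega> \<partial>M)"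
        using e_test[OF that IX(1) IX_int] that by auto
      moreover have "- (\<integral>\<omega>. I k \<omega> * X k \<omega> * e k \<omega> \<partial>M) \<le> (\<integral>\<omega>. \<kappa> * \<bar>e k \<omega>\<bar> \<partial>M)"
        unfolding integral_minus[symmetric]
      proof (rule integral_mono)
        fix \<omega>
        have "- (I k \<omega> * X k \<omega> * e k \<omega>) \<le> \<bar>I k \<omega> * X k \<omega>\<bar> * \<bar>e k \<omega>\<bar>"
          by (simp add: abs_mult[symmetric])
        also have "\<dots> \<le> \<kappa> * \<bar>e k \<omega>\<bar>" using IX(2)[of k \<omega>] that by (intro mult_right_mono) auto
        finally show "- (I k \<omega> * X k \<omega> * e k \<omega>) \<le> \<kappa> * \<bar>e k \<omega>\<bar>" .
      qed (use Xe_int e_int that in auto)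
      ultimately show ?thesis by simp
    qed
    have U_le: "0 \<le> U k \<omega> \<and> U k \<omega> \<le> \<kappa>\<^sup>2" for k \<omega>
      using lam by (auto simp: U_def I_def abs_le_square_iff[symmetric])
    have sum_int: "integrable M (\<lambda>\<omega>. \<Sum>k<K. (d k \<omega>)\<^sup>2 + 2 * (I k \<omega> * X k \<omega> * d k \<omega>))"
      using d2 Xd_int by auto
    have "(\<Sum>k<K. \<integral>\<omega>. (d k \<omega>)\<^sup>2 \<partial>M) =
        (\<integral>\<omega>. (\<Sum>k<K. (d k \<omega>)\<^sup>2 + 2 * (I k \<omega> * X k \<omega> * d k \<omega>)) \<partial>M)
        + (\<Sum>k<K. - 2 * (\<integral>\<omega>. I k \<omega> * X k \<omega> * d k \<omega> \<partial>M))"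
      using d2 Xd_int
      by (subst Bochner_Integration.integral_sum) (auto simp: sum_negf sum_distrib_left sum.distrib)
    also have "(\<integral>\<omega>. (\<Sum>k<K. (d k \<omega>)\<^sup>2 + 2 * (I k \<omega> * X k \<omega> * d k \<omega>)) \<partial>M) \<le> (\<integral>\<omega>. \<kappa>\<^sup>2 \<partial>M)"
    proof (rule integral_mono[OF sum_int])
      fix \<omega>
      have "(\<Sum>k<K. (d k \<omega>)\<^sup>2 + 2 * (I k \<omega> * X k \<omega> * d k \<omega>)) = (\<Sum>k<K. U (Suc k) \<omega> - U k \<omega>)"
        by (simp add: pt)
      also have "\<dots> = U K \<omega> - U 0 \<omega>" by (rule sum_lessThan_telescope)
      also have "\<dots> \<le> \<kappa>\<^sup>2" using U_le[of K \<omega>] U_le[of 0 \<omega>] by linarith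
      finally show "(\<Sum>k<K. (d k \<omega>)\<^sup>2 + 2 * (I k \<omega> * X k \<omega> * d k \<omega>)) \<le> \<kappa>\<^sup>2" .
    qed auto
    also have "(\<Sum>k<K. - 2 * (\<integral>\<omega>. I k \<omega> * X k \<omega> * d k \<omega> \<partial>M)) \<le>
        (\<Sum>k<K. 2 * \<kappa> * (\<integral>\<omega>. \<bar>e k \<omega>\<bar> \<partial>M))"
      using drift by (intro sum_mono) auto
    also have "\<dots> \<le> 2 * \<kappa> * m"
      using sum_e lam by (simp add: sum_distrib_left[symmetric])
    finally show ?thesis by (simp add: prob_space)
  qed
  have S: "integrable M (\<lambda>\<omega>. (\<Sum>k<K. c k \<omega> * \<xi> k \<omega>)\<^sup>2)"
    "(\<integral>\<omega>. (\<Sum>k<K. c k \<omega> * \<xi> k \<omega>)\<^sup>2 \<partial>M) \<le> \<kappa>\<^sup>2 + 2 * \<kappa> * m"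
  proof -
    have *: "integrable M (\<lambda>\<omega>. (\<Sum>k<K. c k \<omega> * \<xi> k \<omega>)\<^sup>2) \<and>
      (\<integral>\<omega>. (\<Sum>k<K. c k \<omega> * \<xi> k \<omega>)\<^sup>2 \<partial>M) \<le> (\<Sum>k<K. \<integral>\<omega>. (\<xi> k \<omega>)\<^sup>2 \<partial>M)"
    proof (rule orthogonal_sum_second_moment[where G=G and \<xi>=\<xi> and c=c and K=K and n=K, THEN conjunct2,
        OF sub mono _ xi2 _ c_meas c_bound order_refl])
      fix k assume k: "k < K"
      show "\<xi> k \<in> borel_measurable (G (Suc k))"
        unfolding \<xi>_def[abs_def] using d_meas[OF k] up[OF e_meas k] by auto
      fix H :: "'a \<Rightarrow> real" assume H: "H \<in> borel_measurable (G k)" "integrable M (\<lambda>\<omega>. (H \<omega>)\<^sup>2)"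
      have HM: "H \<in> borel_measurable M" using fromG[OF H(1)] k by auto
      have Hi: "integrable M H"
        using integrable_mult_of_square_integrable[of H "\<lambda>_. 1"] HM H by auto
      have "integrable M (\<lambda>\<omega>. H \<omega> * d k \<omega>)" "integrable M (\<lambda>\<omega>. H \<omega> * e k \<omega>)"
        using integrable_mult_of_square_integrable HM H(2) dM eM d2 e2 k by auto
      then show "(\<integral>\<omega>. H \<omega> * \<xi> k \<omega> \<partial>M) = 0"
        using e_test[OF k H(1) Hi] by (simp add: \<xi>_def right_diff_distrib)
    qed
    then show "integrable M (\<lambda>\<omega>. (\<Sum>k<K. c k \<omega> * \<xi> k \<omega>)\<^sup>2)" by blast
    have "(\<Sum>k<K. \<integral>\<omega>. (\<xi> k \<omega>)\<^sup>2 \<partial>M) \<le> (\<Sum>k<K. \<integral>\<omega>. (d k \<omega>)\<^sup>2 \<partial>M)"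
      using xi2_le by (intro sum_mono) auto
    with * sum_d2 show "(\<integral>\<omega>. (\<Sum>k<K. c k \<omega> * \<xi> k \<omega>)\<^sup>2 \<partial>M) \<le> \<kappa>\<^sup>2 + 2 * \<kappa> * m" by linarith
  qed
  have "whp M ((\<kappa>\<^sup>2 + 2 * \<kappa> * m) / (\<mu> / 2)\<^sup>2) (\<lambda>\<omega>. (\<Sum>k<K. c k \<omega> * \<xi> k \<omega>)\<^sup>2 \<le> (\<mu> / 2)\<^sup>2)"
    using S mu by (intro whp_of_expectation_le) auto
  moreover have "whp M (m / (\<mu> / 2)) (\<lambda>\<omega>. (\<Sum>k<K. \<bar>e k \<omega>\<bar>) \<le> \<mu> / 2)"
    using sum_e e_int mu by (intro whp_of_expectation_le) (auto simp: sum_nonneg)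
  ultimately show ?thesis
  proof (rule whp_mono[OF whp_conj])
    fix \<omega> assume om: "\<omega> \<in> space M"
      "(\<Sum>k<K. c k \<omega> * \<xi> k \<omega>)\<^sup>2 \<le> (\<mu> / 2)\<^sup>2 \<and> (\<Sum>k<K. \<bar>e k \<omega>\<bar>) \<le> \<mu> / 2"
    show "(\<forall>k\<le>K. \<bar>X k \<omega>\<bar> \<le> \<kappa>) \<longrightarrow> \<bar>\<Sum>k<K. c k \<omega> * (X (Suc k) \<omega> - X k \<omega>)\<bar> \<le> \<mu>"
    proof
      assume small: "\<forall>k\<le>K. \<bar>X k \<omega>\<bar> \<le> \<kappa>"
      have "X (Suc k) \<omega> - X k \<omega> = \<xi> k \<omega> + e k \<omega>" if "k < K" for k
      proof -
        have "I k \<omega> = 1" using small that by (auto simp: I_def)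
        moreover have "\<bar>X (Suc k) \<omega>\<bar> \<le> \<kappa>" using small that by auto
        then have "clip \<kappa> (X (Suc k) \<omega>) = X (Suc k) \<omega>" by (auto simp: clip_def abs_le_iff)
        ultimately show ?thesis by (simp add: \<xi>_def d_def)
      qed
      then have "(\<Sum>k<K. c k \<omega> * (X (Suc k) \<omega> - X k \<omega>)) =
          (\<Sum>k<K. c k \<omega> * \<xi> k \<omega>) + (\<Sum>k<K. c k \<omega> * e k \<omega>)"
        by (simp add: sum.distrib[symmetric] distrib_left)
      moreover have "\<bar>\<Sum>k<K. c k \<omega> * \<xi> k \<omega>\<bar> \<le> \<mu> / 2"
        using om(2) mu abs_le_square_iff[of "\<Sum>k<K. c k \<omega> * \<xi> k \<omega>" "\<mu> / 2"] by simp
      moreover have "\<bar>\<Sum>k<K. c k \<omega> * e k \<omega>\<bar> \<le> (\<Sum>k<K. \<bar>e k \<omega>\<bar>)"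
      proof (rule order_trans[OF sum_abs], rule sum_mono)
        fix k assume "k \<in> {..<K}"
        then show "\<bar>c k \<omega> * e k \<omega>\<bar> \<le> \<bar>e k \<omega>\<bar>"
          using c_bound[of k \<omega>] om(1) by (auto simp: abs_mult intro: mult_left_le_one_le)
      qed
      ultimately show "\<bar>\<Sum>k<K. c k \<omega> * (X (Suc k) \<omega> - X k \<omega>)\<bar> \<le> \<mu>"
        using om(2) by linarith
    qed
  qed simp_all
qed

end

section \<open>Good integrators\<close>

definition grid :: "real \<Rightarrow> real \<Rightarrow> nat \<Rightarrow> nat \<Rightarrow> real" where
  "grid a b n k = a + (b - a) * (real k / 2 ^ n)"

lemma grid_0 [simp]: "grid a b n 0 = a"
  by (simp add: grid_def)

lemma grid_last [simp]: "grid a b n (2 ^ n) = b"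
  by (simp add: grid_def)

lemma grid_mono: "a \<le> b \<Longrightarrow> j \<le> k \<Longrightarrow> grid a b n j \<le> grid a b n k"
  by (simp add: grid_def divide_right_mono mult_left_mono)

lemma grid_Suc_diff: "grid a b n (Suc k) - grid a b n k = (b - a) / 2 ^ n"
  by (simp add: grid_def field_simps)

lemma grid_in: "a \<le> b \<Longrightarrow> k \<le> 2 ^ n \<Longrightarrow> grid a b n k \<in> {a..b}"
  using grid_mono[of a b 0 k n] grid_mono[of a b k "2 ^ n" n] by simp

text \<open>
  Suprema over all dyadic times are measurable because there are only countably many of them.
\<close>
definition dyadics :: "real \<Rightarrow> real \<Rightarrow> real set" where
  "dyadics a b = {grid a b n k | n k. k \<le> 2 ^ n}"

lemma grid_dyadics [intro]: "k \<le> 2 ^ n \<Longrightarrow> grid a b n k \<in> dyadics a b"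
  by (auto simp: dyadics_def)

lemma countable_dyadics: "countable (dyadics a b)"
proof -
  have "dyadics a b \<subseteq> (\<lambda>(n, k). grid a b n k) ` UNIV"
    by (auto simp: dyadics_def)
  then show ?thesis by (rule countable_subset) simp
qed

lemma dyadics_subset: "a \<le> b \<Longrightarrow> dyadics a b \<subseteq> {a..b}"
  using grid_in by (auto simp: dyadics_def)

context prob_space
begin

lemma whp_path_bounded:
  fixes X :: "real \<Rightarrow> 'a \<Rightarrow> 'b::{second_countable_topology, real_normed_vector}"
  assumes ab: "a \<le> b" and meas: "\<And>t. t \<in> {a..b} \<Longrightarrow> X t \<in> borel_measurable M"
    and cont: "AE \<omega> in M. continuous_on {a..b} (\<lambda>t. X t \<omega>)" and eps: "0 < \<epsilon>"
  shows "\<exists>C>0. whp M \<epsilon> (\<lambda>\<omega>. \<forall>t\<in>dyadics a b. norm (X t \<omega>) \<le> C)"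
proof -
  have [measurable]: "X t \<in> borel_measurable M" if "t \<in> dyadics a b" for t
    using meas that dyadics_subset[OF ab] by auto
  have "\<exists>m::nat. whp M \<epsilon> (\<lambda>\<omega>. \<forall>t\<in>dyadics a b. norm (X t \<omega>) \<le> real m)"
  proof (rule whp_eventually[OF _ _ _ eps])
    fix m
    show "{\<omega> \<in> space M. \<not> (\<forall>t\<in>dyadics a b. norm (X t \<omega>) \<le> real m)} \<in> sets M"
      using countable_dyadics[of a b] by measurable
  next
    show "AE \<omega> in M. \<exists>m. \<forall>t\<in>dyadics a b. norm (X t \<omega>) \<le> real m"
      using cont
    proof eventually_elim
      case (elim \<omega>)
      then have "bounded ((\<lambda>t. X t \<omega>) ` {a..b})"
        by (intro compact_imp_bounded compact_continuous_image) auto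
      then obtain B where "\<forall>x\<in>(\<lambda>t. X t \<omega>) ` {a..b}. norm x \<le> B"
        unfolding bounded_iff by blast
      then have B: "\<And>t. t \<in> {a..b} \<Longrightarrow> norm (X t \<omega>) \<le> B" by blast
      obtain m where "B \<le> real m" using real_arch_simple by blast
      with B dyadics_subset[OF ab] show ?case
        by (intro exI[of _ m]) (meson order_trans subsetD)
    qed
  qed (force intro: order_trans)
  then obtain m where "whp M \<epsilon> (\<lambda>\<omega>. \<forall>t\<in>dyadics a b. norm (X t \<omega>) \<le> real m)" ..
  then have "whp M \<epsilon> (\<lambda>\<omega>. \<forall>t\<in>dyadics a b. norm (X t \<omega>) \<le> real m + 1)"
    by (rule whp_mono) (auto intro: order_trans[of _ "real m"])
  then show ?thesis by (intro exI[of _ "real m + 1"]) auto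
qed

lemma whp_path_modulus:
  fixes X :: "real \<Rightarrow> 'a \<Rightarrow> 'b::{second_countable_topology, real_normed_vector}"
  assumes ab: "a \<le> b" and meas: "\<And>t. t \<in> {a..b} \<Longrightarrow> X t \<in> borel_measurable M"
    and cont: "AE \<omega> in M. continuous_on {a..b} (\<lambda>t. X t \<omega>)" and eps: "0 < \<epsilon>" and eta: "0 < \<eta>"
  shows "\<exists>\<delta>>0. whp M \<epsilon>
    (\<lambda>\<omega>. \<forall>t\<in>dyadics a b. \<forall>s\<in>dyadics a b. \<bar>t - s\<bar> \<le> \<delta> \<longrightarrow> norm (X t \<omega> - X s \<omega>) \<le> \<eta>)"
proof -
  have [measurable]: "X t \<in> borel_measurable M" if "t \<in> dyadics a b" for t
    using meas that dyadics_subset[OF ab] by auto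
  let ?\<phi> = "\<lambda>m \<omega>. \<forall>t\<in>dyadics a b. \<forall>s\<in>dyadics a b.
    \<bar>t - s\<bar> \<le> inverse (Suc m) \<longrightarrow> norm (X t \<omega> - X s \<omega>) \<le> \<eta>"
  have "\<exists>m::nat. whp M \<epsilon> (?\<phi> m)"
  proof (rule whp_eventually[OF _ _ _ eps])
    fix m
    show "{\<omega> \<in> space M. \<not> ?\<phi> m \<omega>} \<in> sets M"
      using countable_dyadics[of a b] by measurable
  next
    fix m \<omega>
    have "inverse (real (Suc (Suc m))) \<le> inverse (Suc m)" by (simp add: field_simps)
    then show "?\<phi> m \<omega> \<Longrightarrow> ?\<phi> (Suc m) \<omega>" by (meson order_trans)
  next
    show "AE \<omega> in M. \<exists>m. ?\<phi> m \<omega>"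
      using cont
    proof eventually_elim
      case (elim \<omega>)
      then have "uniformly_continuous_on {a..b} (\<lambda>t. X t \<omega>)"
        by (intro compact_uniformly_continuous) auto
      then obtain d where d: "d > 0"
        "\<And>s t. s \<in> {a..b} \<Longrightarrow> t \<in> {a..b} \<Longrightarrow> dist t s < d \<Longrightarrow> dist (X t \<omega>) (X s \<omega>) < \<eta>"
        using eta unfolding uniformly_continuous_on_def by metis
      obtain m where m: "inverse (real (Suc m)) < d" using reals_Archimedean[OF d(1)] by auto
      have "?\<phi> m \<omega>"
      proof (intro ballI impI)
        fix t s assume "t \<in> dyadics a b" "s \<in> dyadics a b" "\<bar>t - s\<bar> \<le> inverse (real (Suc m))"
        then have "dist (X t \<omega>) (X s \<omega>) < \<eta>"
          using m dyadics_subset[OF ab] by (intro d(2)) (auto simp: dist_real_def)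
        then show "norm (X t \<omega> - X s \<omega>) \<le> \<eta>" by (simp add: dist_norm)
      qed
      then show ?case ..
    qed
  qed
  then obtain m where "whp M \<epsilon> (?\<phi> m)" ..
  then show ?thesis by (intro exI[of _ "inverse (real (Suc m))"]) simp
qed

end

abbreviation grid_integral ::
  "real \<Rightarrow> real \<Rightarrow> nat \<Rightarrow> (nat \<Rightarrow> 'a \<Rightarrow> 'b::real_inner) \<Rightarrow> (real \<Rightarrow> 'a \<Rightarrow> 'b) \<Rightarrow> 'a \<Rightarrow> real" where
  "grid_integral a b n c X \<omega> \<equiv>
     \<Sum>k<2 ^ n. c k \<omega> \<bullet> (X (grid a b n (Suc k)) \<omega> - X (grid a b n k) \<omega>)"

abbreviation unit_integrand ::
  "'a measure \<Rightarrow> (real \<Rightarrow> 'a measure) \<Rightarrow> real \<Rightarrow> real \<Rightarrow> nat \<Rightarrow> (nat \<Rightarrow> 'a \<Rightarrow> 'b::euclidean_space) \<Rightarrow> bool" where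
  "unit_integrand P F a b n c \<equiv>
     \<forall>k<2 ^ n. c k \<in> borel_measurable (F (grid a b n k)) \<and> (\<forall>\<omega>\<in>space P. norm (c k \<omega>) \<le> 1)"

text \<open>
  Boundedness in probability of the elementary integrals over all dyadic grids, uniformly in the adapted
  integrands bounded by one.  This is the property by which the Bichteler-Dellacherie theorem
  characterises semimartingales; it depends only on the null sets of the measure, up to the choice of
  the bound \<open>\<kappa>\<close>.
\<close>
definition good_integrator ::
  "'a measure \<Rightarrow> (real \<Rightarrow> 'a measure) \<Rightarrow> real \<Rightarrow> real \<Rightarrow> (real \<Rightarrow> 'a \<Rightarrow> 'b::euclidean_space) \<Rightarrow> bool"
where
  "good_integrator P F a b X \<longleftrightarrow> (\<forall>\<epsilon>>0. \<exists>\<kappa>\<ge>0. \<forall>n c.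
     unit_integrand P F a b n c \<longrightarrow>
     whp P \<epsilon> (\<lambda>\<omega>. \<bar>grid_integral a b n c X \<omega>\<bar> \<le> \<kappa>))"

lemma good_integratorE:
  assumes "good_integrator P F a b X" "0 < \<epsilon>"
  obtains \<kappa> where "0 \<le> \<kappa>"
    "\<And>n c. unit_integrand P F a b n c \<Longrightarrow>
      whp P \<epsilon> (\<lambda>\<omega>. \<bar>grid_integral a b n c X \<omega>\<bar> \<le> \<kappa>)"
  using assms unfolding good_integrator_def by meson

lemma good_integrator_uniform_measure:
  assumes "finite_measure M" "A \<in> sets M" and pos: "0 < measure M A" and good: "good_integrator M F a b X"
  shows "good_integrator (uniform_measure M A) F a b X"
  unfolding good_integrator_def
proof (intro allI impI)
  fix \<epsilon> :: real assume "0 < \<epsilon>"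
  then have "0 < \<epsilon> * measure M A" using pos by simp
  with good obtain \<kappa> where "0 \<le> \<kappa>" and
    \<kappa>: "\<And>n c. unit_integrand M F a b n c \<Longrightarrow>
      whp M (\<epsilon> * measure M A) (\<lambda>\<omega>. \<bar>grid_integral a b n c X \<omega>\<bar> \<le> \<kappa>)"
    by (rule good_integratorE) blast
  show "\<exists>\<kappa>\<ge>0. \<forall>n c. unit_integrand (uniform_measure M A) F a b n c \<longrightarrow>
    whp (uniform_measure M A) \<epsilon>
      (\<lambda>\<omega>. \<bar>grid_integral a b n c X \<omega>\<bar> \<le> \<kappa>)"
  proof (intro exI[of _ \<kappa>] conjI \<open>0 \<le> \<kappa>\<close> allI impI)
    fix n and c :: "nat \<Rightarrow> 'a \<Rightarrow> 'b"
    assume c: "unit_integrand (uniform_measure M A) F a b n c"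
    have "whp M (\<epsilon> * measure M A)
      (\<lambda>\<omega>. \<bar>grid_integral a b n c X \<omega>\<bar> \<le> \<kappa>)"
      using c by (intro \<kappa>) simp
    from whp_uniform_measure[OF this assms(2,1)] pos
    show "whp (uniform_measure M A) \<epsilon>
      (\<lambda>\<omega>. \<bar>grid_integral a b n c X \<omega>\<bar> \<le> \<kappa>)"
      by simp
  qed
qed

lemma (in prob_space) good_integrator_add:
  fixes X Y Z :: "real \<Rightarrow> 'a \<Rightarrow> 'b::euclidean_space"
  assumes ab: "a \<le> b" and X: "good_integrator M F a b X" and Y: "good_integrator M F a b Y"
    and Z: "AE \<omega> in M. \<forall>t\<in>{a..b}. Z t \<omega> = X t \<omega> + Y t \<omega>"
  shows "good_integrator M F a b Z"
  unfolding good_integrator_def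
proof (intro allI impI)
  fix \<epsilon> :: real assume "0 < \<epsilon>"
  then have e: "0 < \<epsilon> / 2" by simp
  let ?S = "\<lambda>(X :: real \<Rightarrow> 'a \<Rightarrow> 'b) n c \<omega>. \<bar>grid_integral a b n c X \<omega>\<bar>"
  obtain \<kappa> where "0 \<le> \<kappa>" and
    \<kappa>: "\<And>n c. unit_integrand M F a b n c \<Longrightarrow> whp M (\<epsilon> / 2) (\<lambda>\<omega>. ?S X n c \<omega> \<le> \<kappa>)"
    using good_integratorE[OF X e] by blast
  obtain \<kappa>' where "0 \<le> \<kappa>'" and
    \<kappa>': "\<And>n c. unit_integrand M F a b n c \<Longrightarrow> whp M (\<epsilon> / 2) (\<lambda>\<omega>. ?S Y n c \<omega> \<le> \<kappa>')"
    using good_integratorE[OF Y e] by blast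
  show "\<exists>\<kappa>\<ge>0. \<forall>n c. unit_integrand M F a b n c \<longrightarrow> whp M \<epsilon> (\<lambda>\<omega>. ?S Z n c \<omega> \<le> \<kappa>)"
  proof (intro exI[of _ "\<kappa> + \<kappa>'"] conjI allI impI)
    show "0 \<le> \<kappa> + \<kappa>'" using \<open>0 \<le> \<kappa>\<close> \<open>0 \<le> \<kappa>'\<close> by simp
    fix n and c :: "nat \<Rightarrow> 'a \<Rightarrow> 'b"
    assume c: "unit_integrand M F a b n c"
    have 1: "whp M (\<epsilon> / 2) (\<lambda>\<omega>. ?S X n c \<omega> \<le> \<kappa>)" using c by (rule \<kappa>)
    have 2: "whp M (\<epsilon> / 2) (\<lambda>\<omega>. ?S Y n c \<omega> \<le> \<kappa>')" using c by (rule \<kappa>')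
    have 3: "whp M 0 (\<lambda>\<omega>. \<forall>t\<in>{a..b}. Z t \<omega> = X t \<omega> + Y t \<omega>)"
      using Z by (rule whp_of_AE) simp
    from whp_conj[OF 1 whp_conj[OF 2 3]]
    show "whp M \<epsilon> (\<lambda>\<omega>. ?S Z n c \<omega> \<le> \<kappa> + \<kappa>')"
    proof (rule whp_mono)
      fix \<omega> assume *: "?S X n c \<omega> \<le> \<kappa> \<and> ?S Y n c \<omega> \<le> \<kappa>' \<and> (\<forall>t\<in>{a..b}. Z t \<omega> = X t \<omega> + Y t \<omega>)"
      have "Z (grid a b n k) \<omega> = X (grid a b n k) \<omega> + Y (grid a b n k) \<omega>" if "k \<le> 2 ^ n" for k
        using * grid_in[OF ab that] by blast
      then have "(grid_integral a b n c Z \<omega>) =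
         (grid_integral a b n c X \<omega>) +
         (grid_integral a b n c Y \<omega>)"
        unfolding sum.distrib[symmetric] by (intro sum.cong) (auto simp: algebra_simps)
      with * show "?S Z n c \<omega> \<le> \<kappa> + \<kappa>'" by linarith
    qed simp
  qed
qed

lemma measurable_component: "(\<lambda>x :: real ^ 'd. x $ j) \<in> borel_measurable borel"
  by (intro borel_measurable_continuous_onI continuous_intros)

lemma (in prob_space) good_integrator_vec:
  fixes X :: "real \<Rightarrow> 'a \<Rightarrow> real ^ 'd"
  assumes X: "\<And>j. good_integrator M F a b (\<lambda>t \<omega>. X t \<omega> $ j)"
  shows "good_integrator M F a b X"
  unfolding good_integrator_def
proof (intro allI impI)
  fix \<epsilon> :: real assume "0 < \<epsilon>"
  then have e: "0 < \<epsilon> / CARD('d)" by simp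
  let ?P = "\<lambda>j \<kappa>. 0 \<le> \<kappa> \<and> (\<forall>n c. unit_integrand M F a b n c \<longrightarrow> whp M (\<epsilon> / CARD('d))
    (\<lambda>\<omega>. \<bar>\<Sum>k<2 ^ n. c k \<omega> \<bullet> (X (grid a b n (Suc k)) \<omega> $ j - X (grid a b n k) \<omega> $ j)\<bar> \<le> \<kappa>))"
  have ex: "\<forall>j. \<exists>\<kappa>. ?P j \<kappa>"
    using X e unfolding good_integrator_def by blast
  obtain \<kappa> where all: "\<forall>j. ?P j (\<kappa> j)"
    using choice[OF ex] ..
  note \<kappa> = spec[OF all, THEN conjunct1] spec[OF all, THEN conjunct2, THEN spec, THEN spec, THEN mp]
  show "\<exists>\<kappa>\<ge>0. \<forall>n c. unit_integrand M F a b n c \<longrightarrow> whp M \<epsilon>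
    (\<lambda>\<omega>. \<bar>grid_integral a b n c X \<omega>\<bar> \<le> \<kappa>)"
  proof (intro exI[of _ "\<Sum>j\<in>UNIV. \<kappa> j"] conjI allI impI)
    show "0 \<le> (\<Sum>j\<in>UNIV. \<kappa> j)" using \<kappa>(1) by (simp add: sum_nonneg)
    fix n and c :: "nat \<Rightarrow> 'a \<Rightarrow> real ^ 'd"
    assume c: "unit_integrand M F a b n c"
    have "whp M (\<epsilon> / CARD('d)) (\<lambda>\<omega>. \<bar>\<Sum>k<2 ^ n. c k \<omega> $ j \<bullet>
        (X (grid a b n (Suc k)) \<omega> $ j - X (grid a b n k) \<omega> $ j)\<bar> \<le> \<kappa> j)" for j
    proof (rule \<kappa>(2), intro allI impI conjI ballI)
      fix k :: nat assume k: "k < 2 ^ n"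
      then show "(\<lambda>\<omega>. c k \<omega> $ j) \<in> borel_measurable (F (grid a b n k))"
        using c measurable_compose[of "c k", OF _ measurable_component] by blast
      fix \<omega> assume "\<omega> \<in> space M"
      with c k have "norm (c k \<omega>) \<le> 1" by blast
      then show "norm (c k \<omega> $ j) \<le> 1"
        using component_le_norm_cart[of "c k \<omega>" j] by simp
    qed
    then have "whp M (real (card (UNIV :: 'd set)) * (\<epsilon> / CARD('d))) (\<lambda>\<omega>. \<forall>j\<in>UNIV. \<bar>\<Sum>k<2 ^ n. c k \<omega> $ j \<bullet>
        (X (grid a b n (Suc k)) \<omega> $ j - X (grid a b n k) \<omega> $ j)\<bar> \<le> \<kappa> j)"
      by (intro whp_ball) auto
    then show "whp M \<epsilon> (\<lambda>\<omega>. \<bar>grid_integral a b n c X \<omega>\<bar> \<le> (\<Sum>j\<in>UNIV. \<kappa> j))"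
    proof (rule whp_mono)
      fix \<omega> assume *: "\<forall>j\<in>UNIV. \<bar>\<Sum>k<2 ^ n. c k \<omega> $ j \<bullet>
        (X (grid a b n (Suc k)) \<omega> $ j - X (grid a b n k) \<omega> $ j)\<bar> \<le> \<kappa> j"
      have "(grid_integral a b n c X \<omega>) =
        (\<Sum>j\<in>UNIV. \<Sum>k<2 ^ n. c k \<omega> $ j \<bullet> (X (grid a b n (Suc k)) \<omega> $ j - X (grid a b n k) \<omega> $ j))"
        by (subst sum.swap) (simp add: inner_vec_def)
      also have "\<bar>\<dots>\<bar> \<le> (\<Sum>j\<in>UNIV. \<kappa> j)"
        by (rule order_trans[OF sum_abs], rule sum_mono) (use * in auto)
      finally show "\<bar>grid_integral a b n c X \<omega>\<bar> \<le> (\<Sum>j\<in>UNIV. \<kappa> j)" .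
    qed simp
  qed
qed

lemma (in prob_space) good_integrator_bounded_variation:
  fixes A :: "real \<Rightarrow> 'a \<Rightarrow> real"
  assumes ab: "0 \<le> a" "a \<le> b" and meas: "\<And>t. 0 \<le> t \<Longrightarrow> A t \<in> borel_measurable M"
    and bv: "AE \<omega> in M. bounded_variation (\<lambda>u. A u \<omega>) 0 b"
  shows "good_integrator M F a b A"
  unfolding good_integrator_def
proof (intro allI impI)
  fix \<epsilon> :: real assume eps: "0 < \<epsilon>"
  let ?d = "\<lambda>n k \<omega>. A (grid a b n (Suc k)) \<omega> - A (grid a b n k) \<omega>"
  have gm: "A (grid a b n k) \<in> borel_measurable M" for n k
    using ab by (intro meas) (simp add: grid_def)
  have "\<exists>m::nat. whp M \<epsilon> (\<lambda>\<omega>. \<forall>n. (\<Sum>k<2 ^ n. \<bar>?d n k \<omega>\<bar>) \<le> real m)"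
  proof (rule whp_eventually[OF _ _ _ eps])
    note [measurable] = gm
    show "{\<omega> \<in> space M. \<not> (\<forall>n. (\<Sum>k<2 ^ n. \<bar>?d n k \<omega>\<bar>) \<le> real m)} \<in> sets M" for m
      by measurable
    show "AE \<omega> in M. \<exists>m. \<forall>n. (\<Sum>k<2 ^ n. \<bar>?d n k \<omega>\<bar>) \<le> real m"
      using bv
    proof eventually_elim
      case (elim \<omega>)
      then obtain C where C: "\<And>K s. partition_of 0 b K s \<Longrightarrow> (\<Sum>k<K. \<bar>A (s (Suc k)) \<omega> - A (s k) \<omega>\<bar>) \<le> C"
        unfolding bounded_variation_def by blast
      obtain m where m: "C \<le> real m" using real_arch_simple by blast
      have "(\<Sum>k<2 ^ n. \<bar>?d n k \<omega>\<bar>) \<le> real m" for n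
      proof -
        \<comment> \<open>the variation is known on \<open>[0, b]\<close>, so the grid of \<open>[a, b]\<close> is completed by the point \<open>0\<close>\<close>
        define s where "s k = (case k of 0 \<Rightarrow> 0 | Suc j \<Rightarrow> grid a b n j)" for k
        have "partition_of 0 b (Suc (2 ^ n)) s"
          unfolding partition_of_def using ab grid_mono[of a b _ _ n]
          by (auto simp: s_def split: nat.split)
        from C[OF this] have "(\<Sum>k<2 ^ n. \<bar>A (s (Suc (Suc k))) \<omega> - A (s (Suc k)) \<omega>\<bar>) \<le> C"
          unfolding sum.lessThan_Suc_shift using abs_ge_zero[of "A (s (Suc 0)) \<omega> - A (s 0) \<omega>"] by linarith
        with m show ?thesis by (simp add: s_def)
      qed
      then show ?case by blast
    qed
    show "\<forall>n. (\<Sum>k<2 ^ n. \<bar>?d n k \<omega>\<bar>) \<le> real (Suc m)"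
      if "\<forall>n. (\<Sum>k<2 ^ n. \<bar>?d n k \<omega>\<bar>) \<le> real m" for m \<omega>
      using that by (meson of_nat_le_iff le_Suc_eq order_trans order_refl)
  qed
  then obtain m where m: "whp M \<epsilon> (\<lambda>\<omega>. \<forall>n. (\<Sum>k<2 ^ n. \<bar>?d n k \<omega>\<bar>) \<le> real m)" ..
  show "\<exists>\<kappa>\<ge>0. \<forall>n c. unit_integrand M F a b n c \<longrightarrow> whp M \<epsilon> (\<lambda>\<omega>. \<bar>\<Sum>k<2 ^ n. c k \<omega> \<bullet> ?d n k \<omega>\<bar> \<le> \<kappa>)"
  proof (intro exI[of _ "real m"] conjI allI impI whp_mono[OF m order_refl])
    fix n \<omega> and c :: "nat \<Rightarrow> 'a \<Rightarrow> real"
    assume c: "unit_integrand M F a b n c"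
      and om: "\<omega> \<in> space M" and le: "\<forall>n. (\<Sum>k<2 ^ n. \<bar>?d n k \<omega>\<bar>) \<le> real m"
    have "\<bar>\<Sum>k<2 ^ n. c k \<omega> \<bullet> ?d n k \<omega>\<bar> \<le> (\<Sum>k<2 ^ n. \<bar>?d n k \<omega>\<bar>)"
    proof (rule order_trans[OF sum_abs], rule sum_mono)
      fix k :: nat assume "k \<in> {..<2 ^ n}"
      then have "\<bar>c k \<omega>\<bar> \<le> 1" using c om by auto
      then show "\<bar>c k \<omega> \<bullet> ?d n k \<omega>\<bar> \<le> \<bar>?d n k \<omega>\<bar>"
        by (simp add: abs_mult mult_left_le_one_le)
    qed
    also have "\<dots> \<le> real m" using le by blast
    finally show "\<bar>\<Sum>k<2 ^ n. c k \<omega> \<bullet> ?d n k \<omega>\<bar> \<le> real m" .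
  qed simp
qed

locale filtered_prob_space = prob_space M + filtration "space M" F
  for M :: "'a measure" and F :: "real \<Rightarrow> 'a measure" +
  assumes F_sub: "sets (F t) \<subseteq> events"
begin

lemma subalgebra_F: "subalgebra M (F t)"
  using F_sub space_F by (simp add: subalgebra_def)

lemma subalgebra_F_mono: "s \<le> t \<Longrightarrow> subalgebra (F t) (F s)"
  using sets_F_mono space_F by (simp add: subalgebra_def)

lemma measurable_F_M: "f \<in> measurable (F t) N \<Longrightarrow> f \<in> measurable M N"
  by (rule measurable_from_subalg[OF subalgebra_F])

lemma measurable_F_mono: "f \<in> measurable (F s) N \<Longrightarrow> s \<le> t \<Longrightarrow> f \<in> measurable (F t) N"
  by (rule measurable_from_subalg[OF subalgebra_F_mono])

text \<open>
  Up to a small probability the localising time \<open>T N\<close> lies beyond \<open>b\<close> and the path is bounded on the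
  dyadic times, so that the truncated inequality for the stopped martingale applies.  Its bound involves
  only the absolute mean at the final time and is therefore the same for all grids.
\<close>
lemma good_integrator_local_martingale:
  assumes ab: "0 \<le> a" "a \<le> b" and L: "continuous_local_martingale M F L"
  shows "good_integrator M F a b L"
  unfolding good_integrator_def
proof (intro allI impI)
  fix \<epsilon> :: real assume eps: "0 < \<epsilon>"
  obtain T where adap: "adapted F L" and cont: "continuous_paths M L"
    and T: "\<And>n. stopping_time F (T n)" "\<And>n \<omega>. \<omega> \<in> space M \<Longrightarrow> 0 \<le> T n \<omega>"
    and lim: "AE \<omega> in M. incseq (\<lambda>n. T n \<omega>) \<and> filterlim (\<lambda>n. T n \<omega>) at_top sequentially"
    and mart: "\<And>n. martingale M F (\<lambda>t \<omega>. L (min t (T n \<omega>)) \<omega> - L 0 \<omega>)"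
    using L unfolding continuous_local_martingale_def by auto
  have LM: "L t \<in> borel_measurable M" if "0 \<le> t" for t
    using adap that measurable_F_M unfolding adapted_def by blast
  have "\<exists>N. whp M (\<epsilon> / 4) (\<lambda>\<omega>. \<forall>n\<ge>N. b < T n \<omega>)"
  proof (rule whp_eventually)
    have [measurable]: "Measurable.pred M (\<lambda>\<omega>. T n \<omega> \<le> b)" for n
      using T(1)[of n] measurable_F_M unfolding stopping_time_def by blast
    show "{\<omega> \<in> space M. \<not> (\<forall>n\<ge>N. b < T n \<omega>)} \<in> events" for N
      unfolding not_le[symmetric] by measurable
    show "AE \<omega> in M. \<exists>N. \<forall>n\<ge>N. b < T n \<omega>"
      using lim
    proof eventually_elim
      case (elim \<omega>)
      then have "eventually (\<lambda>n. b < T n \<omega>) sequentially"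
        by (auto simp: filterlim_at_top_dense)
      then show ?case by (auto simp: eventually_sequentially)
    qed
  qed (use eps in auto)
  then obtain N where N: "whp M (\<epsilon> / 4) (\<lambda>\<omega>. \<forall>n\<ge>N. b < T n \<omega>)" ..
  have "\<exists>C>0. whp M (\<epsilon> / 4) (\<lambda>\<omega>. \<forall>t\<in>dyadics a b. norm (L t \<omega> - L 0 \<omega>) \<le> C)"
  proof (rule whp_path_bounded[OF ab(2)])
    show "(\<lambda>\<omega>. L t \<omega> - L 0 \<omega>) \<in> borel_measurable M" if "t \<in> {a..b}" for t
      using LM[of t] LM[of 0] that ab by auto
    show "AE \<omega> in M. continuous_on {a..b} (\<lambda>t. L t \<omega> - L 0 \<omega>)"
      using cont unfolding continuous_paths_def
      by eventually_elim (use ab in \<open>auto intro!: continuous_intros elim: continuous_on_subset\<close>)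
  qed (use eps in auto)
  then obtain C where C: "C > 0" "whp M (\<epsilon> / 4) (\<lambda>\<omega>. \<forall>t\<in>dyadics a b. norm (L t \<omega> - L 0 \<omega>) \<le> C)"
    by blast
  define X where "X t \<omega> = L (min t (T N \<omega>)) \<omega> - L 0 \<omega>" for t \<omega>
  have X_adap: "X t \<in> borel_measurable (F t)" and X_int: "integrable M (X t)" if "0 \<le> t" for t
    using mart[of N] that unfolding martingale_def adapted_def X_def[abs_def] by auto
  have X_mart: "AE \<omega> in M. real_cond_exp M (F s) (X t) \<omega> = X s \<omega>" if "0 \<le> s" "s \<le> t" for s t
    using mart[of N] that unfolding martingale_def X_def[abs_def] by auto
  define m where "m = (\<integral>\<omega>. \<bar>X b \<omega>\<bar> \<partial>M)"
  have m0: "0 \<le> m" unfolding m_def by (simp add: integral_nonneg_AE)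
  \<comment> \<open>\<open>x \<ge> 1\<close> allows the two terms of the bound to be estimated together over the denominator \<open>x\<close>\<close>
  define x where "x = 1 + 4 * (C\<^sup>2 + 2 * C * m + m) / \<epsilon>"
  have x1: "1 \<le> x" unfolding x_def using eps C m0 by simp
  have x_le: "(C\<^sup>2 + 2 * C * m) / x\<^sup>2 + m / x \<le> \<epsilon> / 4"
  proof -
    have "(C\<^sup>2 + 2 * C * m) / x\<^sup>2 \<le> (C\<^sup>2 + 2 * C * m) / x"
      using x1 C m0 by (intro divide_left_mono) (auto simp: power2_eq_square)
    then have "(C\<^sup>2 + 2 * C * m) / x\<^sup>2 + m / x \<le> (C\<^sup>2 + 2 * C * m + m) / x"
      by (simp add: add_divide_distrib)
    also have "\<dots> \<le> \<epsilon> / 4"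
    proof -
      have "4 * (C\<^sup>2 + 2 * C * m + m) = \<epsilon> * (x - 1)" unfolding x_def using eps by simp
      also have "\<dots> \<le> \<epsilon> * x" using eps by simp
      finally show ?thesis using x1 by (simp add: field_simps)
    qed
    finally show ?thesis .
  qed
  show "\<exists>\<kappa>\<ge>0. \<forall>n c. unit_integrand M F a b n c \<longrightarrow> whp M \<epsilon>
    (\<lambda>\<omega>. \<bar>grid_integral a b n c L \<omega>\<bar> \<le> \<kappa>)"
  proof (intro exI[of _ "2 * x"] conjI allI impI)
    show "0 \<le> 2 * x" using x1 by simp
    fix n and c :: "nat \<Rightarrow> 'a \<Rightarrow> real"
    assume c: "unit_integrand M F a b n c"
    have g0: "0 \<le> grid a b n k" for k using ab by (simp add: grid_def)
    have "whp M ((C\<^sup>2 + 2 * C * m) / (2 * x / 2)\<^sup>2 + m / (2 * x / 2))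
      (\<lambda>\<omega>. (\<forall>k\<le>2 ^ n. \<bar>X (grid a b n k) \<omega>\<bar> \<le> C) \<longrightarrow>
        \<bar>\<Sum>k<2 ^ n. c k \<omega> * (X (grid a b n (Suc k)) \<omega> - X (grid a b n k) \<omega>)\<bar> \<le> 2 * x)"
    proof (rule martingale_transform_truncated[where G="\<lambda>k. F (grid a b n k)" and X="\<lambda>k. X (grid a b n k)"])
      show "AE \<omega> in M. real_cond_exp M (F (grid a b n j)) (X (grid a b n k)) \<omega> = X (grid a b n j) \<omega>"
        if "j \<le> k" for j k using g0 grid_mono[OF ab(2) that] by (intro X_mart) auto
    qed (use subalgebra_F subalgebra_F_mono[OF grid_mono[OF ab(2)]] X_adap X_int g0 c C x1 m_def in auto)
    then have "whp M (\<epsilon> / 4) (\<lambda>\<omega>. (\<forall>k\<le>2 ^ n. \<bar>X (grid a b n k) \<omega>\<bar> \<le> C) \<longrightarrow>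
        \<bar>\<Sum>k<2 ^ n. c k \<omega> * (X (grid a b n (Suc k)) \<omega> - X (grid a b n k) \<omega>)\<bar> \<le> 2 * x)"
      by (rule whp_mono) (use x_le in auto)
    from whp_conj[OF this whp_conj[OF N C(2)]]
    show "whp M \<epsilon> (\<lambda>\<omega>. \<bar>grid_integral a b n c L \<omega>\<bar> \<le> 2 * x)"
    proof (rule whp_mono)
      show "\<epsilon> / 4 + (\<epsilon> / 4 + \<epsilon> / 4) \<le> \<epsilon>" using eps by simp
      fix \<omega> assume *: "((\<forall>k\<le>2 ^ n. \<bar>X (grid a b n k) \<omega>\<bar> \<le> C) \<longrightarrow>
        \<bar>\<Sum>k<2 ^ n. c k \<omega> * (X (grid a b n (Suc k)) \<omega> - X (grid a b n k) \<omega>)\<bar> \<le> 2 * x) \<and>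
        (\<forall>n\<ge>N. b < T n \<omega>) \<and> (\<forall>t\<in>dyadics a b. norm (L t \<omega> - L 0 \<omega>) \<le> C)"
      have "X (grid a b n k) \<omega> = L (grid a b n k) \<omega> - L 0 \<omega>" if "k \<le> 2 ^ n" for k
      proof -
        have "grid a b n k < T N \<omega>"
          using * grid_in[OF ab(2) that] by (meson atLeastAtMost_iff le_less_trans order_refl)
        then show ?thesis by (simp add: X_def)
      qed
      moreover from this have "\<forall>k\<le>2 ^ n. \<bar>X (grid a b n k) \<omega>\<bar> \<le> C"
        using * grid_dyadics by (metis real_norm_def)
      ultimately show "\<bar>grid_integral a b n c L \<omega>\<bar> \<le> 2 * x"
        using * by simp
    qed
  qed
qed

lemma good_integrator_semimartingale:
  assumes ab: "0 \<le> a" "a \<le> b" and X: "continuous_semimartingale M F X"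
  shows "good_integrator M F a b X"
proof -
  obtain L A where L: "continuous_local_martingale M F L" and A: "adapted F A"
    and bv: "AE \<omega> in M. \<forall>t\<ge>0. bounded_variation (\<lambda>u. A u \<omega>) 0 t"
    and eq: "AE \<omega> in M. \<forall>t\<ge>0. X t \<omega> = L t \<omega> + A t \<omega>"
    using X unfolding continuous_semimartingale_def by blast
  show ?thesis
  proof (rule good_integrator_add[OF ab(2) good_integrator_local_martingale[OF ab L]])
    show "good_integrator M F a b A"
    proof (rule good_integrator_bounded_variation[OF ab])
      show "A t \<in> borel_measurable M" if "0 \<le> t" for t
        using A that measurable_F_M unfolding adapted_def by blast
      show "AE \<omega> in M. bounded_variation (\<lambda>u. A u \<omega>) 0 b"
        using bv by eventually_elim (use ab in auto)
    qed
    show "AE \<omega> in M. \<forall>t\<in>{a..b}. X t \<omega> = L t \<omega> + A t \<omega>"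
      using eq by eventually_elim (use ab in auto)
  qed
qed

end

section \<open>Riemann sums that vanish in probability\<close>

lemma partition_concat:
  assumes p: "partition_of a b K p" and q: "partition_of b c L q"
  obtains r where "partition_of a c (K + L) r"
    "\<And>k. k < K \<Longrightarrow> r k = p k \<and> r (Suc k) = p (Suc k)"
    "\<And>k. k < L \<Longrightarrow> r (K + k) = q k \<and> r (Suc (K + k)) = q (Suc k)"
proof
  define r where "r k = (if k \<le> K then p k else q (k - K))" for k
  have pq: "p K = q 0" using p q by (simp add: partition_of_def)
  show left: "\<And>k. k < K \<Longrightarrow> r k = p k \<and> r (Suc k) = p (Suc k)"
    by (simp add: r_def)
  show right: "r (K + k) = q k \<and> r (Suc (K + k)) = q (Suc k)" if "k < L" for k
    using that pq by (cases k) (auto simp: r_def)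
  show "partition_of a c (K + L) r"
    unfolding partition_of_def
  proof (intro conjI allI impI)
    show "r 0 = a" using p by (simp add: r_def partition_of_def)
    show "r (K + L) = c" using p q by (cases L) (auto simp: r_def partition_of_def)
    fix k assume "k < K + L"
    then consider "k < K" | j where "k = K + j" "j < L"
      by (metis add_less_cancel_left le_Suc_ex not_less)
    then show "r k \<le> r (Suc k)"
      using left right p q by cases (auto simp: partition_of_def)
  qed
qed

lemma sum_lessThan_add:
  fixes f :: "nat \<Rightarrow> 'b::comm_monoid_add"
  shows "(\<Sum>k<K + L. f k) = (\<Sum>k<K. f k) + (\<Sum>k<L. f (K + k))"
  by (induction L) (auto simp: add.assoc)

lemma grid_partition: "a \<le> b \<Longrightarrow> partition_of a b (2 ^ n) (grid a b n)"
  using grid_mono[of a b] by (simp add: partition_of_def)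

lemma fine_grid:
  fixes \<delta> :: real
  assumes "0 < \<delta>"
  obtains N where "\<And>n. N \<le> n \<Longrightarrow> (b - a) / 2 ^ n < \<delta>"
proof -
  have "(\<lambda>n. (b - a) / 2 ^ n) \<longlonglongrightarrow> 0"
    by (rule LIMSEQ_divide_realpow_zero) simp
  then have "eventually (\<lambda>n. (b - a) / 2 ^ n < \<delta>) sequentially"
    using assms by (rule order_tendstoD)
  then show ?thesis using that by (auto simp: eventually_sequentially)
qed

text \<open>
  The sums of the interval function \<open>\<Psi>\<close> over the partitions of \<open>[a, b]\<close> tend to zero in probability as
  the mesh tends to zero.  A process is a Stratonovich integral exactly when the defects of its
  increments have this property.
\<close>
definition vanishing_sums :: "'a measure \<Rightarrow> (real \<Rightarrow> real \<Rightarrow> 'a \<Rightarrow> 'b::real_normed_vector) \<Rightarrow> real \<Rightarrow> real \<Rightarrow> bool" where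
  "vanishing_sums P \<Psi> a b \<longleftrightarrow> (\<forall>\<epsilon>>0. \<forall>\<eta>>0. \<exists>\<delta>>0. \<forall>K p. partition_of a b K p \<longrightarrow>
     (\<forall>k<K. p (Suc k) - p k < \<delta>) \<longrightarrow> whp P \<eta> (\<lambda>\<omega>. norm (\<Sum>k<K. \<Psi> (p k) (p (Suc k)) \<omega>) \<le> \<epsilon>))"

lemma vanishing_sumsE:
  assumes "vanishing_sums P \<Psi> a b" "0 < \<epsilon>" "0 < \<eta>"
  obtains \<delta> where "0 < \<delta>" "\<And>K p. partition_of a b K p \<Longrightarrow> (\<And>k. k < K \<Longrightarrow> p (Suc k) - p k < \<delta>) \<Longrightarrow>
      whp P \<eta> (\<lambda>\<omega>. norm (\<Sum>k<K. \<Psi> (p k) (p (Suc k)) \<omega>) \<le> \<epsilon>)"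
  using assms unfolding vanishing_sums_def by blast

context finite_measure
begin

text \<open>
  A fine partition of \<open>[s, u]\<close> extends to one of \<open>[a, u]\<close> by a fine partition of \<open>[a, s]\<close>.
\<close>
lemma vanishing_sums_subinterval:
  assumes su: "a \<le> s" and V: "vanishing_sums M \<Psi> a s" "vanishing_sums M \<Psi> a u"
  shows "vanishing_sums M \<Psi> s u"
  unfolding vanishing_sums_def
proof (intro allI impI)
  fix \<epsilon> \<eta> :: real assume "0 < \<epsilon>" "0 < \<eta>"
  then have e: "0 < \<epsilon> / 2" "0 < \<eta> / 2" by auto
  obtain \<delta>1 where d1: "0 < \<delta>1" and V1: "\<And>K p. partition_of a s K p \<Longrightarrow> (\<And>k. k < K \<Longrightarrow> p (Suc k) - p k < \<delta>1) \<Longrightarrow>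
      whp M (\<eta> / 2) (\<lambda>\<omega>. norm (\<Sum>k<K. \<Psi> (p k) (p (Suc k)) \<omega>) \<le> \<epsilon> / 2)"
    using vanishing_sumsE[OF V(1) e] by blast
  obtain \<delta>2 where d2: "0 < \<delta>2" and V2: "\<And>K p. partition_of a u K p \<Longrightarrow> (\<And>k. k < K \<Longrightarrow> p (Suc k) - p k < \<delta>2) \<Longrightarrow>
      whp M (\<eta> / 2) (\<lambda>\<omega>. norm (\<Sum>k<K. \<Psi> (p k) (p (Suc k)) \<omega>) \<le> \<epsilon> / 2)"
    using vanishing_sumsE[OF V(2) e] by blast
  show "\<exists>\<delta>>0. \<forall>K p. partition_of s u K p \<longrightarrow> (\<forall>k<K. p (Suc k) - p k < \<delta>) \<longrightarrow>
      whp M \<eta> (\<lambda>\<omega>. norm (\<Sum>k<K. \<Psi> (p k) (p (Suc k)) \<omega>) \<le> \<epsilon>)"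
  proof (intro exI[of _ \<delta>2] conjI d2 allI impI)
    fix K p assume p: "partition_of s u K p" "\<forall>k<K. p (Suc k) - p k < \<delta>2"
    obtain N where N: "\<And>n. N \<le> n \<Longrightarrow> (s - a) / 2 ^ n < min \<delta>1 \<delta>2"
      using fine_grid[of "min \<delta>1 \<delta>2" s a] d1 d2 by auto
    let ?q = "grid a s N"
    have q: "partition_of a s (2 ^ N) ?q" using su by (rule grid_partition)
    have qm: "?q (Suc k) - ?q k < min \<delta>1 \<delta>2" for k using N[of N] by (simp add: grid_Suc_diff)
    obtain r where r: "partition_of a u (2 ^ N + K) r"
      "\<And>k. k < 2 ^ N \<Longrightarrow> r k = ?q k \<and> r (Suc k) = ?q (Suc k)"
      "\<And>k. k < K \<Longrightarrow> r (2 ^ N + k) = p k \<and> r (Suc (2 ^ N + k)) = p (Suc k)"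
      using partition_concat[OF q p(1)] by blast
    have "r (Suc k) - r k < \<delta>2" if "k < 2 ^ N + K" for k
    proof (cases "k < 2 ^ N")
      case True
      then show ?thesis using r(2) qm[of k] by auto
    next
      case False
      then obtain j where "k = 2 ^ N + j" by (metis le_Suc_ex not_less)
      then show ?thesis using r(3)[of j] p(2) that by auto
    qed
    then have 2: "whp M (\<eta> / 2) (\<lambda>\<omega>. norm (\<Sum>k<2 ^ N + K. \<Psi> (r k) (r (Suc k)) \<omega>) \<le> \<epsilon> / 2)"
      using r(1) by (intro V2) auto
    have 1: "whp M (\<eta> / 2) (\<lambda>\<omega>. norm (\<Sum>k<2 ^ N. \<Psi> (?q k) (?q (Suc k)) \<omega>) \<le> \<epsilon> / 2)"
      using qm by (intro V1 q) auto
    from whp_conj[OF 2 1] show "whp M \<eta> (\<lambda>\<omega>. norm (\<Sum>k<K. \<Psi> (p k) (p (Suc k)) \<omega>) \<le> \<epsilon>)"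
    proof (rule whp_mono)
      fix \<omega> assume *: "norm (\<Sum>k<2 ^ N + K. \<Psi> (r k) (r (Suc k)) \<omega>) \<le> \<epsilon> / 2 \<and>
        norm (\<Sum>k<2 ^ N. \<Psi> (?q k) (?q (Suc k)) \<omega>) \<le> \<epsilon> / 2"
      have "(\<Sum>k<2 ^ N + K. \<Psi> (r k) (r (Suc k)) \<omega>) =
        (\<Sum>k<2 ^ N. \<Psi> (?q k) (?q (Suc k)) \<omega>) + (\<Sum>k<K. \<Psi> (p k) (p (Suc k)) \<omega>)"
        unfolding sum_lessThan_add using r(2,3) by simp
      then have "(\<Sum>k<K. \<Psi> (p k) (p (Suc k)) \<omega>) = (\<Sum>k<2 ^ N + K. \<Psi> (r k) (r (Suc k)) \<omega>) -
        (\<Sum>k<2 ^ N. \<Psi> (?q k) (?q (Suc k)) \<omega>)" by simp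
      then show "norm (\<Sum>k<K. \<Psi> (p k) (p (Suc k)) \<omega>) \<le> \<epsilon>"
        using * norm_triangle_ineq4[of "\<Sum>k<2 ^ N + K. \<Psi> (r k) (r (Suc k)) \<omega>" "\<Sum>k<2 ^ N. \<Psi> (?q k) (?q (Suc k)) \<omega>"]
        by simp
    qed simp
  qed
qed

text \<open>
  Every interval of the partition whose index is outside \<open>J\<close> is replaced by a partition of itself so fine
  that its sum nearly vanishes; the sum over the refined partition is then nearly the sum over \<open>J\<close>.
\<close>
lemma refine_outside:
  assumes V: "\<And>s u. a \<le> s \<Longrightarrow> s \<le> u \<Longrightarrow> u \<le> b \<Longrightarrow> vanishing_sums M \<Psi> s u"
    and "p 0 = a" and "\<And>k. k < K \<Longrightarrow> p k \<le> p (Suc k)" and "p K \<le> b"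
    and "0 < \<delta>" and "\<And>k. k < K \<Longrightarrow> p (Suc k) - p k < \<delta>" and "0 < \<epsilon>" and "0 < \<eta>"
  shows "\<exists>L r. partition_of a (p K) L r \<and> (\<forall>k<L. r (Suc k) - r k < \<delta>) \<and>
    whp M \<eta> (\<lambda>\<omega>. norm ((\<Sum>k<L. \<Psi> (r k) (r (Suc k)) \<omega>) -
      (\<Sum>k<K. if k \<in> J then \<Psi> (p k) (p (Suc k)) \<omega> else 0)) \<le> \<epsilon>)"
  using assms(2-)
proof (induction K arbitrary: \<epsilon> \<eta>)
  case 0
  have "whp M \<eta> (\<lambda>\<omega>. True)" using \<open>0 < \<eta>\<close> by (intro whp_of_AE) auto
  with 0 show ?case
    by (intro exI[of _ 0] exI[of _ p]) (auto simp: partition_of_def elim: whp_mono)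
next
  case (Suc K)
  have mono: "p 0 \<le> p k" if "k \<le> Suc K" for k
    using that Suc.prems(2) by (induction k) (auto intro: order_trans)
  have pK: "a \<le> p K" "p K \<le> p (Suc K)" "p (Suc K) \<le> b" "p (Suc K) - p K < \<delta>"
    using Suc.prems mono[of K] by auto
  have "\<exists>L r. partition_of a (p K) L r \<and> (\<forall>k<L. r (Suc k) - r k < \<delta>) \<and>
    whp M (\<eta> / 2) (\<lambda>\<omega>. norm ((\<Sum>k<L. \<Psi> (r k) (r (Suc k)) \<omega>) -
      (\<Sum>k<K. if k \<in> J then \<Psi> (p k) (p (Suc k)) \<omega> else 0)) \<le> \<epsilon> / 2)"
  proof (rule Suc.IH)
    show "p K \<le> b" using pK by linarith
    show "p 0 = a" "0 < \<delta>" "0 < \<epsilon> / 2" "0 < \<eta> / 2" using Suc.prems(1,4,6,7) by simp_all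
    show "p k \<le> p (Suc k)" "p (Suc k) - p k < \<delta>" if "k < K" for k using Suc.prems(2,5) that by simp_all
  qed
  then obtain L r where r: "partition_of a (p K) L r" "\<And>k. k < L \<Longrightarrow> r (Suc k) - r k < \<delta>"
    "whp M (\<eta> / 2) (\<lambda>\<omega>. norm ((\<Sum>k<L. \<Psi> (r k) (r (Suc k)) \<omega>) -
      (\<Sum>k<K. if k \<in> J then \<Psi> (p k) (p (Suc k)) \<omega> else 0)) \<le> \<epsilon> / 2)"
    by blast
  have "\<exists>L' q. partition_of (p K) (p (Suc K)) L' q \<and> (\<forall>k<L'. q (Suc k) - q k < \<delta>) \<and>
    whp M (\<eta> / 2) (\<lambda>\<omega>. norm ((\<Sum>k<L'. \<Psi> (q k) (q (Suc k)) \<omega>) -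
      (if K \<in> J then \<Psi> (p K) (p (Suc K)) \<omega> else 0)) \<le> \<epsilon> / 2)"
  proof (cases "K \<in> J")
    case True
    have "whp M (\<eta> / 2) (\<lambda>\<omega>. True)" using Suc.prems by (intro whp_of_AE) auto
    then have "whp M (\<eta> / 2) (\<lambda>\<omega>. norm ((\<Sum>k<1. \<Psi> (p (K + k)) (p (K + Suc k)) \<omega>) -
      (if K \<in> J then \<Psi> (p K) (p (Suc K)) \<omega> else 0)) \<le> \<epsilon> / 2)"
      by (rule whp_mono) (use True Suc.prems in auto)
    then show ?thesis
      using pK by (intro exI[of _ 1] exI[of _ "\<lambda>k. p (K + k)"]) (auto simp: partition_of_def)
  next
    case False
    have "vanishing_sums M \<Psi> (p K) (p (Suc K))" using V pK by simp
    then obtain \<delta>' where d': "0 < \<delta>'" and V': "\<And>L q. partition_of (p K) (p (Suc K)) L q \<Longrightarrow>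
      (\<And>k. k < L \<Longrightarrow> q (Suc k) - q k < \<delta>') \<Longrightarrow>
      whp M (\<eta> / 2) (\<lambda>\<omega>. norm (\<Sum>k<L. \<Psi> (q k) (q (Suc k)) \<omega>) \<le> \<epsilon> / 2)"
      using vanishing_sumsE[of M \<Psi> "p K" "p (Suc K)" "\<epsilon> / 2" "\<eta> / 2"] Suc.prems by auto
    obtain N where N: "\<And>n. N \<le> n \<Longrightarrow> (p (Suc K) - p K) / 2 ^ n < min \<delta> \<delta>'"
      using fine_grid[of "min \<delta> \<delta>'" "p (Suc K)" "p K"] d' Suc.prems by auto
    let ?q = "grid (p K) (p (Suc K)) N"
    have q: "partition_of (p K) (p (Suc K)) (2 ^ N) ?q" using pK by (intro grid_partition) auto
    have qm: "?q (Suc k) - ?q k < min \<delta> \<delta>'" for k using N[of N] by (simp add: grid_Suc_diff)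
    have "whp M (\<eta> / 2) (\<lambda>\<omega>. norm (\<Sum>k<2 ^ N. \<Psi> (?q k) (?q (Suc k)) \<omega>) \<le> \<epsilon> / 2)"
      using qm by (intro V' q) auto
    then show ?thesis
      using q qm False by (intro exI[of _ "2 ^ N"] exI[of _ ?q]) auto
  qed
  then obtain L' q where q: "partition_of (p K) (p (Suc K)) L' q" "\<And>k. k < L' \<Longrightarrow> q (Suc k) - q k < \<delta>"
    "whp M (\<eta> / 2) (\<lambda>\<omega>. norm ((\<Sum>k<L'. \<Psi> (q k) (q (Suc k)) \<omega>) -
      (if K \<in> J then \<Psi> (p K) (p (Suc K)) \<omega> else 0)) \<le> \<epsilon> / 2)"
    by blast
  obtain t where t: "partition_of a (p (Suc K)) (L + L') t"
    "\<And>k. k < L \<Longrightarrow> t k = r k \<and> t (Suc k) = r (Suc k)"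
    "\<And>k. k < L' \<Longrightarrow> t (L + k) = q k \<and> t (Suc (L + k)) = q (Suc k)"
    using partition_concat[OF r(1) q(1)] by blast
  have mesh: "t (Suc k) - t k < \<delta>" if "k < L + L'" for k
  proof (cases "k < L")
    case True
    then show ?thesis using t(2) r(2) by auto
  next
    case False
    then obtain j where "k = L + j" by (metis le_Suc_ex not_less)
    then show ?thesis using t(3)[of j] q(2) that by auto
  qed
  from whp_conj[OF r(3) q(3)]
  have "whp M \<eta> (\<lambda>\<omega>. norm ((\<Sum>k<L + L'. \<Psi> (t k) (t (Suc k)) \<omega>) -
      (\<Sum>k<Suc K. if k \<in> J then \<Psi> (p k) (p (Suc k)) \<omega> else 0)) \<le> \<epsilon>)"
  proof (rule whp_mono)
    fix \<omega> assume *: "norm ((\<Sum>k<L. \<Psi> (r k) (r (Suc k)) \<omega>) -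
      (\<Sum>k<K. if k \<in> J then \<Psi> (p k) (p (Suc k)) \<omega> else 0)) \<le> \<epsilon> / 2 \<and>
      norm ((\<Sum>k<L'. \<Psi> (q k) (q (Suc k)) \<omega>) - (if K \<in> J then \<Psi> (p K) (p (Suc K)) \<omega> else 0)) \<le> \<epsilon> / 2"
    have "(\<Sum>k<L + L'. \<Psi> (t k) (t (Suc k)) \<omega>) =
        (\<Sum>k<L. \<Psi> (r k) (r (Suc k)) \<omega>) + (\<Sum>k<L'. \<Psi> (q k) (q (Suc k)) \<omega>)"
      unfolding sum_lessThan_add using t(2,3) by simp
    then have "(\<Sum>k<L + L'. \<Psi> (t k) (t (Suc k)) \<omega>) - (\<Sum>k<Suc K. if k \<in> J then \<Psi> (p k) (p (Suc k)) \<omega> else 0)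
      = ((\<Sum>k<L. \<Psi> (r k) (r (Suc k)) \<omega>) - (\<Sum>k<K. if k \<in> J then \<Psi> (p k) (p (Suc k)) \<omega> else 0)) +
        ((\<Sum>k<L'. \<Psi> (q k) (q (Suc k)) \<omega>) - (if K \<in> J then \<Psi> (p K) (p (Suc K)) \<omega> else 0))"
      by simp
    also have "norm \<dots> \<le> \<epsilon> / 2 + \<epsilon> / 2"
      using * by (intro order_trans[OF norm_triangle_ineq] add_mono) auto
    finally show "norm ((\<Sum>k<L + L'. \<Psi> (t k) (t (Suc k)) \<omega>) -
      (\<Sum>k<Suc K. if k \<in> J then \<Psi> (p k) (p (Suc k)) \<omega> else 0)) \<le> \<epsilon>" by simp
  qed simp
  with t(1) mesh show ?case by blast
qed

text \<open>
  The refinement outside \<open>J\<close> is again a partition of \<open>[a, b]\<close> of small mesh, so its total sum is small,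
  and that sum nearly equals the sum over \<open>J\<close>.  The threshold \<open>N\<close> does not depend on \<open>J\<close>.
\<close>
lemma vanishing_subset_sums:
  assumes "a \<le> b" and V: "\<And>s u. a \<le> s \<Longrightarrow> s \<le> u \<Longrightarrow> u \<le> b \<Longrightarrow> vanishing_sums M \<Psi> s u"
    and eps: "0 < \<epsilon>" "0 < \<eta>"
  obtains N where "\<And>n J. N \<le> n \<Longrightarrow> J \<subseteq> {..<2 ^ n} \<Longrightarrow>
    whp M \<eta> (\<lambda>\<omega>. norm (\<Sum>k\<in>J. \<Psi> (grid a b n k) (grid a b n (Suc k)) \<omega>) \<le> \<epsilon>)"
proof -
  obtain \<delta> where d: "0 < \<delta>" and V': "\<And>K p. partition_of a b K p \<Longrightarrow> (\<And>k. k < K \<Longrightarrow> p (Suc k) - p k < \<delta>) \<Longrightarrow>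
      whp M (\<eta> / 2) (\<lambda>\<omega>. norm (\<Sum>k<K. \<Psi> (p k) (p (Suc k)) \<omega>) \<le> \<epsilon> / 2)"
    using vanishing_sumsE[of M \<Psi> a b "\<epsilon> / 2" "\<eta> / 2"] V[of a b] assms by auto
  obtain N where N: "\<And>n. N \<le> n \<Longrightarrow> (b - a) / 2 ^ n < \<delta>" using fine_grid[OF d] by blast
  show ?thesis
  proof (rule that)
    fix n J assume n: "N \<le> n" and J: "J \<subseteq> {..<(2::nat) ^ n}"
    let ?g = "grid a b n"
    have "\<exists>L r. partition_of a (?g (2 ^ n)) L r \<and> (\<forall>k<L. r (Suc k) - r k < \<delta>) \<and>
      whp M (\<eta> / 2) (\<lambda>\<omega>. norm ((\<Sum>k<L. \<Psi> (r k) (r (Suc k)) \<omega>) -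
        (\<Sum>k<2 ^ n. if k \<in> J then \<Psi> (?g k) (?g (Suc k)) \<omega> else 0)) \<le> \<epsilon> / 2)"
      using assms grid_mono[of a b] d N[OF n] by (intro refine_outside V) (auto simp: grid_Suc_diff)
    then obtain L r where r: "partition_of a b L r" "\<And>k. k < L \<Longrightarrow> r (Suc k) - r k < \<delta>" and
      1: "whp M (\<eta> / 2) (\<lambda>\<omega>. norm ((\<Sum>k<L. \<Psi> (r k) (r (Suc k)) \<omega>) -
        (\<Sum>k<2 ^ n. if k \<in> J then \<Psi> (?g k) (?g (Suc k)) \<omega> else 0)) \<le> \<epsilon> / 2)"
      by auto
    have 2: "whp M (\<eta> / 2) (\<lambda>\<omega>. norm (\<Sum>k<L. \<Psi> (r k) (r (Suc k)) \<omega>) \<le> \<epsilon> / 2)"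
      using V' r by blast
    have J_sum: "(\<Sum>k<2 ^ n. if k \<in> J then \<Psi> (?g k) (?g (Suc k)) \<omega> else 0) =
        (\<Sum>k\<in>J. \<Psi> (?g k) (?g (Suc k)) \<omega>)" for \<omega>
      using J by (simp add: sum.inter_restrict[symmetric] Int_absorb1)
    from whp_conj[OF 2 1] show "whp M \<eta> (\<lambda>\<omega>. norm (\<Sum>k\<in>J. \<Psi> (?g k) (?g (Suc k)) \<omega>) \<le> \<epsilon>)"
    proof (rule whp_mono)
      fix \<omega> assume *: "norm (\<Sum>k<L. \<Psi> (r k) (r (Suc k)) \<omega>) \<le> \<epsilon> / 2 \<and>
        norm ((\<Sum>k<L. \<Psi> (r k) (r (Suc k)) \<omega>) -
        (\<Sum>k<2 ^ n. if k \<in> J then \<Psi> (?g k) (?g (Suc k)) \<omega> else 0)) \<le> \<epsilon> / 2"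
      then show "norm (\<Sum>k\<in>J. \<Psi> (?g k) (?g (Suc k)) \<omega>) \<le> \<epsilon>"
        unfolding J_sum using norm_triangle_sub[of "\<Sum>k\<in>J. \<Psi> (?g k) (?g (Suc k)) \<omega>" "\<Sum>k<L. \<Psi> (r k) (r (Suc k)) \<omega>"]
        by (simp add: norm_minus_commute)
    qed simp
  qed
qed

end

text \<open>
  The characteristic function of a sum of independent random signs with weights \<open>r k\<close>, with the
  probability written as a sum over the set \<open>J\<close> of the positive signs.
\<close>
lemma cos_sign_average:
  fixes r :: "nat \<Rightarrow> real"
  assumes "finite A"
  shows "(\<Sum>J\<in>Pow A. cos (x + (\<Sum>k\<in>A. if k \<in> J then r k else - r k))) =
    2 ^ card A * cos x * (\<Prod>k\<in>A. cos (r k))"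
  using assms
proof (induction A arbitrary: x rule: finite_induct)
  case empty
  then show ?case by simp
next
  case (insert a A)
  let ?S = "\<lambda>J. \<Sum>k\<in>A. if k \<in> J then r k else - r k"
  have inj: "inj_on (insert a) (Pow A)"
    using insert.hyps by (auto simp: inj_on_def dest: insert_ident[THEN iffD1, rotated 2])
  have "(\<Sum>J\<in>Pow (insert a A). cos (x + (\<Sum>k\<in>insert a A. if k \<in> J then r k else - r k))) =
      (\<Sum>J\<in>Pow A. cos (x + (\<Sum>k\<in>insert a A. if k \<in> J then r k else - r k))) +
      (\<Sum>J\<in>Pow A. cos (x + (\<Sum>k\<in>insert a A. if k \<in> insert a J then r k else - r k)))"
    unfolding Pow_insert using insert.hyps inj
    by (subst sum.union_disjoint) (auto simp: sum.reindex)
  also have "(\<Sum>J\<in>Pow A. cos (x + (\<Sum>k\<in>insert a A. if k \<in> J then r k else - r k))) =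
      (\<Sum>J\<in>Pow A. cos ((x - r a) + ?S J))"
    using insert.hyps by (intro sum.cong refl arg_cong[of _ _ cos]) auto
  also have "(\<Sum>J\<in>Pow A. cos (x + (\<Sum>k\<in>insert a A. if k \<in> insert a J then r k else - r k))) =
      (\<Sum>J\<in>Pow A. cos ((x + r a) + ?S J))"
  proof (intro sum.cong refl arg_cong[of _ _ cos])
    fix J assume "J \<in> Pow A"
    have "(\<Sum>k\<in>A. if k \<in> insert a J then r k else - r k) = ?S J"
      using insert.hyps by (intro sum.cong) auto
    then show "x + (\<Sum>k\<in>insert a A. if k \<in> insert a J then r k else - r k) = (x + r a) + ?S J"
      using insert.hyps by simp
  qed
  also have "(\<Sum>J\<in>Pow A. cos ((x - r a) + ?S J)) + (\<Sum>J\<in>Pow A. cos ((x + r a) + ?S J)) =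
      2 ^ card A * cos (x - r a) * (\<Prod>k\<in>A. cos (r k)) + 2 ^ card A * cos (x + r a) * (\<Prod>k\<in>A. cos (r k))"
    by (simp only: insert.IH)
  also have "\<dots> = 2 ^ card (insert a A) * cos x * (\<Prod>k\<in>insert a A. cos (r k))"
    using insert.hyps by (simp add: cos_add cos_diff algebra_simps)
  finally show ?case .
qed

lemma cos_le_exp:
  fixes x :: real
  assumes "\<bar>x\<bar> \<le> 1"
  shows "\<bar>cos x\<bar> \<le> exp (- (x\<^sup>2 / 4))"
proof -
  have cos_ge: "1 / 2 \<le> cos y" if "0 \<le> y" "y \<le> 1" for y :: real
    using cos_monotone_0_pi_le[of y "pi / 3"] that pi_gt3 by (simp add: cos_60)
  have sin_ge: "y / 2 \<le> sin y" if "0 \<le> y" "y \<le> 1" for y :: real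
  proof -
    have "sin 0 - 0 / 2 \<le> sin y - y / 2"
      by (rule DERIV_nonneg_imp_nondecreasing[OF that(1)])
        (use cos_ge that in \<open>auto intro!: exI derivative_eq_intros\<close>)
    then show ?thesis by simp
  qed
  have "1 - 0\<^sup>2 / 4 - cos 0 \<le> 1 - \<bar>x\<bar>\<^sup>2 / 4 - cos \<bar>x\<bar>"
    by (rule DERIV_nonneg_imp_nondecreasing[OF abs_ge_zero])
      (use sin_ge assms in \<open>auto intro!: exI derivative_eq_intros\<close>)
  then have "cos x \<le> 1 - x\<^sup>2 / 4" by simp
  also have "\<dots> \<le> exp (- (x\<^sup>2 / 4))" using exp_ge_add_one_self[of "- (x\<^sup>2 / 4)"] by simp
  finally show ?thesis using cos_ge[of "\<bar>x\<bar>"] assms by simp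
qed

context prob_space
begin

lemma expectation_ge_of_whp:
  fixes f :: "'a \<Rightarrow> real"
  assumes [measurable]: "f \<in> borel_measurable M" and bound: "\<And>\<omega>. \<bar>f \<omega>\<bar> \<le> 1"
    and whp: "whp M \<theta> (\<lambda>\<omega>. v \<le> f \<omega>)" and "v \<le> 1"
  shows "v - 2 * \<theta> \<le> (\<integral>\<omega>. f \<omega> \<partial>M)"
proof -
  obtain E where E: "E \<in> sets M" "prob E \<le> \<theta>" "\<forall>\<omega>\<in>space M - E. v \<le> f \<omega>"
    using whp unfolding whp_def by auto
  note [measurable] = E(1)
  have ind: "integrable M (\<lambda>\<omega>. 2 * indicator E \<omega> :: real)"
    by (rule integrable_const_bound[where B=2]) (auto simp: indicator_def)
  have "v - 2 * \<theta> \<le> v - 2 * prob E" using E by simp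
  also have "\<dots> = (\<integral>\<omega>. v - 2 * indicator E \<omega> \<partial>M)"
    using E(1) ind by (subst Bochner_Integration.integral_diff) (auto simp: prob_space)
  also have "\<dots> \<le> (\<integral>\<omega>. f \<omega> \<partial>M)"
  proof (rule integral_mono)
    show "integrable M f" by (rule integrable_const_bound[where B=1]) (use bound in auto)
    show "v - 2 * indicator E \<omega> \<le> f \<omega>" if "\<omega> \<in> space M" for \<omega>
      using E(3) that bound[of \<omega>] \<open>v \<le> 1\<close> by (cases "\<omega> \<in> E") (auto simp: abs_le_iff)
    show "integrable M (\<lambda>\<omega>. v - 2 * indicator E \<omega>)"
      by (intro Bochner_Integration.integrable_diff ind) simp
  qed
  finally show ?thesis .
qed

text \<open>
  If every signed sum is small, then the mean of its cosine is close to one.  Averaging over the signs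
  replaces the cosine by the product \<open>C\<close> of the cosines of the \<open>r k\<close>, which is therefore close to one
  except on an event of small probability.  Where \<open>C\<close> is close to one, \<open>\<bar>cos x\<bar> \<le> exp (- x\<^sup>2 / 4)\<close>
  bounds the sum of the squares.  Factors with a large \<open>r k\<close> do no harm since their cosines are at most
  one, which is why the bound holds for each index set \<open>G\<close> of moderate values.
\<close>
lemma sum_squares_small:
  fixes r :: "nat \<Rightarrow> 'a \<Rightarrow> real"
  assumes meas [measurable]: "\<And>k. k < K \<Longrightarrow> r k \<in> borel_measurable M"
    and small: "\<And>J. J \<subseteq> {..<K} \<Longrightarrow> whp M \<eta> (\<lambda>\<omega>. \<bar>\<Sum>k\<in>J. r k \<omega>\<bar> \<le> \<alpha>)"
    and \<beta>: "0 < \<beta>"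
  shows "whp M ((9 * \<alpha>\<^sup>2 / 2 + 4 * \<eta>) / (1 - exp (- (\<beta> / 4))))
    (\<lambda>\<omega>. \<forall>G\<subseteq>{..<K}. (\<forall>k\<in>G. \<bar>r k \<omega>\<bar> \<le> 1) \<longrightarrow> (\<Sum>k\<in>G. (r k \<omega>)\<^sup>2) \<le> \<beta>)"
proof -
  define S where "S J \<omega> = (\<Sum>k<K. if k \<in> J then r k \<omega> else - r k \<omega>)" for J \<omega>
  define C where "C \<omega> = (\<Prod>k<K. cos (r k \<omega>))" for \<omega>
  have S_meas [measurable]: "S J \<in> borel_measurable M" for J
    unfolding S_def by measurable
  have C_meas [measurable]: "C \<in> borel_measurable M"
    unfolding C_def by (intro borel_measurable_prod) auto
  have C_bound: "\<bar>C \<omega>\<bar> \<le> 1" for \<omega>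
    unfolding C_def abs_prod by (intro prod_le_1) auto
  have S_mean: "1 - (9 * \<alpha>\<^sup>2 / 2 + 4 * \<eta>) \<le> (\<integral>\<omega>. cos (S J \<omega>) \<partial>M)" if J: "J \<subseteq> {..<K}" for J
  proof -
    have "whp M (\<eta> + \<eta>) (\<lambda>\<omega>. 1 - 9 * \<alpha>\<^sup>2 / 2 \<le> cos (S J \<omega>))"
    proof (rule whp_mono[OF whp_conj[OF small[OF J] small[OF subset_refl]] order_refl])
      fix \<omega> assume *: "\<bar>\<Sum>k\<in>J. r k \<omega>\<bar> \<le> \<alpha> \<and> \<bar>\<Sum>k<K. r k \<omega>\<bar> \<le> \<alpha>"
      have "S J \<omega> = (\<Sum>k<K. 2 * (if k \<in> J then r k \<omega> else 0) - r k \<omega>)"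
        unfolding S_def by (intro sum.cong) auto
      also have "\<dots> = 2 * (\<Sum>k\<in>J. r k \<omega>) - (\<Sum>k<K. r k \<omega>)"
        using J by (simp add: sum_subtractf sum_distrib_left[symmetric] sum.inter_restrict[symmetric] Int_absorb1)
      finally have "\<bar>S J \<omega>\<bar> \<le> 3 * \<alpha>" using * by linarith
      then have "(S J \<omega>)\<^sup>2 \<le> (3 * \<alpha>)\<^sup>2" using abs_le_square_iff[of "S J \<omega>" "3 * \<alpha>"] by linarith
      moreover have "1 - (S J \<omega>)\<^sup>2 / 2 \<le> cos (S J \<omega>)"
      proof -
        have "(sin (S J \<omega> / 2))\<^sup>2 \<le> (S J \<omega> / 2)\<^sup>2"
          using abs_sin_x_le_abs_x abs_le_square_iff by blast
        moreover have "cos (S J \<omega>) = 1 - 2 * (sin (S J \<omega> / 2))\<^sup>2"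
          using cos_double_sin[of "S J \<omega> / 2"] by simp
        ultimately show ?thesis by (simp add: power_divide)
      qed
      ultimately show "1 - 9 * \<alpha>\<^sup>2 / 2 \<le> cos (S J \<omega>)" by (simp add: power_mult_distrib)
    qed
    then have "1 - 9 * \<alpha>\<^sup>2 / 2 - 2 * (\<eta> + \<eta>) \<le> (\<integral>\<omega>. cos (S J \<omega>) \<partial>M)"
      by (intro expectation_ge_of_whp) auto
    then show ?thesis by simp
  qed
  have cos_int: "integrable M (\<lambda>\<omega>. cos (S J \<omega>))" for J
    by (rule integrable_const_bound[where B=1]) auto
  have C_int: "integrable M C"
    by (rule integrable_const_bound[where B=1]) (use C_bound in auto)
  have avg: "(\<Sum>J\<in>Pow {..<K}. cos (S J \<omega>)) = 2 ^ K * C \<omega>" for \<omega>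
    using cos_sign_average[of "{..<K}" 0 "\<lambda>k. r k \<omega>"] by (simp add: S_def C_def)
  have "2 ^ K * (1 - (9 * \<alpha>\<^sup>2 / 2 + 4 * \<eta>)) = (\<Sum>J\<in>Pow {..<K}. 1 - (9 * \<alpha>\<^sup>2 / 2 + 4 * \<eta>))"
    by (simp add: card_Pow)
  also have "\<dots> \<le> (\<Sum>J\<in>Pow {..<K}. \<integral>\<omega>. cos (S J \<omega>) \<partial>M)"
    using S_mean by (intro sum_mono) auto
  also have "\<dots> = (\<integral>\<omega>. 2 ^ K * C \<omega> \<partial>M)"
    using cos_int by (simp add: avg[symmetric])
  finally have "1 - (9 * \<alpha>\<^sup>2 / 2 + 4 * \<eta>) \<le> (\<integral>\<omega>. C \<omega> \<partial>M)" by simp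
  then have "(\<integral>\<omega>. 1 - C \<omega> \<partial>M) \<le> 9 * \<alpha>\<^sup>2 / 2 + 4 * \<eta>"
    using C_int by (simp add: prob_space)
  then have "whp M ((9 * \<alpha>\<^sup>2 / 2 + 4 * \<eta>) / (1 - exp (- (\<beta> / 4)))) (\<lambda>\<omega>. 1 - C \<omega> \<le> 1 - exp (- (\<beta> / 4)))"
    using C_int C_bound \<beta> by (intro whp_of_expectation_le) (auto simp: abs_le_iff)
  then show ?thesis
  proof (rule whp_mono[OF _ order_refl], intro allI impI)
    fix \<omega> G assume C: "1 - C \<omega> \<le> 1 - exp (- (\<beta> / 4))" and G: "G \<subseteq> {..<K}" "\<forall>k\<in>G. \<bar>r k \<omega>\<bar> \<le> 1"
    have fin: "finite G" using G(1) finite_subset by blast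
    have "exp (- (\<beta> / 4)) \<le> \<bar>C \<omega>\<bar>" using C by linarith
    also have "\<dots> = (\<Prod>k\<in>{..<K} - G. \<bar>cos (r k \<omega>)\<bar>) * (\<Prod>k\<in>G. \<bar>cos (r k \<omega>)\<bar>)"
      unfolding C_def abs_prod by (rule prod.subset_diff[OF G(1)]) simp
    also have "\<dots> \<le> (\<Prod>k\<in>G. \<bar>cos (r k \<omega>)\<bar>)"
      by (intro mult_left_le_one_le prod_le_1 prod_nonneg) auto
    also have "\<dots> \<le> (\<Prod>k\<in>G. exp (- ((r k \<omega>)\<^sup>2 / 4)))"
      using G(2) cos_le_exp by (intro prod_mono) auto
    also have "\<dots> = exp (\<Sum>k\<in>G. - ((r k \<omega>)\<^sup>2 / 4))"
      using fin by (simp add: exp_sum)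
    finally show "(\<Sum>k\<in>G. (r k \<omega>)\<^sup>2) \<le> \<beta>"
      by (simp add: sum_negf sum_divide_distrib[symmetric])
  qed
qed

end

section \<open>The energy increment along a partition\<close>

text \<open>
  The trapezoidal rule for the derivative \<open>3 (max 0 x)\<^sup>2\<close> of \<open>(max 0 x) ^ 3\<close> has an error of third order
  although the function is only twice continuously differentiable.
\<close>
lemma trapezoid_cube:
  fixes x y :: real
  shows "\<bar>(max 0 y) ^ 3 - (max 0 x) ^ 3 - (3 * (max 0 x)\<^sup>2 + 3 * (max 0 y)\<^sup>2) / 2 * (y - x)\<bar> \<le> 5 / 2 * \<bar>y - x\<bar> ^ 3"
proof -
  have both: "\<bar>v ^ 3 - u ^ 3 - (3 * u\<^sup>2 + 3 * v\<^sup>2) / 2 * (v - u)\<bar> \<le> 5 / 2 * \<bar>v - u\<bar> ^ 3" for u v :: real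
  proof -
    have "v ^ 3 - u ^ 3 - (3 * u\<^sup>2 + 3 * v\<^sup>2) / 2 * (v - u) = - (1 / 2) * (v - u) ^ 3"
      by (simp add: power2_eq_square power3_eq_cube field_simps)
    then have "\<bar>v ^ 3 - u ^ 3 - (3 * u\<^sup>2 + 3 * v\<^sup>2) / 2 * (v - u)\<bar> = 1 / 2 * \<bar>v - u\<bar> ^ 3"
      by (simp add: abs_mult power_abs)
    then show ?thesis using zero_le_power[of "\<bar>v - u\<bar>" 3] by simp
  qed
  have cross: "\<bar>v ^ 3 - 3 * v\<^sup>2 / 2 * (v - u)\<bar> \<le> 5 / 2 * \<bar>v - u\<bar> ^ 3" if "u \<le> 0" "0 \<le> v" for u v :: real
  proof -
    have "\<bar>v ^ 3 - 3 * v\<^sup>2 / 2 * (v - u)\<bar> \<le> v ^ 3 + 3 * v\<^sup>2 / 2 * (v - u)"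
      using that abs_triangle_ineq4[of "v ^ 3" "3 * v\<^sup>2 / 2 * (v - u)"] by (simp add: abs_mult)
    also have "\<dots> \<le> (v - u) ^ 3 + 3 * (v - u)\<^sup>2 / 2 * (v - u)"
      using that by (intro add_mono mult_right_mono divide_right_mono mult_left_mono power_mono) auto
    also have "\<dots> = 5 / 2 * \<bar>v - u\<bar> ^ 3"
      using that by (simp add: power2_eq_square power3_eq_cube)
    finally show ?thesis .
  qed
  show ?thesis
  proof (cases "0 \<le> x"; cases "0 \<le> y")
    assume "0 \<le> x" "0 \<le> y"
    then show ?thesis using both[of y x] by simp
  next
    assume "0 \<le> x" "\<not> 0 \<le> y"
    have m: "max 0 y = 0" "max 0 x = x" using \<open>0 \<le> x\<close> \<open>\<not> 0 \<le> y\<close> by auto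
    have eq: "(0::real) ^ 3 - x ^ 3 - (3 * x\<^sup>2 + 3 * 0\<^sup>2) / 2 * (y - x) = - (x ^ 3 - 3 * x\<^sup>2 / 2 * (x - y))"
      by (simp add: field_simps)
    show ?thesis
      unfolding m eq abs_minus_cancel abs_minus_commute[of y x]
      using cross[of y x] \<open>0 \<le> x\<close> \<open>\<not> 0 \<le> y\<close> by simp
  next
    assume "\<not> 0 \<le> x" "0 \<le> y"
    then show ?thesis using cross[of x y] by simp
  qed (simp add: zero_le_power)
qed

lemma abs_sum_le_scaled:
  fixes f g :: "nat \<Rightarrow> real"
  assumes "\<And>k. k < K \<Longrightarrow> \<bar>f k\<bar> \<le> c * g k" "(\<Sum>k<K. g k) \<le> Q" "0 \<le> c"
  shows "\<bar>\<Sum>k<K. f k\<bar> \<le> c * Q"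
proof -
  have "\<bar>\<Sum>k<K. f k\<bar> \<le> (\<Sum>k<K. c * g k)"
    using assms(1) by (intro order_trans[OF sum_abs] sum_mono) auto
  also have "\<dots> \<le> c * Q" using assms(2,3) by (simp add: sum_distrib_left[symmetric] mult_left_mono)
  finally show ?thesis .
qed

text \<open>
  The derivative of \<open>(max 0 (r - \<alpha>)) ^ 3\<close> at \<open>r = (norm x)\<^sup>2\<close>.
\<close>
definition cutoff :: "real \<Rightarrow> 'v::real_inner \<Rightarrow> real" where
  "cutoff \<alpha> x = 3 * (max 0 ((norm x)\<^sup>2 - \<alpha>))\<^sup>2"

lemma cutoff_bound:
  assumes "norm x \<le> C" "0 \<le> \<alpha>"
  shows "0 \<le> cutoff \<alpha> x \<and> cutoff \<alpha> x \<le> 3 * C ^ 4"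
proof -
  have C: "0 \<le> C" using assms(1) norm_ge_zero order_trans by blast
  have "(norm x)\<^sup>2 \<le> C\<^sup>2" using assms(1) by (intro power_mono) auto
  then have "max 0 ((norm x)\<^sup>2 - \<alpha>) \<le> C\<^sup>2" using assms(2) by simp
  then have "(max 0 ((norm x)\<^sup>2 - \<alpha>))\<^sup>2 \<le> (C\<^sup>2)\<^sup>2" by (intro power_mono) auto
  then show ?thesis by (simp add: cutoff_def power_mult[symmetric])
qed

lemma cutoff_eq_0: "(norm x)\<^sup>2 \<le> \<alpha> \<Longrightarrow> cutoff \<alpha> x = 0"
  by (simp add: cutoff_def)

lemma cutoff_lipschitz:
  fixes x y :: "'v::real_inner"
  assumes x: "norm x \<le> C" and y: "norm y \<le> C" and "0 \<le> \<alpha>"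
  shows "\<bar>cutoff \<alpha> x - cutoff \<alpha> y\<bar> \<le> 12 * C ^ 3 * norm (x - y)"
proof -
  have C: "0 \<le> C" using x norm_ge_zero order_trans by blast
  let ?u = "max 0 ((norm x)\<^sup>2 - \<alpha>)" and ?v = "max 0 ((norm y)\<^sup>2 - \<alpha>)"
  have sq: "(norm x)\<^sup>2 \<le> C\<^sup>2" "(norm y)\<^sup>2 \<le> C\<^sup>2" using x y by (auto intro: power_mono)
  have sq_le: "?u \<le> C\<^sup>2" "?v \<le> C\<^sup>2" using sq \<open>0 \<le> \<alpha>\<close> by simp_all
  have "\<bar>max 0 (a - \<alpha>) - max 0 (b - \<alpha>)\<bar> \<le> \<bar>a - b\<bar>" for a b :: real
    by (auto simp: max_def abs_if)
  then have "\<bar>?u - ?v\<bar> \<le> \<bar>(norm x)\<^sup>2 - (norm y)\<^sup>2\<bar>" .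
  also have "\<dots> = \<bar>norm x - norm y\<bar> * \<bar>norm x + norm y\<bar>"
    by (simp only: power2_eq_square square_diff_square_factored abs_mult mult.commute)
  also have "\<dots> \<le> norm (x - y) * (2 * C)"
    using x y by (intro mult_mono norm_triangle_ineq3) (auto simp: abs_le_iff add_nonneg_nonneg)
  finally have uv: "\<bar>?u - ?v\<bar> \<le> norm (x - y) * (2 * C)" .
  have "\<bar>cutoff \<alpha> x - cutoff \<alpha> y\<bar> = 3 * (\<bar>?u - ?v\<bar> * \<bar>?u + ?v\<bar>)"
  proof -
    have "3 * ?u\<^sup>2 - 3 * ?v\<^sup>2 = 3 * ((?u - ?v) * (?u + ?v))"
      by (simp add: power2_eq_square algebra_simps)
    then show ?thesis unfolding cutoff_def by (simp only: abs_mult abs_numeral)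
  qed
  also have "\<dots> \<le> 3 * (norm (x - y) * (2 * C) * (2 * C\<^sup>2))"
  proof -
    have "\<bar>?u + ?v\<bar> \<le> 2 * C\<^sup>2" using sq_le by linarith
    with uv show ?thesis using C by (intro mult_left_mono mult_mono) auto
  qed
  also have "\<dots> = 12 * C ^ 3 * norm (x - y)"
    by (simp add: power2_eq_square power3_eq_cube)
  finally show ?thesis .
qed

lemma cutoff_field_lipschitz:
  fixes x y :: "'v::real_inner"
  assumes x: "norm x \<le> C" and y: "norm y \<le> C" and \<alpha>: "0 \<le> \<alpha>"
  shows "norm (cutoff \<alpha> x *\<^sub>R x - cutoff \<alpha> y *\<^sub>R y) \<le> 15 * C ^ 4 * norm (x - y)"
proof -
  have C: "0 \<le> C" using x norm_ge_zero order_trans by blast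
  have "cutoff \<alpha> x *\<^sub>R x - cutoff \<alpha> y *\<^sub>R y = cutoff \<alpha> x *\<^sub>R (x - y) + (cutoff \<alpha> x - cutoff \<alpha> y) *\<^sub>R y"
    by (simp add: algebra_simps)
  also have "norm \<dots> \<le> cutoff \<alpha> x * norm (x - y) + \<bar>cutoff \<alpha> x - cutoff \<alpha> y\<bar> * norm y"
    using cutoff_bound[OF x \<alpha>] by (intro order_trans[OF norm_triangle_ineq]) simp
  also have "\<dots> \<le> 3 * C ^ 4 * norm (x - y) + 12 * C ^ 3 * norm (x - y) * C"
    using cutoff_bound[OF x \<alpha>] cutoff_lipschitz[OF x y \<alpha>] y C
    by (intro add_mono mult_mono mult_right_mono) auto
  also have "\<dots> = 15 * C ^ 4 * norm (x - y)"
    by (simp add: power_numeral_reduce)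
  finally show ?thesis .
qed

text \<open>
  If \<open>a\<close> and \<open>b\<close> are the values of a function at \<open>x\<close> and \<open>y\<close>, the right-hand side consists of
  increments only.
\<close>
lemma averaged_product:
  fixes x y :: "'v::real_vector"
  shows "((a + b) / 2) *\<^sub>R (x + y) - 2 *\<^sub>R (a *\<^sub>R x) =
    (1 / 2) *\<^sub>R ((b *\<^sub>R y - a *\<^sub>R x) + a *\<^sub>R (y - x) + (b - a) *\<^sub>R x)"
proof -
  have four: "4 *\<^sub>R u = u + u + (u + u)" for u :: 'v
    by (simp flip: scaleR_2)
  have "2 *\<^sub>R (((a + b) / 2) *\<^sub>R (x + y) - 2 *\<^sub>R (a *\<^sub>R x)) = (a + b) *\<^sub>R (x + y) - 4 *\<^sub>R (a *\<^sub>R x)"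
    by (simp only: scaleR_diff_right scaleR_scaleR) simp
  also have "\<dots> = (b *\<^sub>R y - a *\<^sub>R x) + a *\<^sub>R (y - x) + (b - a) *\<^sub>R x"
    unfolding four by (simp add: algebra_simps)
  finally have "(1 / 2) *\<^sub>R (2 *\<^sub>R (((a + b) / 2) *\<^sub>R (x + y) - 2 *\<^sub>R (a *\<^sub>R x))) =
      (1 / 2) *\<^sub>R ((b *\<^sub>R y - a *\<^sub>R x) + a *\<^sub>R (y - x) + (b - a) *\<^sub>R x)"
    by (rule arg_cong)
  then show ?thesis by (simp only: scaleR_scaleR) simp
qed

text \<open>
  A deterministic estimate along one path.  Here \<open>R k\<close> is the defect of the equation, \<open>h k\<close> is half the
  gradient of \<open>(max 0 (|x|\<^sup>2 - \<alpha>)) ^ 3\<close> at \<open>z k\<close>, and \<open>B k\<close> is the beginning of the block containing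
  \<open>k\<close>.  The trapezoidal rule expresses the increment through the average of the cutoffs times
  \<open>z k + z (Suc k)\<close> paired with the increment of \<open>z\<close>, which is \<open>R k\<close> plus the average of the fields
  applied to the noise.  In the noise part tangentiality leaves only the product of the increments of
  \<open>z\<close> and of the field, and this is of third order.  In the defect part the average is replaced by
  \<open>2 h k\<close>, at the price of a product of increments bounded through the sum of \<open>\<bar>R\<bar>\<^sup>2\<close>, and then \<open>h k\<close> by
  \<open>h (B k)\<close>; the remaining coefficient \<open>c k = h k - h (B k)\<close> is small, and \<open>c k \<bullet> R k\<close> is expanded into
  elementary integrals against \<open>z\<close> and against the noise and a product of increments.
\<close>
lemma cutoff_energy_increment:
  fixes z :: "nat \<Rightarrow> 'v::real_inner" and w :: "nat \<Rightarrow> 'w::real_normed_vector"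
    and s :: "'v \<Rightarrow> 'w \<Rightarrow> 'v" and B :: "nat \<Rightarrow> nat" and \<alpha> :: real
  defines "R \<equiv> \<lambda>k. z (Suc k) - z k - (1 / 2) *\<^sub>R (s (z k) (w k) + s (z (Suc k)) (w k))"
    and "h \<equiv> \<lambda>k. cutoff \<alpha> (z k) *\<^sub>R z k"
  assumes \<alpha>: "0 < \<alpha>" and tangential: "\<And>x v. x \<bullet> s x v = 0"
    and lip: "\<And>x y v. sqrt \<alpha> / 2 \<le> norm x \<Longrightarrow> norm x \<le> C \<Longrightarrow> sqrt \<alpha> / 2 \<le> norm y \<Longrightarrow> norm y \<le> C \<Longrightarrow>
      norm (s x v - s y v) \<le> L * norm (x - y) * norm v"
    and L: "0 \<le> L" and \<eta>: "0 < \<eta>" "2 * \<eta> \<le> sqrt \<alpha> / 2"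
    and C: "\<And>k. k \<le> K \<Longrightarrow> norm (z k) \<le> C"
    and B: "\<And>k. k < K \<Longrightarrow> B k \<le> k"
    and dz: "\<And>k. k < K \<Longrightarrow> norm (z (Suc k) - z k) \<le> \<eta>" and dw: "\<And>k. k < K \<Longrightarrow> norm (w k) \<le> \<eta>"
    and zB: "\<And>k. k < K \<Longrightarrow> norm (z k - z (B k)) \<le> \<eta>"
    and Qz: "(\<Sum>k<K. (norm (z (Suc k) - z k))\<^sup>2) \<le> Qz" and Qw: "(\<Sum>k<K. (norm (w k))\<^sup>2) \<le> Qw"
    and R2: "(\<Sum>k | k < K \<and> sqrt \<alpha> / 2 \<le> norm (z k) \<and> sqrt \<alpha> / 2 \<le> norm (z (Suc k)). (norm (R k))\<^sup>2) \<le> \<eta>\<^sup>2"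
    and blocks: "\<bar>\<Sum>k<K. h (B k) \<bullet> R k\<bar> \<le> \<eta>"
    and cz: "\<bar>\<Sum>k<K. (h k - h (B k)) \<bullet> (z (Suc k) - z k)\<bar> \<le> \<eta> * (15 * C ^ 4 * \<kappa>z)"
    and cw: "\<bar>\<Sum>k<K. (h k - h (B k)) \<bullet> s (z k) (w k)\<bar> \<le> \<eta> * (15 * C ^ 4 * S * \<kappa>w)"
  shows "\<bar>(max 0 ((norm (z K))\<^sup>2 - \<alpha>)) ^ 3 - (max 0 ((norm (z 0))\<^sup>2 - \<alpha>)) ^ 3\<bar> \<le>
    \<eta> * (20 * C ^ 3 * Qz + 2 * C ^ 4 * L * Qz + 15 * C ^ 4 * (Qz + 1) + 2
      + 30 * C ^ 4 * (\<kappa>z + S * \<kappa>w + L * (Qz + Qw)))"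
proof -
  let ?\<Phi> = "\<lambda>k. cutoff \<alpha> (z k)"
  let ?d = "\<lambda>k. z (Suc k) - z k"
  let ?p = "sqrt \<alpha> / 2"
  define g where "g k = (max 0 ((norm (z k))\<^sup>2 - \<alpha>)) ^ 3" for k
  define G where "G = {k. k < K \<and> ?p \<le> norm (z k) \<and> ?p \<le> norm (z (Suc k))}"
  define D where "D k = ((?\<Phi> k + ?\<Phi> (Suc k)) / 2) *\<^sub>R (z k + z (Suc k)) - 2 *\<^sub>R h k" for k
  define c where "c k = h k - h (B k)" for k
  have C0: "0 \<le> C" using C[of 0] norm_ge_zero[of "z 0"] by linarith
  have sa: "0 < sqrt \<alpha>" using \<alpha> by simp
  have Phi: "0 \<le> ?\<Phi> k" "?\<Phi> k \<le> 3 * C ^ 4" if "k \<le> K" for k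
    using cutoff_bound[OF C[OF that]] \<alpha> by auto
  have far: "sqrt \<alpha> < norm (z k)" if "?\<Phi> k \<noteq> 0" for k
  proof (rule ccontr)
    assume "\<not> sqrt \<alpha> < norm (z k)"
    then have "(norm (z k))\<^sup>2 \<le> (sqrt \<alpha>)\<^sup>2" by (intro power_mono) auto
    then show False using that \<alpha> cutoff_eq_0[of "z k" \<alpha>] by simp
  qed
  \<comment> \<open>a term with a nonzero cutoff has both endpoints in the annulus, where the field is Lipschitz\<close>
  have near: "norm y \<ge> ?p" if "sqrt \<alpha> < norm x" "norm (x - y) \<le> 2 * \<eta>" for x y :: 'v
    using norm_triangle_ineq2[of x y] that \<eta> by linarith
  have base: "norm x \<ge> ?p" if "sqrt \<alpha> < norm x" for x :: 'v
    using that sa by linarith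
  have G_I: "k \<in> G" if "k < K" "?\<Phi> k \<noteq> 0 \<or> ?\<Phi> (Suc k) \<noteq> 0" for k
  proof -
    have "norm (z k - z (Suc k)) \<le> 2 * \<eta>" "norm (z (Suc k) - z k) \<le> 2 * \<eta>"
      using dz[OF that(1)] \<eta>(1) by (auto simp: norm_minus_commute)
    then show ?thesis
      using that far[of k] far[of "Suc k"] near[of "z k" "z (Suc k)"] near[of "z (Suc k)" "z k"] base
      unfolding G_def by blast
  qed
  have lipG: "norm (s (z (Suc k)) v - s (z k) v) \<le> L * norm (?d k) * norm v" if "k \<in> G" for k v
    using that C[of k] C[of "Suc k"] unfolding G_def by (intro lip) auto
  \<comment> \<open>\<open>e1\<close> is the error of the trapezoidal rule, \<open>e2\<close> what tangentiality leaves of the noise, and \<open>e3\<close>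
    the part of \<open>c k \<bullet> R k\<close> due to the increment of the field; each is a product of increments\<close>
  define e1 where "e1 k = g (Suc k) - g k - ((?\<Phi> k + ?\<Phi> (Suc k)) / 2) * ((norm (z (Suc k)))\<^sup>2 - (norm (z k))\<^sup>2)" for k
  define e2 where "e2 k = - (1 / 4) * (?\<Phi> k + ?\<Phi> (Suc k)) * (?d k \<bullet> (s (z (Suc k)) (w k) - s (z k) (w k)))" for k
  define e3 where "e3 k = - (1 / 2) * (c k \<bullet> (s (z (Suc k)) (w k) - s (z k) (w k)))" for k
  have R_eq: "?d k = R k + (1 / 2) *\<^sub>R (s (z k) (w k) + s (z (Suc k)) (w k))" for k
    by (simp add: R_def)
  have noise: "((?\<Phi> k + ?\<Phi> (Suc k)) / 2) * ((z k + z (Suc k)) \<bullet> ((1 / 2) *\<^sub>R (s (z k) (w k) + s (z (Suc k)) (w k)))) = e2 k" for k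
    unfolding e2_def
    by (simp add: inner_add_left inner_add_right inner_diff_left inner_diff_right tangential field_simps)
  have sq: "(norm (z (Suc k)))\<^sup>2 - (norm (z k))\<^sup>2 = (z k + z (Suc k)) \<bullet> ?d k" for k
    by (simp add: power2_norm_eq_inner inner_add_left inner_diff_right inner_commute[of "z (Suc k)" "z k"])
  have cR: "c k \<bullet> R k = c k \<bullet> ?d k - c k \<bullet> s (z k) (w k) + e3 k" for k
    unfolding e3_def R_def by (simp add: inner_add_right inner_diff_right algebra_simps)
  have step: "g (Suc k) - g k = e1 k + e2 k + D k \<bullet> R k + 2 * (h (B k) \<bullet> R k)
      + 2 * (c k \<bullet> ?d k) - 2 * (c k \<bullet> s (z k) (w k)) + 2 * e3 k" for k
  proof -
    have "g (Suc k) - g k = e1 k + ((?\<Phi> k + ?\<Phi> (Suc k)) / 2) * ((z k + z (Suc k)) \<bullet> ?d k)"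
      unfolding e1_def sq by simp
    also have "(z k + z (Suc k)) \<bullet> ?d k = (z k + z (Suc k)) \<bullet> R k +
        (z k + z (Suc k)) \<bullet> ((1 / 2) *\<^sub>R (s (z k) (w k) + s (z (Suc k)) (w k)))"
      unfolding R_eq inner_add_right ..
    also have "((?\<Phi> k + ?\<Phi> (Suc k)) / 2) * \<dots> = ((?\<Phi> k + ?\<Phi> (Suc k)) / 2) * ((z k + z (Suc k)) \<bullet> R k) + e2 k"
      unfolding distrib_left noise ..
    also have "((?\<Phi> k + ?\<Phi> (Suc k)) / 2) * ((z k + z (Suc k)) \<bullet> R k) = D k \<bullet> R k + 2 * (h k \<bullet> R k)"
      unfolding D_def by (simp add: inner_diff_left)
    also have "h k \<bullet> R k = h (B k) \<bullet> R k + c k \<bullet> R k"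
      unfolding c_def by (simp add: inner_diff_left)
    finally show ?thesis unfolding cR by simp
  qed
  have b1: "\<bar>\<Sum>k<K. e1 k\<bar> \<le> (20 * C ^ 3 * \<eta>) * Qz"
  proof (rule abs_sum_le_scaled[OF _ Qz])
    fix k assume k: "k < K"
    have "(z k + z (Suc k)) \<bullet> ?d k = (norm (z (Suc k)) - norm (z k)) * (norm (z (Suc k)) + norm (z k))"
      unfolding sq[symmetric] by (simp add: power2_eq_square algebra_simps)
    then have "\<bar>(norm (z (Suc k)))\<^sup>2 - (norm (z k))\<^sup>2\<bar> \<le> norm (?d k) * (2 * C)"
      unfolding sq using C[of k] C[of "Suc k"] k
      by (simp add: abs_mult) (intro mult_mono norm_triangle_ineq3; simp)
    then have "\<bar>(norm (z (Suc k)))\<^sup>2 - (norm (z k))\<^sup>2\<bar> ^ 3 \<le> (norm (?d k) * (2 * C)) ^ 3"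
      by (intro power_mono) auto
    moreover have "\<bar>e1 k\<bar> \<le> 5 / 2 * \<bar>(norm (z (Suc k)))\<^sup>2 - (norm (z k))\<^sup>2\<bar> ^ 3"
      using trapezoid_cube[of "(norm (z (Suc k)))\<^sup>2 - \<alpha>" "(norm (z k))\<^sup>2 - \<alpha>"]
      unfolding e1_def g_def cutoff_def by simp
    ultimately have "\<bar>e1 k\<bar> \<le> 5 / 2 * (norm (?d k) * (2 * C)) ^ 3" by linarith
    also have "\<dots> = 20 * C ^ 3 * norm (?d k) * (norm (?d k))\<^sup>2"
      by (simp add: power_mult_distrib power3_eq_cube power2_eq_square)
    also have "\<dots> \<le> 20 * C ^ 3 * \<eta> * (norm (?d k))\<^sup>2"
      using dz[OF k] C0 by (intro mult_right_mono mult_left_mono) auto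
    finally show "\<bar>e1 k\<bar> \<le> (20 * C ^ 3 * \<eta>) * (norm (?d k))\<^sup>2" .
  qed (use C0 \<eta> in auto)
  have b2: "\<bar>\<Sum>k<K. e2 k\<bar> \<le> (2 * C ^ 4 * L * \<eta>) * Qz"
  proof (rule abs_sum_le_scaled[OF _ Qz])
    fix k assume k: "k < K"
    show "\<bar>e2 k\<bar> \<le> (2 * C ^ 4 * L * \<eta>) * (norm (?d k))\<^sup>2"
    proof (cases "?\<Phi> k \<noteq> 0 \<or> ?\<Phi> (Suc k) \<noteq> 0")
      case False
      then have "e2 k = 0" by (simp add: e2_def)
      then show ?thesis using C0 L \<eta> by simp
    next
      case True
      have "norm (s (z (Suc k)) (w k) - s (z k) (w k)) \<le> L * norm (?d k) * \<eta>"
        using lipG[OF G_I[OF k True], of "w k"] dw[OF k] L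
        by (meson mult_left_mono mult_nonneg_nonneg norm_ge_zero order_trans)
      then have i: "\<bar>?d k \<bullet> (s (z (Suc k)) (w k) - s (z k) (w k))\<bar> \<le> norm (?d k) * (L * norm (?d k) * \<eta>)"
        by (intro order_trans[OF Cauchy_Schwarz_ineq2] mult_left_mono) auto
      have "\<bar>e2 k\<bar> = (1 / 4) * (?\<Phi> k + ?\<Phi> (Suc k)) * \<bar>?d k \<bullet> (s (z (Suc k)) (w k) - s (z k) (w k))\<bar>"
        unfolding e2_def using Phi(1)[of k] Phi(1)[of "Suc k"] k by (simp add: abs_mult)
      also have "\<dots> \<le> (1 / 4) * (3 * C ^ 4 + 3 * C ^ 4) * (norm (?d k) * (L * norm (?d k) * \<eta>))"
        using Phi[of k] Phi[of "Suc k"] k i by (intro mult_mono add_mono) auto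
      also have "\<dots> = (3 / 2) * (C ^ 4 * L * \<eta> * (norm (?d k))\<^sup>2)" by (simp add: power2_eq_square)
      also have "\<dots> \<le> 2 * (C ^ 4 * L * \<eta> * (norm (?d k))\<^sup>2)"
        using C0 L \<eta> by (intro mult_right_mono) auto
      finally show ?thesis by (simp add: mult.assoc)
    qed
  qed (use C0 L \<eta> in auto)
  have D_le: "norm (D k) \<le> 15 * C ^ 4 * norm (?d k)" if k: "k < K" for k
  proof -
    have "D k = (1 / 2) *\<^sub>R ((h (Suc k) - h k) + ?\<Phi> k *\<^sub>R ?d k + (?\<Phi> (Suc k) - ?\<Phi> k) *\<^sub>R z k)"
      unfolding D_def h_def by (rule averaged_product)
    also have "norm \<dots> \<le> (1 / 2) * (norm (h (Suc k) - h k) + ?\<Phi> k * norm (?d k) + \<bar>?\<Phi> (Suc k) - ?\<Phi> k\<bar> * norm (z k))"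
      using Phi(1)[of k] k
        norm_triangle_ineq[of "(h (Suc k) - h k) + ?\<Phi> k *\<^sub>R ?d k" "(?\<Phi> (Suc k) - ?\<Phi> k) *\<^sub>R z k"]
        norm_triangle_ineq[of "h (Suc k) - h k" "?\<Phi> k *\<^sub>R ?d k"] by simp
    also have "\<dots> \<le> (1 / 2) * (15 * C ^ 4 * norm (?d k) + 3 * C ^ 4 * norm (?d k) + 12 * C ^ 3 * norm (?d k) * C)"
      using cutoff_field_lipschitz[OF C C, of "Suc k" k \<alpha>] cutoff_lipschitz[OF C C, of "Suc k" k \<alpha>]
        Phi(2)[of k] C[of k] C0 k \<alpha> unfolding h_def
      by (intro mult_left_mono add_mono mult_right_mono mult_mono) auto
    also have "\<dots> = 15 * C ^ 4 * norm (?d k)" by (simp add: power_numeral_reduce)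
    finally show ?thesis .
  qed
  have b3: "\<bar>\<Sum>k<K. D k \<bullet> R k\<bar> \<le> (15 * C ^ 4 * \<eta>) * (Qz + 1)"
  proof (rule abs_sum_le_scaled)
    let ?g = "\<lambda>k. (norm (?d k))\<^sup>2 + (if k \<in> G then (norm (R k))\<^sup>2 / \<eta>\<^sup>2 else 0)"
    have "(\<Sum>k<K. if k \<in> G then (norm (R k))\<^sup>2 / \<eta>\<^sup>2 else 0) = (\<Sum>k\<in>G. (norm (R k))\<^sup>2 / \<eta>\<^sup>2)"
    proof -
      have "{..<K} \<inter> G = G" unfolding G_def by auto
      then show ?thesis using sum.inter_restrict[of "{..<K}" "\<lambda>k. (norm (R k))\<^sup>2 / \<eta>\<^sup>2" G] by simp
    qed
    also have "\<dots> \<le> 1"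
      using R2 \<eta> unfolding G_def sum_divide_distrib[symmetric] by (simp add: field_simps)
    finally show "(\<Sum>k<K. ?g k) \<le> Qz + 1" using Qz by (simp add: sum.distrib)
    fix k assume k: "k < K"
    show "\<bar>D k \<bullet> R k\<bar> \<le> 15 * C ^ 4 * \<eta> * ?g k"
    proof (cases "k \<in> G")
      case False
      then have "?\<Phi> k = 0" "?\<Phi> (Suc k) = 0" using G_I[OF k] by auto
      then have "D k = 0" unfolding D_def h_def by simp
      then show ?thesis using C0 \<eta> False by simp
    next
      case True
      have "2 * (norm (?d k) * (norm (R k) / \<eta>)) \<le> (norm (?d k))\<^sup>2 + (norm (R k) / \<eta>)\<^sup>2"
        using sum_squares_bound[of "norm (?d k)" "norm (R k) / \<eta>"] by simp
      moreover have "0 \<le> norm (?d k) * (norm (R k) / \<eta>)" using \<eta> by simp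
      ultimately have "norm (?d k) * (norm (R k) / \<eta>) \<le> ?g k" using True by (simp add: power_divide)
      then have *: "norm (?d k) * norm (R k) \<le> \<eta> * ?g k" using \<eta> by (simp add: field_simps)
      have "\<bar>D k \<bullet> R k\<bar> \<le> norm (D k) * norm (R k)" by (rule Cauchy_Schwarz_ineq2)
      also have "\<dots> \<le> 15 * C ^ 4 * norm (?d k) * norm (R k)"
        using D_le[OF k] by (intro mult_right_mono) auto
      also have "\<dots> = 15 * C ^ 4 * (norm (?d k) * norm (R k))" by simp
      also have "\<dots> \<le> 15 * C ^ 4 * (\<eta> * ?g k)" using * C0 by (intro mult_left_mono) auto
      finally show ?thesis by (simp add: mult.assoc)
    qed
  qed (use C0 \<eta> in auto)
  have c_le: "norm (c k) \<le> 15 * C ^ 4 * \<eta>" if "k < K" for k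
  proof -
    have "norm (c k) \<le> 15 * C ^ 4 * norm (z k - z (B k))"
      unfolding c_def h_def using that B[OF that] \<alpha> by (intro cutoff_field_lipschitz C) auto
    also have "\<dots> \<le> 15 * C ^ 4 * \<eta>" using zB[OF that] C0 by (intro mult_left_mono) auto
    finally show ?thesis .
  qed
  have b4: "\<bar>\<Sum>k<K. e3 k\<bar> \<le> (15 * C ^ 4 * \<eta> * L) * (Qz + Qw)"
  proof (rule abs_sum_le_scaled)
    show "(\<Sum>k<K. (norm (?d k))\<^sup>2 + (norm (w k))\<^sup>2) \<le> Qz + Qw" using Qz Qw by (simp add: sum.distrib)
    fix k assume k: "k < K"
    show "\<bar>e3 k\<bar> \<le> 15 * C ^ 4 * \<eta> * L * ((norm (?d k))\<^sup>2 + (norm (w k))\<^sup>2)"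
    proof (cases "c k = 0")
      case True
      then show ?thesis using C0 \<eta> L by (simp add: e3_def)
    next
      case False
      then have "?\<Phi> k \<noteq> 0 \<or> ?\<Phi> (B k) \<noteq> 0" unfolding c_def h_def by auto
      moreover have "norm (z (B k) - z k) \<le> 2 * \<eta>" "norm (z k - z (Suc k)) \<le> 2 * \<eta>"
        using zB[OF k] dz[OF k] \<eta> by (auto simp: norm_minus_commute)
      moreover have "norm (z (B k) - z (Suc k)) \<le> 2 * \<eta>"
        using zB[OF k] dz[OF k] norm_triangle_ineq[of "z (B k) - z k" "z k - z (Suc k)"]
        by (simp add: norm_minus_commute)
      ultimately have "k \<in> G"
        using k base far[of k] far[of "B k"] near[of "z (B k)" "z k"] near[of "z k" "z (Suc k)"] near[of "z (B k)" "z (Suc k)"]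
        unfolding G_def by blast
      have "2 * (norm (?d k) * norm (w k)) \<le> (norm (?d k))\<^sup>2 + (norm (w k))\<^sup>2"
        using sum_squares_bound[of "norm (?d k)" "norm (w k)"] by simp
      moreover have "0 \<le> norm (?d k) * norm (w k)" by simp
      ultimately have dw_le: "norm (?d k) * norm (w k) \<le> (norm (?d k))\<^sup>2 + (norm (w k))\<^sup>2" by linarith
      have "\<bar>e3 k\<bar> \<le> \<bar>c k \<bullet> (s (z (Suc k)) (w k) - s (z k) (w k))\<bar>" by (simp add: e3_def abs_mult)
      also have "\<dots> \<le> norm (c k) * norm (s (z (Suc k)) (w k) - s (z k) (w k))" by (rule Cauchy_Schwarz_ineq2)
      also have "\<dots> \<le> (15 * C ^ 4 * \<eta>) * (L * norm (?d k) * norm (w k))"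
        using c_le[OF k] lipG[OF \<open>k \<in> G\<close>] C0 \<eta> by (intro mult_mono) auto
      also have "\<dots> = 15 * C ^ 4 * \<eta> * L * (norm (?d k) * norm (w k))" by simp
      also have "\<dots> \<le> 15 * C ^ 4 * \<eta> * L * ((norm (?d k))\<^sup>2 + (norm (w k))\<^sup>2)"
        using dw_le C0 \<eta> L by (intro mult_left_mono) auto
      finally show ?thesis .
    qed
  qed (use C0 \<eta> L in auto)
  have "g K - g 0 = (\<Sum>k<K. g (Suc k) - g k)" by (rule sum_lessThan_telescope[symmetric])
  also have "\<dots> = (\<Sum>k<K. e1 k) + (\<Sum>k<K. e2 k) + (\<Sum>k<K. D k \<bullet> R k) + 2 * (\<Sum>k<K. h (B k) \<bullet> R k)
      + 2 * (\<Sum>k<K. c k \<bullet> ?d k) - 2 * (\<Sum>k<K. c k \<bullet> s (z k) (w k)) + 2 * (\<Sum>k<K. e3 k)"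
    unfolding step by (simp add: sum.distrib sum_subtractf sum_distrib_left)
  also have "\<bar>\<dots>\<bar> \<le> (20 * C ^ 3 * \<eta>) * Qz + (2 * C ^ 4 * L * \<eta>) * Qz + (15 * C ^ 4 * \<eta>) * (Qz + 1)
      + 2 * \<eta> + 2 * (\<eta> * (15 * C ^ 4 * \<kappa>z)) + 2 * (\<eta> * (15 * C ^ 4 * S * \<kappa>w)) + 2 * ((15 * C ^ 4 * \<eta> * L) * (Qz + Qw))"
  proof -
    have "\<bar>x1 + x2 + x3 + 2 * x4 + 2 * x5 - 2 * x6 + 2 * x7\<bar> \<le> y1 + y2 + y3 + 2 * y4 + 2 * y5 + 2 * y6 + 2 * y7"
      if "\<bar>x1\<bar> \<le> y1" "\<bar>x2\<bar> \<le> y2" "\<bar>x3\<bar> \<le> y3" "\<bar>x4\<bar> \<le> y4" "\<bar>x5\<bar> \<le> y5" "\<bar>x6\<bar> \<le> y6" "\<bar>x7\<bar> \<le> y7"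
      for x1 x2 x3 x4 x5 x6 x7 y1 y2 y3 y4 y5 y6 y7 :: real
      using that unfolding abs_le_iff by (intro conjI; linarith)
    from this[OF b1 b2 b3 blocks cz[folded c_def] cw[folded c_def] b4]
    show "\<bar>(\<Sum>k<K. e1 k) + (\<Sum>k<K. e2 k) + (\<Sum>k<K. D k \<bullet> R k) + 2 * (\<Sum>k<K. h (B k) \<bullet> R k)
      + 2 * (\<Sum>k<K. c k \<bullet> ?d k) - 2 * (\<Sum>k<K. c k \<bullet> s (z k) (w k)) + 2 * (\<Sum>k<K. e3 k)\<bar> \<le>
      (20 * C ^ 3 * \<eta>) * Qz + (2 * C ^ 4 * L * \<eta>) * Qz + (15 * C ^ 4 * \<eta>) * (Qz + 1)
      + 2 * \<eta> + 2 * (\<eta> * (15 * C ^ 4 * \<kappa>z)) + 2 * (\<eta> * (15 * C ^ 4 * S * \<kappa>w)) + 2 * ((15 * C ^ 4 * \<eta> * L) * (Qz + Qw))" .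
  qed
  also have "\<dots> = \<eta> * (20 * C ^ 3 * Qz + 2 * C ^ 4 * L * Qz + 15 * C ^ 4 * (Qz + 1) + 2
      + 30 * C ^ 4 * (\<kappa>z + S * \<kappa>w + L * (Qz + Qw)))"
    by (simp add: algebra_simps)
  finally show ?thesis unfolding g_def .
qed

section \<open>Tangential Stratonovich equations preserve the norm\<close>

lemma good_integrator_boundE:
  assumes "good_integrator P F a b X" "0 < \<epsilon>"
  obtains \<kappa> where "0 \<le> \<kappa>"
    "\<And>n c \<tau>. 0 < \<tau> \<Longrightarrow> (\<And>k. k < 2 ^ n \<Longrightarrow> c k \<in> borel_measurable (F (grid a b n k))) \<Longrightarrow>
      whp P \<epsilon> (\<lambda>\<omega>. (\<forall>k<2 ^ n. norm (c k \<omega>) \<le> \<tau>) \<longrightarrow>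
        \<bar>grid_integral a b n c X \<omega>\<bar> \<le> \<tau> * \<kappa>)"
proof -
  obtain \<kappa> where \<kappa>0: "0 \<le> \<kappa>" and
    \<kappa>: "\<And>n c. unit_integrand P F a b n c \<Longrightarrow>
      whp P \<epsilon> (\<lambda>\<omega>. \<bar>grid_integral a b n c X \<omega>\<bar> \<le> \<kappa>)"
    using good_integratorE[OF assms] by blast
  show ?thesis
  proof (rule that[OF \<kappa>0])
    fix n \<tau> and c :: "nat \<Rightarrow> 'a \<Rightarrow> 'b"
    assume \<tau>: "0 < (\<tau>::real)" and c: "\<And>k. k < 2 ^ n \<Longrightarrow> c k \<in> borel_measurable (F (grid a b n k))"
    define c' where "c' k \<omega> = (if norm (c k \<omega>) \<le> \<tau> then (1 / \<tau>) *\<^sub>R c k \<omega> else 0)" for k \<omega>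
    have "whp P \<epsilon> (\<lambda>\<omega>. \<bar>grid_integral a b n c' X \<omega>\<bar> \<le> \<kappa>)"
    proof (rule \<kappa>, intro allI impI conjI ballI)
      fix k :: nat assume "k < 2 ^ n"
      note [measurable] = c[OF this]
      show "c' k \<in> borel_measurable (F (grid a b n k))" unfolding c'_def[abs_def] by measurable
      show "norm (c' k \<omega>) \<le> 1" for \<omega> using \<tau> by (simp add: c'_def)
    qed
    then show "whp P \<epsilon> (\<lambda>\<omega>. (\<forall>k<2 ^ n. norm (c k \<omega>) \<le> \<tau>) \<longrightarrow>
        \<bar>grid_integral a b n c X \<omega>\<bar> \<le> \<tau> * \<kappa>)"
    proof (rule whp_mono[OF _ order_refl], intro impI)
      fix \<omega> assume le: "\<bar>grid_integral a b n c' X \<omega>\<bar> \<le> \<kappa>"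
        and small: "\<forall>k<2 ^ n. norm (c k \<omega>) \<le> \<tau>"
      have "grid_integral a b n c X \<omega> =
        \<tau> * grid_integral a b n c' X \<omega>"
        unfolding sum_distrib_left using small \<tau> by (intro sum.cong) (auto simp: c'_def)
      then show "\<bar>grid_integral a b n c X \<omega>\<bar> \<le> \<tau> * \<kappa>"
        using le \<tau> by (simp add: abs_mult)
    qed
  qed
qed

text \<open>
  The sum of the squared increments is \<open>|X b|\<^sup>2 - |X a|\<^sup>2\<close> minus twice the elementary integral of \<open>X\<close>
  against itself, and the paths are bounded up to a small probability.
\<close>
lemma (in filtered_prob_space) whp_square_sum_bounded:
  fixes X :: "real \<Rightarrow> 'a \<Rightarrow> 'b::euclidean_space"
  assumes ab: "a \<le> b" and adapted: "\<And>t. t \<in> {a..b} \<Longrightarrow> X t \<in> borel_measurable (F t)"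
    and cont: "AE \<omega> in M. continuous_on {a..b} (\<lambda>t. X t \<omega>)"
    and good: "good_integrator M F a b X" and eps: "0 < \<epsilon>"
  obtains Q where "0 \<le> Q"
    "\<And>n. whp M \<epsilon> (\<lambda>\<omega>. (\<Sum>k<2 ^ n. (norm (X (grid a b n (Suc k)) \<omega> - X (grid a b n k) \<omega>))\<^sup>2) \<le> Q)"
proof -
  have e: "0 < \<epsilon> / 2" using eps by simp
  obtain C where C: "0 < C" "whp M (\<epsilon> / 2) (\<lambda>\<omega>. \<forall>t\<in>dyadics a b. norm (X t \<omega>) \<le> C)"
    using whp_path_bounded[OF ab _ cont e] adapted measurable_F_M by blast
  obtain \<kappa> where \<kappa>: "0 \<le> \<kappa>" "\<And>n c \<tau>. 0 < \<tau> \<Longrightarrow> (\<And>k. k < 2 ^ n \<Longrightarrow> c k \<in> borel_measurable (F (grid a b n k))) \<Longrightarrow>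
      whp M (\<epsilon> / 2) (\<lambda>\<omega>. (\<forall>k<2 ^ n. norm (c k \<omega>) \<le> \<tau>) \<longrightarrow>
        \<bar>grid_integral a b n c X \<omega>\<bar> \<le> \<tau> * \<kappa>)"
    using good_integrator_boundE[OF good e] by blast
  show ?thesis
  proof (rule that[of "C\<^sup>2 + 2 * (C * \<kappa>)"])
    show "0 \<le> C\<^sup>2 + 2 * (C * \<kappa>)" using C \<kappa>(1) by simp
    fix n
    let ?x = "\<lambda>k \<omega>. X (grid a b n k) \<omega>"
    have "whp M (\<epsilon> / 2) (\<lambda>\<omega>. (\<forall>k<2 ^ n. norm (?x k \<omega>) \<le> C) \<longrightarrow>
        \<bar>\<Sum>k<2 ^ n. ?x k \<omega> \<bullet> (?x (Suc k) \<omega> - ?x k \<omega>)\<bar> \<le> C * \<kappa>)"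
      using C(1) grid_in[OF ab] adapted by (intro \<kappa>(2)) auto
    from whp_conj[OF C(2) this]
    show "whp M \<epsilon> (\<lambda>\<omega>. (\<Sum>k<2 ^ n. (norm (?x (Suc k) \<omega> - ?x k \<omega>))\<^sup>2) \<le> C\<^sup>2 + 2 * (C * \<kappa>))"
    proof (rule whp_mono)
      fix \<omega> assume *: "(\<forall>t\<in>dyadics a b. norm (X t \<omega>) \<le> C) \<and> ((\<forall>k<2 ^ n. norm (?x k \<omega>) \<le> C) \<longrightarrow>
        \<bar>\<Sum>k<2 ^ n. ?x k \<omega> \<bullet> (?x (Suc k) \<omega> - ?x k \<omega>)\<bar> \<le> C * \<kappa>)"
      then have x_le: "norm (?x k \<omega>) \<le> C" if "k \<le> 2 ^ n" for k using that by auto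
      have sq: "(norm (?x (Suc k) \<omega> - ?x k \<omega>))\<^sup>2 =
          ((norm (?x (Suc k) \<omega>))\<^sup>2 - (norm (?x k \<omega>))\<^sup>2) - 2 * (?x k \<omega> \<bullet> (?x (Suc k) \<omega> - ?x k \<omega>))" for k
        by (simp add: power2_norm_eq_inner inner_diff_left inner_diff_right
            inner_commute[of "?x (Suc k) \<omega>" "?x k \<omega>"])
      have "(\<Sum>k<2 ^ n. (norm (?x (Suc k) \<omega> - ?x k \<omega>))\<^sup>2) =
          ((norm (?x (2 ^ n) \<omega>))\<^sup>2 - (norm (?x 0 \<omega>))\<^sup>2) - 2 * (\<Sum>k<2 ^ n. ?x k \<omega> \<bullet> (?x (Suc k) \<omega> - ?x k \<omega>))"
        unfolding sq sum_subtractf[of _ "\<lambda>k. 2 * _ k"] sum_distrib_left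
          sum_lessThan_telescope[of "\<lambda>k. (norm (?x k \<omega>))\<^sup>2" "2 ^ n"] ..
      also have "\<dots> \<le> (norm (?x (2 ^ n) \<omega>))\<^sup>2 + 2 * (C * \<kappa>)"
      proof -
        have "\<bar>\<Sum>k<2 ^ n. ?x k \<omega> \<bullet> (?x (Suc k) \<omega> - ?x k \<omega>)\<bar> \<le> C * \<kappa>" using * x_le by simp
        moreover have "0 \<le> (norm (?x 0 \<omega>))\<^sup>2" by simp
        ultimately show ?thesis by linarith
      qed
      also have "\<dots> \<le> C\<^sup>2 + 2 * (C * \<kappa>)"
        using x_le[of "2 ^ n"] by (intro add_right_mono power_mono) auto
      finally show "(\<Sum>k<2 ^ n. (norm (?x (Suc k) \<omega> - ?x k \<omega>))\<^sup>2) \<le> C\<^sup>2 + 2 * (C * \<kappa>)" .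
    qed simp
  qed
qed

text \<open>
  The adjoint of \<open>s x\<close> turns the pairing of a coefficient with the integrand \<open>s (z) dW\<close> into an elementary
  integral against \<open>W\<close>.
\<close>
definition adjoint_field :: "('v::euclidean_space \<Rightarrow> 'w::euclidean_space \<Rightarrow> 'v) \<Rightarrow> 'v \<Rightarrow> 'v \<Rightarrow> 'w" where
  "adjoint_field s x c = (\<Sum>i\<in>Basis. (c \<bullet> s x i) *\<^sub>R i)"

lemma linear_field_expand:
  fixes s :: "'v::euclidean_space \<Rightarrow> 'w::euclidean_space \<Rightarrow> 'v"
  assumes "linear (s x)"
  shows "s x w = (\<Sum>i\<in>Basis. (w \<bullet> i) *\<^sub>R s x i)"
proof -
  have "s x w = s x (\<Sum>i\<in>Basis. (w \<bullet> i) *\<^sub>R i)" by (simp add: euclidean_representation)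
  also have "\<dots> = (\<Sum>i\<in>Basis. (w \<bullet> i) *\<^sub>R s x i)"
    using assms by (simp add: linear_sum linear_scale)
  finally show ?thesis .
qed

lemma inner_adjoint_field:
  assumes "linear (s x)"
  shows "adjoint_field s x c \<bullet> w = c \<bullet> s x w"
  unfolding adjoint_field_def linear_field_expand[of s x w, OF assms]
  by (simp add: inner_sum_left inner_sum_right inner_commute mult.commute)

lemma norm_adjoint_field_le:
  assumes lin: "linear (s x)" and S: "0 \<le> S" "\<And>w. norm (s x w) \<le> S * norm w"
  shows "norm (adjoint_field s x c) \<le> S * norm c"
proof -
  let ?d = "adjoint_field s x c"
  have "norm ?d * norm ?d = c \<bullet> s x ?d"
    using inner_adjoint_field[of s x c ?d, OF lin]
    by (simp add: power2_norm_eq_inner flip: power2_eq_square)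
  also have "\<dots> \<le> norm c * (S * norm ?d)"
    using S(2)[of ?d] by (intro order_trans[OF norm_cauchy_schwarz] mult_left_mono) auto
  finally have "norm ?d * norm ?d \<le> (S * norm c) * norm ?d" by (simp add: mult_ac)
  then show ?thesis
  proof (cases "?d = 0")
    case True
    then show ?thesis using S(1) by simp
  qed simp
qed

lemma measurable_field:
  fixes s :: "'v::euclidean_space \<Rightarrow> 'w::euclidean_space \<Rightarrow> 'v"
  assumes lin: "\<And>x. linear (s x)" and s: "\<And>w. (\<lambda>x. s x w) \<in> borel_measurable borel"
    and [measurable]: "f \<in> borel_measurable N" "g \<in> borel_measurable N"
  shows "(\<lambda>\<omega>. s (f \<omega>) (g \<omega>)) \<in> borel_measurable N"
proof -
  have [measurable]: "(\<lambda>\<omega>. s (f \<omega>) i) \<in> borel_measurable N" for i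
    using measurable_compose[OF _ s] by measurable
  show ?thesis unfolding linear_field_expand[of s "f _" "g _", OF lin] by measurable
qed

lemma measurable_adjoint_field:
  fixes s :: "'v::euclidean_space \<Rightarrow> 'w::euclidean_space \<Rightarrow> 'v"
  assumes s: "\<And>w. (\<lambda>x. s x w) \<in> borel_measurable borel"
    and [measurable]: "f \<in> borel_measurable N" "g \<in> borel_measurable N"
  shows "(\<lambda>\<omega>. adjoint_field s (f \<omega>) (g \<omega>)) \<in> borel_measurable N"
proof -
  have [measurable]: "(\<lambda>\<omega>. s (f \<omega>) i) \<in> borel_measurable N" for i
    using measurable_compose[OF _ s] by measurable
  show ?thesis unfolding adjoint_field_def by measurable
qed

lemma (in prob_space) AE_eq_0_of_whp:
  fixes X :: "'a \<Rightarrow> real"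
  assumes "\<And>\<epsilon> \<delta>. 0 < \<epsilon> \<Longrightarrow> 0 < \<delta> \<Longrightarrow> whp M \<epsilon> (\<lambda>\<omega>. \<bar>X \<omega>\<bar> \<le> \<delta>)"
  shows "AE \<omega> in M. X \<omega> = 0"
proof -
  have "AE \<omega> in M. \<bar>X \<omega>\<bar> \<le> inverse (Suc n)" for n
    using assms by (intro AE_of_whp) simp
  then have "AE \<omega> in M. \<forall>n. \<bar>X \<omega>\<bar> \<le> inverse (Suc n)" by (simp add: AE_all_countable)
  then show ?thesis
  proof eventually_elim
    case (elim \<omega>)
    have "\<bar>X \<omega>\<bar> \<le> 0"
      by (rule LIMSEQ_le_const[OF LIMSEQ_inverse_real_of_nat]) (use elim in auto)
    then show ?case by simp
  qed
qed

definition stratonovich_defect ::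
  "('v \<Rightarrow> 'w \<Rightarrow> 'v) \<Rightarrow> (real \<Rightarrow> 'a \<Rightarrow> 'v::real_vector) \<Rightarrow> (real \<Rightarrow> 'a \<Rightarrow> 'w::real_vector) \<Rightarrow> real \<Rightarrow> real \<Rightarrow> 'a \<Rightarrow> 'v"
where
  "stratonovich_defect s z W u v \<omega> = z v \<omega> - z u \<omega> -
     (1 / 2) *\<^sub>R (s (z u \<omega>) (W v \<omega> - W u \<omega>) + s (z v \<omega>) (W v \<omega> - W u \<omega>))"

text \<open>
  The constants are fixed in the order in which they depend on each other: a bound \<open>C\<close> of the paths; the
  bounds \<open>S\<close> and \<open>L\<close> of the field on the annulus up to \<open>C\<close>; the constants of the good integrators and of
  the sums of squares; then the oscillation \<open>\<eta>\<close>, to which the whole increment is proportional; then the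
  level \<open>m\<close> of the blocks, on which the paths oscillate by at most \<open>\<eta>\<close>; and finally a level \<open>n\<close> at which
  the sums of the defects over all blocks and over all sets of indices are small compared with \<open>\<eta>\<close> and
  with the number of blocks.
\<close>
lemma (in filtered_prob_space) cutoff_energy_conserved:
  fixes z :: "real \<Rightarrow> 'a \<Rightarrow> 'v::euclidean_space" and W :: "real \<Rightarrow> 'a \<Rightarrow> 'w::euclidean_space"
    and s :: "'v \<Rightarrow> 'w \<Rightarrow> 'v"
  assumes ab: "a \<le> b"
    and z_adapted: "\<And>t. t \<in> {a..b} \<Longrightarrow> z t \<in> borel_measurable (F t)"
    and W_adapted: "\<And>t. t \<in> {a..b} \<Longrightarrow> W t \<in> borel_measurable (F t)"
    and z_cont: "AE \<omega> in M. continuous_on {a..b} (\<lambda>t. z t \<omega>)"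
    and W_cont: "AE \<omega> in M. continuous_on {a..b} (\<lambda>t. W t \<omega>)"
    and z_good: "good_integrator M F a b z" and W_good: "good_integrator M F a b W"
    and lin: "\<And>x. linear (s x)" and s_meas: "\<And>w. (\<lambda>x. s x w) \<in> borel_measurable borel"
    and tangential: "\<And>x w. x \<bullet> s x w = 0"
    and bound: "\<And>p q. 0 < p \<Longrightarrow> \<exists>S. \<forall>x w. p \<le> norm x \<longrightarrow> norm x \<le> q \<longrightarrow> norm (s x w) \<le> S * norm w"
    and lip: "\<And>p q. 0 < p \<Longrightarrow> \<exists>L\<ge>0. \<forall>x y w. p \<le> norm x \<longrightarrow> norm x \<le> q \<longrightarrow> p \<le> norm y \<longrightarrow> norm y \<le> q \<longrightarrow>
      norm (s x w - s y w) \<le> L * norm (x - y) * norm w"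
    and vanish: "\<And>t. t \<in> {a..b} \<Longrightarrow> vanishing_sums M (stratonovich_defect s z W) a t"
    and \<alpha>: "0 < \<alpha>"
  shows "AE \<omega> in M. (max 0 ((norm (z b \<omega>))\<^sup>2 - \<alpha>)) ^ 3 - (max 0 ((norm (z a \<omega>))\<^sup>2 - \<alpha>)) ^ 3 = 0"
proof (rule AE_eq_0_of_whp)
  fix \<epsilon> tol :: real assume "0 < \<epsilon>" and tol: "0 < tol"
  \<comment> \<open>nine exceptional events are combined below\<close>
  define e where "e = \<epsilon> / 9"
  have e: "0 < e" using \<open>0 < \<epsilon>\<close> by (simp add: e_def)
  define p where "p = sqrt \<alpha> / 2"
  have p: "0 < p" using \<alpha> by (simp add: p_def)
  have zM: "z t \<in> borel_measurable M" if "t \<in> {a..b}" for t using measurable_F_M[OF z_adapted[OF that]] .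
  have WM: "W t \<in> borel_measurable M" if "t \<in> {a..b}" for t using measurable_F_M[OF W_adapted[OF that]] .
  obtain C where C: "0 < C" and C_whp: "whp M e (\<lambda>\<omega>. \<forall>t\<in>dyadics a b. norm (z t \<omega>) \<le> C)"
    using whp_path_bounded[OF ab zM z_cont e] by blast
  obtain S where S: "0 < S" "\<And>x w. p \<le> norm x \<Longrightarrow> norm x \<le> C \<Longrightarrow> norm (s x w) \<le> S * norm w"
  proof -
    obtain S where S: "\<forall>x w. p \<le> norm x \<longrightarrow> norm x \<le> C \<longrightarrow> norm (s x w) \<le> S * norm w"
      using bound[OF p] by blast
    show thesis
    proof (rule that[of "\<bar>S\<bar> + 1"])
      fix x :: 'v and w :: 'w assume "p \<le> norm x" "norm x \<le> C"
      then have "norm (s x w) \<le> S * norm w" using S by blast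
      also have "\<dots> \<le> (\<bar>S\<bar> + 1) * norm w" by (intro mult_right_mono) auto
      finally show "norm (s x w) \<le> (\<bar>S\<bar> + 1) * norm w" .
    qed simp
  qed
  obtain L where L: "0 \<le> L" "\<And>x y w. p \<le> norm x \<Longrightarrow> norm x \<le> C \<Longrightarrow> p \<le> norm y \<Longrightarrow> norm y \<le> C \<Longrightarrow>
      norm (s x w - s y w) \<le> L * norm (x - y) * norm w"
    using lip[OF p] by blast
  obtain \<kappa>z where \<kappa>z: "0 \<le> \<kappa>z" "\<And>n c \<tau>. 0 < \<tau> \<Longrightarrow> (\<And>k. k < 2 ^ n \<Longrightarrow> c k \<in> borel_measurable (F (grid a b n k))) \<Longrightarrow>
      whp M e (\<lambda>\<omega>. (\<forall>k<2 ^ n. norm (c k \<omega>) \<le> \<tau>) \<longrightarrow>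
        \<bar>grid_integral a b n c z \<omega>\<bar> \<le> \<tau> * \<kappa>z)"
    using good_integrator_boundE[OF z_good e] by blast
  obtain \<kappa>w where \<kappa>w: "0 \<le> \<kappa>w" "\<And>n c \<tau>. 0 < \<tau> \<Longrightarrow> (\<And>k. k < 2 ^ n \<Longrightarrow> c k \<in> borel_measurable (F (grid a b n k))) \<Longrightarrow>
      whp M e (\<lambda>\<omega>. (\<forall>k<2 ^ n. norm (c k \<omega>) \<le> \<tau>) \<longrightarrow>
        \<bar>grid_integral a b n c W \<omega>\<bar> \<le> \<tau> * \<kappa>w)"
    using good_integrator_boundE[OF W_good e] by blast
  obtain Qz where Qz: "0 \<le> Qz"
    "\<And>n. whp M e (\<lambda>\<omega>. (\<Sum>k<2 ^ n. (norm (z (grid a b n (Suc k)) \<omega> - z (grid a b n k) \<omega>))\<^sup>2) \<le> Qz)"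
    using whp_square_sum_bounded[OF ab z_adapted z_cont z_good e] by blast
  obtain Qw where Qw: "0 \<le> Qw"
    "\<And>n. whp M e (\<lambda>\<omega>. (\<Sum>k<2 ^ n. (norm (W (grid a b n (Suc k)) \<omega> - W (grid a b n k) \<omega>))\<^sup>2) \<le> Qw)"
    using whp_square_sum_bounded[OF ab W_adapted W_cont W_good e] by blast
  define K0 where "K0 = 20 * C ^ 3 * Qz + 2 * C ^ 4 * L * Qz + 15 * C ^ 4 * (Qz + 1) + 2
      + 30 * C ^ 4 * (\<kappa>z + S * \<kappa>w + L * (Qz + Qw))"
  have K0: "0 < K0"
  proof -
    have "0 \<le> 20 * C ^ 3 * Qz" "0 \<le> 2 * C ^ 4 * L * Qz" "0 \<le> 15 * C ^ 4 * (Qz + 1)"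
      "0 \<le> 30 * C ^ 4 * (\<kappa>z + S * \<kappa>w + L * (Qz + Qw))"
      using C L Qz Qw S \<kappa>z \<kappa>w by simp_all
    then show ?thesis unfolding K0_def by linarith
  qed
  \<comment> \<open>respectively: neighbours of the support of the cutoff stay in the annulus; the defects there are at
    most one; the total increment is at most \<open>tol\<close>\<close>
  define \<eta> where "\<eta> = min (p / 2) (min (1 / (1 + S)) (tol / K0))"
  have \<eta>0: "0 < \<eta>" using p S tol K0 by (simp add: \<eta>_def)
  have \<eta>p: "2 * \<eta> \<le> p" and \<eta>S: "\<eta> * (1 + S) \<le> 1" and \<eta>tol: "\<eta> * K0 \<le> tol"
  proof -
    have 1: "\<eta> \<le> p / 2" unfolding \<eta>_def by (rule min.cobounded1)
    have 2: "\<eta> \<le> 1 / (1 + S)" unfolding \<eta>_def by (rule min.coboundedI2[OF min.cobounded1])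
    have 3: "\<eta> \<le> tol / K0" unfolding \<eta>_def by (rule min.coboundedI2[OF min.cobounded2])
    show "2 * \<eta> \<le> p" using 1 by linarith
    have "0 < 1 + S" using S(1) by linarith
    from pos_le_divide_eq[OF this, THEN iffD1, OF 2] show "\<eta> * (1 + S) \<le> 1" .
    from pos_le_divide_eq[OF K0, THEN iffD1, OF 3] show "\<eta> * K0 \<le> tol" .
  qed
  obtain \<delta>z where \<delta>z: "0 < \<delta>z" and z_mod: "whp M e (\<lambda>\<omega>. \<forall>t\<in>dyadics a b. \<forall>u\<in>dyadics a b.
      \<bar>t - u\<bar> \<le> \<delta>z \<longrightarrow> norm (z t \<omega> - z u \<omega>) \<le> \<eta>)"
    using whp_path_modulus[OF ab zM z_cont e \<eta>0] by blast
  obtain \<delta>w where \<delta>w: "0 < \<delta>w" and W_mod: "whp M e (\<lambda>\<omega>. \<forall>t\<in>dyadics a b. \<forall>u\<in>dyadics a b.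
      \<bar>t - u\<bar> \<le> \<delta>w \<longrightarrow> norm (W t \<omega> - W u \<omega>) \<le> \<eta>)"
    using whp_path_modulus[OF ab WM W_cont e \<eta>0] by blast
  obtain m where m: "\<And>n. m \<le> n \<Longrightarrow> (b - a) / 2 ^ n < min \<delta>z \<delta>w"
    using fine_grid[of "min \<delta>z \<delta>w" b a] \<delta>z \<delta>w by auto
  define \<beta> where "\<beta> = \<eta>\<^sup>2 / DIM('v)"
  have \<beta>: "0 < \<beta>" using \<eta>0 by (simp add: \<beta>_def)
  define \<theta> where "\<theta> = e / DIM('v) * (1 - exp (- (\<beta> / 4)))"
  have \<theta>: "0 < \<theta>" using e \<beta> by (simp add: \<theta>_def)
  \<comment> \<open>respectively: to bound \<open>t\<^sup>2\<close> by \<open>t\<close>; for the sum over the blocks, \<open>3 C^5\<close> bounding \<open>h\<close>; for the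
    number of exceptional events of the blocks; for the sums of squares of the coordinates\<close>
  define t where "t = min 1 (min (\<eta> / (2 ^ m * (3 * C ^ 5))) (min (e / 2 ^ m) (\<theta> / 9)))"
  have t0: "0 < t" using \<eta>0 C e \<theta> by (simp add: t_def)
  have t1: "t \<le> 1" and t_block: "2 ^ m * (3 * C ^ 5) * t \<le> \<eta>" and t_e: "2 ^ m * t \<le> e" and t_\<theta>: "9 * t \<le> \<theta>"
  proof -
    show "t \<le> 1" unfolding t_def by (rule min.cobounded1)
    have 2: "t \<le> \<eta> / (2 ^ m * (3 * C ^ 5))"
      unfolding t_def by (rule min.coboundedI2[OF min.cobounded1])
    have 3: "t \<le> e / 2 ^ m"
      unfolding t_def by (rule min.coboundedI2[OF min.coboundedI2[OF min.cobounded1]])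
    have "t \<le> \<theta> / 9"
      unfolding t_def by (rule min.coboundedI2[OF min.coboundedI2[OF min.cobounded2]])
    then show "9 * t \<le> \<theta>" by linarith
    have "0 < (2::real) ^ m * (3 * C ^ 5)" using C by simp
    from pos_le_divide_eq[OF this, THEN iffD1, OF 2] show "2 ^ m * (3 * C ^ 5) * t \<le> \<eta>"
      by (simp only: mult.commute)
    have "0 < (2::real) ^ m" by simp
    from pos_le_divide_eq[OF this, THEN iffD1, OF 3] show "2 ^ m * t \<le> e"
      by (simp only: mult.commute)
  qed
  let ?\<Psi> = "stratonovich_defect s z W"
  have "vanishing_sums M ?\<Psi> u v" if "a \<le> u" "u \<le> v" "v \<le> b" for u v
    using that by (intro vanishing_sums_subinterval[of a u] vanish) auto
  then obtain N where N: "\<And>n J. N \<le> n \<Longrightarrow> J \<subseteq> {..<2 ^ n} \<Longrightarrow>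
    whp M t (\<lambda>\<omega>. norm (\<Sum>k\<in>J. ?\<Psi> (grid a b n k) (grid a b n (Suc k)) \<omega>) \<le> t)"
    using vanishing_subset_sums[OF ab _ t0 t0, of ?\<Psi>] by blast
  define n where "n = max m N"
  have n: "m \<le> n" "N \<le> n" by (auto simp: n_def)
  define g where "g = grid a b n"
  define l where "l = (2::nat) ^ (n - m)"
  have l: "0 < l" "2 ^ m * l = 2 ^ n" using n by (auto simp: l_def power_add[symmetric])
  define B where "B k = k div l * l" for k
  have B_le: "B k \<le> k" for k by (simp add: B_def)
  have g_in: "g k \<in> {a..b}" if "k \<le> 2 ^ n" for k using grid_in[OF ab that] by (simp add: g_def)
  have g_dy: "g k \<in> dyadics a b" if "k \<le> 2 ^ n" for k using that by (auto simp: g_def)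
  have g_mono: "g j \<le> g k" if "j \<le> k" for j k using grid_mono[OF ab that] by (simp add: g_def)
  have g_step: "\<bar>g (Suc k) - g k\<bar> \<le> min \<delta>z \<delta>w" for k
    using m[OF n(1)] ab by (simp add: g_def grid_Suc_diff)
  have g_block: "\<bar>g k - g (B k)\<bar> \<le> min \<delta>z \<delta>w" for k
  proof -
    have "k = B k + k mod l" by (simp add: B_def)
    then have kB: "real k - real (B k) = real (k mod l)" by (metis add_diff_cancel_left' of_nat_add)
    have "g k - g (B k) = (b - a) * ((real k - real (B k)) / 2 ^ n)"
      unfolding g_def grid_def by (simp add: right_diff_distrib diff_divide_distrib)
    also have "\<dots> \<le> (b - a) * (real l / 2 ^ n)"
      unfolding kB using l(1) ab by (intro mult_left_mono divide_right_mono) (auto intro: less_imp_le)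
    also have "real l / 2 ^ n = 1 / 2 ^ m"
    proof -
      have "real (2 ^ m * l) = 2 ^ n" unfolding l(2) by simp
      then have "2 ^ m * real l = 2 ^ n" by simp
      then show ?thesis by (simp add: field_simps)
    qed
    finally have "g k - g (B k) \<le> (b - a) / 2 ^ m" by simp
    then show ?thesis using m[of m] g_mono[OF B_le[of k]] by simp
  qed
  define R where "R k \<omega> = ?\<Psi> (g k) (g (Suc k)) \<omega>" for k \<omega>
  define h where "h k \<omega> = cutoff \<alpha> (z (g k) \<omega>) *\<^sub>R z (g k) \<omega>" for k \<omega>
  define c where "c k \<omega> = h k \<omega> - h (B k) \<omega>" for k \<omega>
  define w where "w k \<omega> = W (g (Suc k)) \<omega> - W (g k) \<omega>" for k \<omega>
  define \<tau> where "\<tau> = 15 * C ^ 4 * \<eta>"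
  have \<tau>: "0 < \<tau>" using C \<eta>0 by (simp add: \<tau>_def)
  have h_meas: "h j \<in> borel_measurable (F (g k))" if "j \<le> k" "k \<le> 2 ^ n" for j k
  proof -
    have [measurable]: "z (g j) \<in> borel_measurable (F (g k))"
      using measurable_F_mono[OF z_adapted[OF g_in] g_mono[OF that(1)]] that by auto
    show ?thesis unfolding h_def[abs_def] cutoff_def by measurable
  qed
  have c_meas: "c k \<in> borel_measurable (F (g k))" if "k < 2 ^ n" for k
    unfolding c_def[abs_def] using h_meas[of k k] h_meas[of "B k" k] B_le that by auto
  have R_meas: "R k \<in> borel_measurable M" if "k < 2 ^ n" for k
  proof -
    have zk: "z (g k) \<in> borel_measurable M" and zk': "z (g (Suc k)) \<in> borel_measurable M"
      using that by (auto intro!: zM g_in)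
    have wk: "(\<lambda>\<omega>. W (g (Suc k)) \<omega> - W (g k) \<omega>) \<in> borel_measurable M"
      using that by (intro borel_measurable_diff WM g_in) auto
    have "(\<lambda>\<omega>. z (g (Suc k)) \<omega> - z (g k) \<omega> - (1 / 2) *\<^sub>R (s (z (g k) \<omega>) (W (g (Suc k)) \<omega> - W (g k) \<omega>)
        + s (z (g (Suc k)) \<omega>) (W (g (Suc k)) \<omega> - W (g k) \<omega>))) \<in> borel_measurable M"
      by (rule borel_measurable_diff[OF borel_measurable_diff[OF zk' zk] borel_measurable_scaleR[OF borel_measurable_const
            borel_measurable_add[OF measurable_field[OF lin s_meas zk wk] measurable_field[OF lin s_meas zk' wk]]]])
    then show ?thesis unfolding R_def[abs_def] stratonovich_defect_def[abs_def] .
  qed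
  have R_J: "whp M t (\<lambda>\<omega>. norm (\<Sum>k\<in>J. R k \<omega>) \<le> t)" if "J \<subseteq> {..<2 ^ n}" for J
    using N[OF n(2) that] by (simp add: R_def g_def)
  have ev_blocks: "whp M e (\<lambda>\<omega>. \<forall>j\<in>{..<2 ^ m}. norm (\<Sum>k\<in>{k \<in> {..<2 ^ n}. k div l = j}. R k \<omega>) \<le> t)"
  proof (rule whp_mono[OF whp_ball])
    show "real (card {..<(2::nat) ^ m}) * t \<le> e" using t_e by simp
  qed (auto intro: R_J)
  have ev_squares: "whp M e (\<lambda>\<omega>. \<forall>i\<in>Basis. \<forall>G\<subseteq>{..<2 ^ n}. (\<forall>k\<in>G. \<bar>R k \<omega> \<bullet> i\<bar> \<le> 1) \<longrightarrow>
      (\<Sum>k\<in>G. (R k \<omega> \<bullet> i)\<^sup>2) \<le> \<beta>)"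
  proof (rule whp_mono[OF whp_ball])
    fix i :: 'v assume i: "i \<in> Basis"
    have sq: "whp M ((9 * t\<^sup>2 / 2 + 4 * t) / (1 - exp (- (\<beta> / 4))))
      (\<lambda>\<omega>. \<forall>G\<subseteq>{..<2 ^ n}. (\<forall>k\<in>G. \<bar>R k \<omega> \<bullet> i\<bar> \<le> 1) \<longrightarrow> (\<Sum>k\<in>G. (R k \<omega> \<bullet> i)\<^sup>2) \<le> \<beta>)"
    proof (rule sum_squares_small[OF _ _ \<beta>])
      show "(\<lambda>\<omega>. R k \<omega> \<bullet> i) \<in> borel_measurable M" if "k < 2 ^ n" for k using R_meas[OF that] by simp
      fix J assume J: "J \<subseteq> {..<(2::nat) ^ n}"
      show "whp M t (\<lambda>\<omega>. \<bar>\<Sum>k\<in>J. R k \<omega> \<bullet> i\<bar> \<le> t)"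
      proof (rule whp_mono[OF R_J[OF J] order_refl])
        fix \<omega> assume "norm (\<Sum>k\<in>J. R k \<omega>) \<le> t"
        moreover have "\<bar>(\<Sum>k\<in>J. R k \<omega>) \<bullet> i\<bar> \<le> norm (\<Sum>k\<in>J. R k \<omega>)" by (rule Basis_le_norm[OF i])
        ultimately show "\<bar>\<Sum>k\<in>J. R k \<omega> \<bullet> i\<bar> \<le> t" by (simp add: inner_sum_left)
      qed
    qed
    have le: "(9 * t\<^sup>2 / 2 + 4 * t) / (1 - exp (- (\<beta> / 4))) \<le> e / DIM('v)"
    proof -
      have "t\<^sup>2 \<le> t" using t0 t1 by (simp add: power2_eq_square mult_left_le)
      then have "9 * t\<^sup>2 / 2 + 4 * t \<le> 9 * t" using t0 by linarith
      also have "\<dots> \<le> e / DIM('v) * (1 - exp (- (\<beta> / 4)))" using t_\<theta> by (simp add: \<theta>_def)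
      finally show ?thesis using \<beta> by (simp add: pos_divide_le_eq)
    qed
    show "whp M (e / DIM('v)) (\<lambda>\<omega>. \<forall>G\<subseteq>{..<2 ^ n}. (\<forall>k\<in>G. \<bar>R k \<omega> \<bullet> i\<bar> \<le> 1) \<longrightarrow>
      (\<Sum>k\<in>G. (R k \<omega> \<bullet> i)\<^sup>2) \<le> \<beta>)"
      by (rule whp_mono[OF sq le])
  qed auto
  have ev_cz: "whp M e (\<lambda>\<omega>. (\<forall>k<2 ^ n. norm (c k \<omega>) \<le> \<tau>) \<longrightarrow>
        \<bar>\<Sum>k<2 ^ n. c k \<omega> \<bullet> (z (g (Suc k)) \<omega> - z (g k) \<omega>)\<bar> \<le> \<tau> * \<kappa>z)"
    unfolding g_def using c_meas[unfolded g_def] \<tau> by (intro \<kappa>z(2)) auto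
  have ev_cw: "whp M e (\<lambda>\<omega>. (\<forall>k<2 ^ n. norm (adjoint_field s (z (g k) \<omega>) (c k \<omega>)) \<le> S * \<tau>) \<longrightarrow>
        \<bar>\<Sum>k<2 ^ n. adjoint_field s (z (g k) \<omega>) (c k \<omega>) \<bullet> (W (g (Suc k)) \<omega> - W (g k) \<omega>)\<bar> \<le> S * \<tau> * \<kappa>w)"
    unfolding g_def
  proof (rule \<kappa>w(2))
    show "(\<lambda>\<omega>. adjoint_field s (z (grid a b n k) \<omega>) (c k \<omega>)) \<in> borel_measurable (F (grid a b n k))"
      if "k < 2 ^ n" for k
      using c_meas[OF that] z_adapted[OF g_in, of k] that
      by (intro measurable_adjoint_field s_meas) (auto simp: g_def)
  qed (use S \<tau> in auto)
  note all = whp_conj[OF C_whp whp_conj[OF Qz(2)[of n] whp_conj[OF Qw(2)[of n] whp_conj[OF z_mod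
    whp_conj[OF W_mod whp_conj[OF ev_blocks whp_conj[OF ev_squares whp_conj[OF ev_cz ev_cw]]]]]]]]
  show "whp M \<epsilon> (\<lambda>\<omega>. \<bar>(max 0 ((norm (z b \<omega>))\<^sup>2 - \<alpha>)) ^ 3 - (max 0 ((norm (z a \<omega>))\<^sup>2 - \<alpha>)) ^ 3\<bar> \<le> tol)"
  proof (rule whp_mono[OF all])
    show "e + (e + (e + (e + (e + (e + (e + (e + e))))))) \<le> \<epsilon>" by (simp add: e_def)
    fix \<omega> assume H: "(\<forall>t\<in>dyadics a b. norm (z t \<omega>) \<le> C) \<and>
      (\<Sum>k<2 ^ n. (norm (z (grid a b n (Suc k)) \<omega> - z (grid a b n k) \<omega>))\<^sup>2) \<le> Qz \<and>
      (\<Sum>k<2 ^ n. (norm (W (grid a b n (Suc k)) \<omega> - W (grid a b n k) \<omega>))\<^sup>2) \<le> Qw \<and>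
      (\<forall>t\<in>dyadics a b. \<forall>u\<in>dyadics a b. \<bar>t - u\<bar> \<le> \<delta>z \<longrightarrow> norm (z t \<omega> - z u \<omega>) \<le> \<eta>) \<and>
      (\<forall>t\<in>dyadics a b. \<forall>u\<in>dyadics a b. \<bar>t - u\<bar> \<le> \<delta>w \<longrightarrow> norm (W t \<omega> - W u \<omega>) \<le> \<eta>) \<and>
      (\<forall>j\<in>{..<2 ^ m}. norm (\<Sum>k\<in>{k \<in> {..<2 ^ n}. k div l = j}. R k \<omega>) \<le> t) \<and>
      (\<forall>i\<in>Basis. \<forall>G\<subseteq>{..<2 ^ n}. (\<forall>k\<in>G. \<bar>R k \<omega> \<bullet> i\<bar> \<le> 1) \<longrightarrow> (\<Sum>k\<in>G. (R k \<omega> \<bullet> i)\<^sup>2) \<le> \<beta>) \<and>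
      ((\<forall>k<2 ^ n. norm (c k \<omega>) \<le> \<tau>) \<longrightarrow>
        \<bar>\<Sum>k<2 ^ n. c k \<omega> \<bullet> (z (g (Suc k)) \<omega> - z (g k) \<omega>)\<bar> \<le> \<tau> * \<kappa>z) \<and>
      ((\<forall>k<2 ^ n. norm (adjoint_field s (z (g k) \<omega>) (c k \<omega>)) \<le> S * \<tau>) \<longrightarrow>
        \<bar>\<Sum>k<2 ^ n. adjoint_field s (z (g k) \<omega>) (c k \<omega>) \<bullet> (W (g (Suc k)) \<omega> - W (g k) \<omega>)\<bar> \<le> S * \<tau> * \<kappa>w)"
    have C_le: "norm (z (g k) \<omega>) \<le> C" if "k \<le> 2 ^ n" for k
      using conjunct1[OF H] g_dy[OF that] by blast
    have z_sq: "(\<Sum>k<2 ^ n. (norm (z (g (Suc k)) \<omega> - z (g k) \<omega>))\<^sup>2) \<le> Qz"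
      and w_sq: "(\<Sum>k<2 ^ n. (norm (w k \<omega>))\<^sup>2) \<le> Qw" using H by (auto simp: g_def w_def)
    have z_osc: "norm (z (g j) \<omega> - z (g k) \<omega>) \<le> \<eta>" if "j \<le> 2 ^ n" "k \<le> 2 ^ n" "\<bar>g j - g k\<bar> \<le> min \<delta>z \<delta>w" for j k
      using H g_dy that by (meson min.boundedE)
    have w_osc: "norm (w k \<omega>) \<le> \<eta>" if "k < 2 ^ n" for k
      using H g_dy[of k] g_dy[of "Suc k"] g_step[of k] that unfolding w_def by (meson Suc_leI less_imp_le min.boundedE)
    have z_step: "norm (z (g (Suc k)) \<omega> - z (g k) \<omega>) \<le> \<eta>" if "k < 2 ^ n" for k
      using z_osc[of "Suc k" k] g_step[of k] that by simp
    have z_block: "norm (z (g k) \<omega> - z (g (B k)) \<omega>) \<le> \<eta>" if "k < 2 ^ n" for k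
      using z_osc[of k "B k"] g_block[of k] B_le[of k] that by simp
    have c_le: "norm (c k \<omega>) \<le> \<tau>" if "k < 2 ^ n" for k
    proof -
      have "norm (c k \<omega>) \<le> 15 * C ^ 4 * norm (z (g k) \<omega> - z (g (B k)) \<omega>)"
        unfolding c_def h_def using C_le B_le[of k] that \<alpha> by (intro cutoff_field_lipschitz) auto
      also have "\<dots> \<le> \<tau>" unfolding \<tau>_def using z_block[OF that] C by (intro mult_left_mono) auto
      finally show ?thesis .
    qed
    have far: "p \<le> norm (z (g k) \<omega>)" if k: "k < 2 ^ n" and "c k \<omega> \<noteq> 0" for k
    proof (rule ccontr)
      assume *: "\<not> p \<le> norm (z (g k) \<omega>)"
      have "norm (z (g (B k)) \<omega>) \<le> norm (z (g k) \<omega>) + \<eta>"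
        using z_block[OF k] norm_triangle_ineq2[of "z (g (B k)) \<omega>" "z (g k) \<omega>"] by (simp add: norm_minus_commute)
      then have "norm (z (g (B k)) \<omega>) \<le> sqrt \<alpha>" "norm (z (g k) \<omega>) \<le> sqrt \<alpha>"
        using * \<eta>p \<eta>0 p by (auto simp: p_def)
      then have "(norm (z (g (B k)) \<omega>))\<^sup>2 \<le> (sqrt \<alpha>)\<^sup>2" "(norm (z (g k) \<omega>))\<^sup>2 \<le> (sqrt \<alpha>)\<^sup>2"
        by (auto intro: power_mono)
      then have "c k \<omega> = 0" using \<alpha> by (simp add: c_def h_def cutoff_eq_0)
      with that show False by simp
    qed
    have adj_le: "norm (adjoint_field s (z (g k) \<omega>) (c k \<omega>)) \<le> S * \<tau>" if "k < 2 ^ n" for k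
    proof (cases "c k \<omega> = 0")
      case True
      then show ?thesis using S \<tau> by (simp add: adjoint_field_def)
    next
      case False
      have "norm (adjoint_field s (z (g k) \<omega>) (c k \<omega>)) \<le> S * norm (c k \<omega>)"
        using far[OF that False] C_le[of k] that by (intro norm_adjoint_field_le lin S(2)) (use S(1) in auto)
      also have "\<dots> \<le> S * \<tau>" using c_le[OF that] S(1) by simp
      finally show ?thesis .
    qed
    have cz: "\<bar>\<Sum>k<2 ^ n. c k \<omega> \<bullet> (z (g (Suc k)) \<omega> - z (g k) \<omega>)\<bar> \<le> \<tau> * \<kappa>z"
      using H c_le by blast
    have "\<bar>\<Sum>k<2 ^ n. adjoint_field s (z (g k) \<omega>) (c k \<omega>) \<bullet> w k \<omega>\<bar> \<le> S * \<tau> * \<kappa>w"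
      unfolding w_def using H adj_le by blast
    then have cw: "\<bar>\<Sum>k<2 ^ n. c k \<omega> \<bullet> s (z (g k) \<omega>) (w k \<omega>)\<bar> \<le> S * \<tau> * \<kappa>w"
      by (simp add: inner_adjoint_field[OF lin])
    have blocks: "\<bar>\<Sum>k<2 ^ n. h (B k) \<omega> \<bullet> R k \<omega>\<bar> \<le> \<eta>"
    proof -
      have "(\<Sum>k<2 ^ n. h (B k) \<omega> \<bullet> R k \<omega>) =
          (\<Sum>j<2 ^ m. \<Sum>k\<in>{k \<in> {..<2 ^ n}. k div l = j}. h (B k) \<omega> \<bullet> R k \<omega>)"
      proof (rule sum.group[symmetric])
        show "(\<lambda>k. k div l) ` {..<2 ^ n} \<subseteq> {..<2 ^ m}"
          using l by (auto simp: less_mult_imp_div_less)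
      qed auto
      also have "\<dots> = (\<Sum>j<2 ^ m. h (j * l) \<omega> \<bullet> (\<Sum>k\<in>{k \<in> {..<2 ^ n}. k div l = j}. R k \<omega>))"
        unfolding inner_sum_right by (intro sum.cong refl) (auto simp: B_def)
      also have "\<bar>\<dots>\<bar> \<le> (\<Sum>j<(2::nat) ^ m. 3 * C ^ 5 * t)"
      proof (rule order_trans[OF sum_abs], rule sum_mono)
        fix j :: nat assume j: "j \<in> {..<2 ^ m}"
        then have jl: "j * l \<le> 2 ^ n" unfolding l(2)[symmetric] by simp
        have "norm (h (j * l) \<omega>) \<le> 3 * C ^ 4 * C"
          unfolding h_def using cutoff_bound[OF C_le[OF jl], of \<alpha>] C_le[OF jl] \<alpha> C
          by (auto intro!: mult_mono)
        then have "norm (h (j * l) \<omega>) \<le> 3 * C ^ 5" by (simp add: power_numeral_reduce mult_ac)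
        moreover have "norm (\<Sum>k\<in>{k \<in> {..<2 ^ n}. k div l = j}. R k \<omega>) \<le> t"
          using H j by blast
        ultimately show "\<bar>h (j * l) \<omega> \<bullet> (\<Sum>k\<in>{k \<in> {..<2 ^ n}. k div l = j}. R k \<omega>)\<bar> \<le> 3 * C ^ 5 * t"
          using C by (intro order_trans[OF Cauchy_Schwarz_ineq2] mult_mono) auto
      qed
      also have "\<dots> \<le> \<eta>" using t_block by (simp add: mult.assoc)
      finally show ?thesis .
    qed
    have R_alt: "R k \<omega> = z (g (Suc k)) \<omega> - z (g k) \<omega> - (1 / 2) *\<^sub>R (s (z (g k) \<omega>) (w k \<omega>) + s (z (g (Suc k)) \<omega>) (w k \<omega>))" for k
      by (simp add: R_def stratonovich_defect_def w_def)
    let ?G = "{k. k < 2 ^ n \<and> sqrt \<alpha> / 2 \<le> norm (z (g k) \<omega>) \<and> sqrt \<alpha> / 2 \<le> norm (z (g (Suc k)) \<omega>)}"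
    have R_le: "norm (R k \<omega>) \<le> 1" if "k \<in> ?G" for k
    proof -
      have k: "k < 2 ^ n" "p \<le> norm (z (g k) \<omega>)" "p \<le> norm (z (g (Suc k)) \<omega>)"
        using that by (auto simp: p_def)
      have Sw: "S * norm (w k \<omega>) \<le> S * \<eta>" using w_osc[OF k(1)] S(1) by (intro mult_left_mono) auto
      have *: "norm (s (z (g k) \<omega>) (w k \<omega>)) \<le> S * \<eta>"
        using k C_le[of k] by (intro order_trans[OF S(2) Sw]) auto
      have **: "norm (s (z (g (Suc k)) \<omega>) (w k \<omega>)) \<le> S * \<eta>"
        using k C_le[of "Suc k"] by (intro order_trans[OF S(2) Sw]) auto
      have "norm (R k \<omega>) \<le> norm (z (g (Suc k)) \<omega> - z (g k) \<omega>) +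
          1 / 2 * (norm (s (z (g k) \<omega>) (w k \<omega>)) + norm (s (z (g (Suc k)) \<omega>) (w k \<omega>)))"
        unfolding R_alt using norm_triangle_ineq[of "s (z (g k) \<omega>) (w k \<omega>)" "s (z (g (Suc k)) \<omega>) (w k \<omega>)"]
        by (intro order_trans[OF norm_triangle_ineq4]) simp
      also have "\<dots> \<le> \<eta> * (1 + S)" using * ** z_step[OF k(1)] by (simp add: algebra_simps)
      finally show ?thesis using \<eta>S by linarith
    qed
    have R2: "(\<Sum>k\<in>?G. (norm (R k \<omega>))\<^sup>2) \<le> \<eta>\<^sup>2"
    proof -
      have "(\<Sum>k\<in>?G. (norm (R k \<omega>))\<^sup>2) = (\<Sum>i\<in>Basis. \<Sum>k\<in>?G. (R k \<omega> \<bullet> i)\<^sup>2)"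
      proof -
        have "(norm x)\<^sup>2 = (\<Sum>i\<in>Basis. (x \<bullet> i)\<^sup>2)" for x :: 'v
          unfolding power2_norm_eq_inner by (subst euclidean_inner) (simp add: power2_eq_square)
        then show ?thesis by (subst sum.swap) simp
      qed
      also have "\<dots> \<le> (\<Sum>i\<in>(Basis :: 'v set). \<beta>)"
      proof (rule sum_mono)
        fix i :: 'v assume i: "i \<in> Basis"
        have "\<forall>k\<in>?G. \<bar>R k \<omega> \<bullet> i\<bar> \<le> 1"
          using R_le Basis_le_norm[OF i] by (meson order_trans)
        moreover have "?G \<subseteq> {..<2 ^ n}" by auto
        ultimately show "(\<Sum>k\<in>?G. (R k \<omega> \<bullet> i)\<^sup>2) \<le> \<beta>" using H i by blast
      qed
      also have "\<dots> = \<eta>\<^sup>2" by (simp add: \<beta>_def)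
      finally show ?thesis .
    qed
    have "\<bar>(max 0 ((norm (z (g (2 ^ n)) \<omega>))\<^sup>2 - \<alpha>)) ^ 3 - (max 0 ((norm (z (g 0) \<omega>))\<^sup>2 - \<alpha>)) ^ 3\<bar> \<le> \<eta> * K0"
      unfolding K0_def
    proof (rule cutoff_energy_increment[where s=s and w="\<lambda>k. w k \<omega>" and B=B and z="\<lambda>k. z (g k) \<omega>" and K="2 ^ n",
          OF \<alpha> tangential _ L(1) \<eta>0 _ C_le B_le z_step w_osc z_block z_sq w_sq])
      show "(\<Sum>k | k < 2 ^ n \<and> sqrt \<alpha> / 2 \<le> norm (z (g k) \<omega>) \<and> sqrt \<alpha> / 2 \<le> norm (z (g (Suc k)) \<omega>).
        (norm (z (g (Suc k)) \<omega> - z (g k) \<omega> - (1 / 2) *\<^sub>R (s (z (g k) \<omega>) (w k \<omega>) + s (z (g (Suc k)) \<omega>) (w k \<omega>))))\<^sup>2) \<le> \<eta>\<^sup>2"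
        using R2 by (simp add: R_alt)
      show "\<bar>\<Sum>k<2 ^ n. (cutoff \<alpha> (z (g (B k)) \<omega>) *\<^sub>R z (g (B k)) \<omega>) \<bullet>
        (z (g (Suc k)) \<omega> - z (g k) \<omega> - (1 / 2) *\<^sub>R (s (z (g k) \<omega>) (w k \<omega>) + s (z (g (Suc k)) \<omega>) (w k \<omega>)))\<bar> \<le> \<eta>"
        using blocks by (simp add: R_alt h_def)
      show "\<bar>\<Sum>k<2 ^ n. (cutoff \<alpha> (z (g k) \<omega>) *\<^sub>R z (g k) \<omega> - cutoff \<alpha> (z (g (B k)) \<omega>) *\<^sub>R z (g (B k)) \<omega>) \<bullet>
        (z (g (Suc k)) \<omega> - z (g k) \<omega>)\<bar> \<le> \<eta> * (15 * C ^ 4 * \<kappa>z)"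
        using cz by (simp add: c_def h_def \<tau>_def mult_ac)
      show "\<bar>\<Sum>k<2 ^ n. (cutoff \<alpha> (z (g k) \<omega>) *\<^sub>R z (g k) \<omega> - cutoff \<alpha> (z (g (B k)) \<omega>) *\<^sub>R z (g (B k)) \<omega>) \<bullet>
        s (z (g k) \<omega>) (w k \<omega>)\<bar> \<le> \<eta> * (15 * C ^ 4 * S * \<kappa>w)"
        using cw by (simp add: c_def h_def \<tau>_def mult_ac)
      show "2 * \<eta> \<le> sqrt \<alpha> / 2" using \<eta>p by (simp add: p_def)
      show "norm (s x v - s y v) \<le> L * norm (x - y) * norm v" if "sqrt \<alpha> / 2 \<le> norm x" "norm x \<le> C"
        "sqrt \<alpha> / 2 \<le> norm y" "norm y \<le> C" for x y v using L(2) that by (simp add: p_def)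
    qed
    also have "\<dots> \<le> tol" by (rule \<eta>tol)
    finally show "\<bar>(max 0 ((norm (z b \<omega>))\<^sup>2 - \<alpha>)) ^ 3 - (max 0 ((norm (z a \<omega>))\<^sup>2 - \<alpha>)) ^ 3\<bar> \<le> tol"
      by (simp add: g_def)
  qed
qed

text \<open>
  Cutoffs with a sequence of levels \<open>\<alpha>\<close> tending to zero separate any two distinct norms, one of which
  may be zero.
\<close>
lemma (in filtered_prob_space) tangential_stratonovich_norm_constant:
  fixes z :: "real \<Rightarrow> 'a \<Rightarrow> 'v::euclidean_space" and W :: "real \<Rightarrow> 'a \<Rightarrow> 'w::euclidean_space"
    and s :: "'v \<Rightarrow> 'w \<Rightarrow> 'v"
  assumes ab: "a \<le> b"
    and z_adapted: "\<And>t. t \<in> {a..b} \<Longrightarrow> z t \<in> borel_measurable (F t)"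
    and W_adapted: "\<And>t. t \<in> {a..b} \<Longrightarrow> W t \<in> borel_measurable (F t)"
    and z_cont: "AE \<omega> in M. continuous_on {a..b} (\<lambda>t. z t \<omega>)"
    and W_cont: "AE \<omega> in M. continuous_on {a..b} (\<lambda>t. W t \<omega>)"
    and z_good: "good_integrator M F a b z" and W_good: "good_integrator M F a b W"
    and lin: "\<And>x. linear (s x)" and s_meas: "\<And>w. (\<lambda>x. s x w) \<in> borel_measurable borel"
    and tangential: "\<And>x w. x \<bullet> s x w = 0"
    and bound: "\<And>p q. 0 < p \<Longrightarrow> \<exists>S. \<forall>x w. p \<le> norm x \<longrightarrow> norm x \<le> q \<longrightarrow> norm (s x w) \<le> S * norm w"
    and lip: "\<And>p q. 0 < p \<Longrightarrow> \<exists>L\<ge>0. \<forall>x y w. p \<le> norm x \<longrightarrow> norm x \<le> q \<longrightarrow> p \<le> norm y \<longrightarrow> norm y \<le> q \<longrightarrow>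
      norm (s x w - s y w) \<le> L * norm (x - y) * norm w"
    and vanish: "\<And>t. t \<in> {a..b} \<Longrightarrow> vanishing_sums M (stratonovich_defect s z W) a t"
  shows "AE \<omega> in M. norm (z b \<omega>) = norm (z a \<omega>)"
proof -
  have "AE \<omega> in M. \<forall>m. (max 0 ((norm (z b \<omega>))\<^sup>2 - inverse (Suc m))) ^ 3 - (max 0 ((norm (z a \<omega>))\<^sup>2 - inverse (Suc m))) ^ 3 = 0"
    unfolding AE_all_countable
    by (intro allI cutoff_energy_conserved[OF ab z_adapted W_adapted z_cont W_cont z_good W_good lin s_meas
          tangential bound lip vanish]) auto
  then show ?thesis
  proof eventually_elim
    case (elim \<omega>)
    have inj: "x = y" if "max 0 x ^ 3 - max 0 y ^ 3 = 0" "0 < x \<or> 0 < y" for x y :: real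
    proof -
      have "max 0 x = max 0 y" using that(1) power_eq_imp_eq_base[of "max 0 x" 3 "max 0 y"] by simp
      with that(2) show ?thesis by (auto simp: max_def split: if_splits)
    qed
    show ?case
    proof (rule ccontr)
      assume ne: "norm (z b \<omega>) \<noteq> norm (z a \<omega>)"
      then have "0 < (norm (z b \<omega>))\<^sup>2 \<or> 0 < (norm (z a \<omega>))\<^sup>2" by auto
      then have "0 < max ((norm (z b \<omega>))\<^sup>2) ((norm (z a \<omega>))\<^sup>2)" by (simp add: less_max_iff_disj)
      then obtain m where "inverse (Suc m) < max ((norm (z b \<omega>))\<^sup>2) ((norm (z a \<omega>))\<^sup>2)"
        using reals_Archimedean by blast
      then have "(norm (z b \<omega>))\<^sup>2 = (norm (z a \<omega>))\<^sup>2"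
        using inj[of "(norm (z b \<omega>))\<^sup>2 - inverse (Suc m)" "(norm (z a \<omega>))\<^sup>2 - inverse (Suc m)"] elim
        by (simp add: less_max_iff_disj)
      then show False using ne by simp
    qed
  qed
qed

section \<open>Brownian motion as a good integrator\<close>

context prob_space
begin

lemma distributed_gaussian_component:
  fixes X :: "'a \<Rightarrow> real ^ 'd"
  assumes X: "distributed M lborel X (\<lambda>x. ennreal (gaussian_density v x))" and v: "0 < v"
  shows "distributed M lborel (\<lambda>\<omega>. X \<omega> $ j) (\<lambda>x. ennreal (normal_density 0 (sqrt v) x))"
  unfolding distributed_def
proof (intro conjI)
  let ?n = "\<lambda>x. ennreal (normal_density 0 (sqrt v) x)"
  have XM [measurable]: "X \<in> borel_measurable M" using distributed_measurable[OF X] by simp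
  note [measurable] = measurable_component
  show Xj: "(\<lambda>\<omega>. X \<omega> $ j) \<in> measurable M lborel" by simp
  show "?n \<in> borel_measurable lborel" by simp
  show "distr M lborel (\<lambda>\<omega>. X \<omega> $ j) = density lborel ?n"
  proof (rule measure_eqI)
    fix A assume "A \<in> sets (distr M lborel (\<lambda>\<omega>. X \<omega> $ j))"
    then have A [measurable]: "A \<in> sets borel" by simp
    define f where "f b x = ?n x * (if b = axis j (1::real) then indicator A x else 1)" for b :: "real ^ 'd" and x
    have B: "{x :: real ^ 'd. x $ j \<in> A} \<in> sets lborel" by measurable
    have one: "(\<integral>\<^sup>+x. ?n x \<partial>lborel) = 1"
      using v by (subst nn_integral_eq_integral) auto
    have basis: "Basis = range (\<lambda>k. axis k (1::real) :: real ^ 'd)"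
      by (auto simp: Basis_vec_def)
    have inj: "inj (\<lambda>k. axis k (1::real) :: real ^ 'd)"
      by (auto simp: inj_def axis_eq_axis)
    have split: "ennreal (gaussian_density v x) * indicator {x. x $ j \<in> A} x = (\<Prod>b\<in>Basis. f b (x \<bullet> b))" for x :: "real ^ 'd"
    proof -
      have "(\<Prod>b\<in>Basis. f b (x \<bullet> b)) = (\<Prod>k\<in>UNIV. ?n (x $ k) * (if k = j then indicator A (x $ j) else 1))"
        unfolding basis using inj
        by (subst prod.reindex) (auto simp: f_def axis_eq_axis cart_eq_inner_axis[symmetric] intro!: prod.cong)
      also have "\<dots> = (\<Prod>k\<in>UNIV. ?n (x $ k)) * indicator A (x $ j)"
        by (simp add: prod.distrib prod.delta)
      also have "(\<Prod>k\<in>UNIV. ?n (x $ k)) = ennreal (gaussian_density v x)"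
        unfolding gaussian_density_def by (rule prod_ennreal) simp
      finally show ?thesis by (simp add: indicator_def)
    qed
    have "emeasure (distr M lborel (\<lambda>\<omega>. X \<omega> $ j)) A = emeasure M (X -` {x. x $ j \<in> A} \<inter> space M)"
      using Xj by (subst emeasure_distr) (auto intro!: arg_cong[where f="emeasure M"])
    also have "\<dots> = (\<integral>\<^sup>+x. ennreal (gaussian_density v x) * indicator {x. x $ j \<in> A} x \<partial>lborel)"
      by (rule distributed_emeasure[OF X B])
    also have "\<dots> = (\<Prod>b\<in>Basis. (\<integral>\<^sup>+x. f b x \<partial>lborel))"
      unfolding split by (rule nn_integral_lborel_prod) (auto simp: f_def)
    also have "\<dots> = (\<Prod>k\<in>UNIV. if k = j then (\<integral>\<^sup>+x. ?n x * indicator A x \<partial>lborel) else 1)"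
    proof -
      have "(\<integral>\<^sup>+x. f (axis k 1) x \<partial>lborel) = (if k = j then (\<integral>\<^sup>+x. ?n x * indicator A x \<partial>lborel) else 1)" for k
        using one by (simp add: f_def axis_eq_axis)
      then show ?thesis unfolding basis by (subst prod.reindex[OF inj]) simp
    qed
    also have "\<dots> = emeasure (density lborel ?n) A"
      by (simp add: prod.delta emeasure_density)
    finally show "emeasure (distr M lborel (\<lambda>\<omega>. X \<omega> $ j)) A = emeasure (density lborel ?n) A" .
  qed simp
qed

lemma normal_moments:
  assumes X: "distributed M lborel X (\<lambda>x. ennreal (normal_density 0 (sqrt v) x))" and v: "0 < v"
  shows "integrable M X" "(\<integral>\<omega>. X \<omega> \<partial>M) = 0"
    "integrable M (\<lambda>\<omega>. (X \<omega>)\<^sup>2)" "(\<integral>\<omega>. (X \<omega>)\<^sup>2 \<partial>M) = v"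
proof -
  let ?n = "normal_density 0 (sqrt v)"
  have s: "0 < sqrt v" using v by simp
  show "integrable M X"
    using distributed_integrable[OF X, of "\<lambda>x. x"] integrable_normal_moment_nz_1[OF s, of 0] by simp
  show "(\<integral>\<omega>. X \<omega> \<partial>M) = 0"
    using distributed_integral[OF X, of "\<lambda>x. x"] integral_normal_moment_nz_1[OF s, of 0] by simp
  have m: "has_bochner_integral lborel (\<lambda>x. ?n x * x\<^sup>2) v"
    using normal_moment_even[OF s, of 0 1] v by (simp add: fact_numeral)
  show "integrable M (\<lambda>\<omega>. (X \<omega>)\<^sup>2)"
    using distributed_integrable[OF X, of "\<lambda>x. x\<^sup>2"] m by (auto simp: has_bochner_integral_iff)
  show "(\<integral>\<omega>. (X \<omega>)\<^sup>2 \<partial>M) = v"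
    using distributed_integral[OF X, of "\<lambda>x. x\<^sup>2"] m by (auto simp: has_bochner_integral_iff)
qed

text \<open>
  Independence of \<open>X\<close> from the \<open>\<sigma>\<close>-algebra \<open>G\<close> is expressed on events, which is the form provided by
  the mutual independence in the definition of a family of Brownian motions.
\<close>
lemma integral_product_independent_past:
  fixes X H :: "'a \<Rightarrow> real"
  assumes indep: "\<And>A S. A \<in> sets G \<Longrightarrow> S \<in> sets borel \<Longrightarrow>
      prob (A \<inter> (X -` S \<inter> space M)) = prob A * prob (X -` S \<inter> space M)"
    and G: "subalgebra M G" and H: "H \<in> borel_measurable G"
    and X: "X \<in> borel_measurable M" and int: "integrable M H" "integrable M X"
  shows "(\<integral>\<omega>. H \<omega> * X \<omega> \<partial>M) = (\<integral>\<omega>. H \<omega> \<partial>M) * (\<integral>\<omega>. X \<omega> \<partial>M)"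
proof (rule indep_var_lebesgue_integral[OF _ int])
  have HM: "H \<in> borel_measurable M" using measurable_from_subalg[OF G H] .
  have sp: "space G = space M" using G by (simp add: subalgebra_def)
  have "indep_set {H -` S \<inter> space M | S. S \<in> sets borel} {X -` S \<inter> space M | S. S \<in> sets borel}"
    unfolding indep_sets2_eq
  proof (intro conjI ballI)
    fix A B assume "A \<in> {H -` S \<inter> space M | S. S \<in> sets borel}" "B \<in> {X -` S \<inter> space M | S. S \<in> sets borel}"
    then show "prob (A \<inter> B) = prob A * prob B"
      using indep measurable_sets[OF H] unfolding sp by auto
  qed (use HM X measurable_sets in auto)
  then have i: "indep_sets (case_bool {H -` S \<inter> space M | S. S \<in> sets borel} {X -` S \<inter> space M | S. S \<in> sets borel}) UNIV"
    by (simp add: indep_set_def)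
  show "indep_var borel H borel X"
    unfolding indep_var_def indep_vars_def2
  proof (intro conjI)
    show "\<forall>i\<in>UNIV. random_variable (case_bool borel borel i) (case_bool H X i)"
      using HM X by (auto split: bool.split)
    show "indep_sets (\<lambda>i. {case_bool H X i -` A \<inter> space M | A. A \<in> sets (case_bool borel borel i)}) UNIV"
      by (rule indep_sets_cong[THEN iffD1, OF refl _ i]) (auto split: bool.split)
  qed
qed

end

text \<open>
  The increments of a coordinate over a grid of \<open>[a, b]\<close> are orthogonal to the past with total second
  moment \<open>b - a\<close>, whatever the grid; Chebyshev's inequality gives a uniform bound.
\<close>
lemma (in filtered_prob_space) good_integrator_brownian:
  fixes B :: "'i \<Rightarrow> real \<Rightarrow> 'a \<Rightarrow> real ^ 'd"
  assumes brown: "brownian_family M F a T I B" and i: "i \<in> I" and ab: "a < b" "b \<le> T"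
  shows "good_integrator M F a b (B i)"
proof (rule good_integrator_vec)
  fix j
  have adapted: "\<And>t. t \<in> {a..T} \<Longrightarrow> B i t \<in> borel_measurable (F t)"
    using brown i unfolding brownian_family_def by blast
  have incr: "distributed M lborel (\<lambda>\<omega>. B i t \<omega> - B i s \<omega>) (\<lambda>x. ennreal (gaussian_density (t - s) x))"
    and indep: "indep_sets (case_option (sets (F s))
             (\<lambda>i. {(\<lambda>\<omega>. B i t \<omega> - B i s \<omega>) -` S \<inter> space M | S. S \<in> sets borel}))
          (insert None (Some ` I))"
    if "a \<le> s" "s < t" "t \<le> T" for s t
  proof -
    note all = brown[unfolded brownian_family_def, THEN conjunct2, THEN conjunct2, THEN spec, THEN spec,
        THEN mp, OF that(1), THEN mp, OF that(2), THEN mp, OF that(3)]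
    show "distributed M lborel (\<lambda>\<omega>. B i t \<omega> - B i s \<omega>) (\<lambda>x. ennreal (gaussian_density (t - s) x))"
      by (rule conjunct1[OF all, THEN bspec, OF i])
    show "indep_sets (case_option (sets (F s))
             (\<lambda>i. {(\<lambda>\<omega>. B i t \<omega> - B i s \<omega>) -` S \<inter> space M | S. S \<in> sets borel}))
          (insert None (Some ` I))"
      by (rule conjunct2[OF all])
  qed
  let ?X = "\<lambda>t \<omega>. B i t \<omega> $ j"
  have adX: "?X t \<in> borel_measurable (F t)" if "t \<in> {a..T}" for t
    using measurable_compose[OF adapted[OF that] measurable_component] .
  note moments = normal_moments[OF distributed_gaussian_component[OF incr, where j=j], simplified vector_minus_component]
  have orth: "(\<integral>\<omega>. H \<omega> * (?X t \<omega> - ?X s \<omega>) \<partial>M) = 0"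
    if st: "a \<le> s" "s < t" "t \<le> T" and H: "H \<in> borel_measurable (F s)" "integrable M (\<lambda>\<omega>. (H \<omega>)\<^sup>2)" for s t H
  proof -
    have XM: "(\<lambda>\<omega>. ?X t \<omega> - ?X s \<omega>) \<in> borel_measurable M"
      using measurable_F_M[OF adX[of t]] measurable_F_M[OF adX[of s]] st by auto
    have HM: "H \<in> borel_measurable M" using measurable_F_M[OF H(1)] .
    have Hi: "integrable M H" using integrable_mult_of_square_integrable[of H "\<lambda>_. 1"] HM H(2) by auto
    have "(\<integral>\<omega>. H \<omega> * (?X t \<omega> - ?X s \<omega>) \<partial>M) = (\<integral>\<omega>. H \<omega> \<partial>M) * (\<integral>\<omega>. ?X t \<omega> - ?X s \<omega> \<partial>M)"
    proof (rule integral_product_independent_past[OF _ subalgebra_F H(1) XM Hi])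
      show "integrable M (\<lambda>\<omega>. ?X t \<omega> - ?X s \<omega>)" using moments(1)[of s t] st by simp
      fix A S assume A: "A \<in> sets (F s)" and S: "S \<in> sets (borel :: real measure)"
      let ?D = "\<lambda>\<omega>. B i t \<omega> - B i s \<omega>"
      have eq: "(\<lambda>\<omega>. ?X t \<omega> - ?X s \<omega>) -` S \<inter> space M = ?D -` ((\<lambda>x. x $ j) -` S) \<inter> space M" by auto
      have S': "(\<lambda>x :: real ^ 'd. x $ j) -` S \<in> sets borel"
        using measurable_sets[OF measurable_component[of j] S] by simp
      have "prob (\<Inter>k\<in>{None, Some i}. case_option A (\<lambda>_. ?D -` ((\<lambda>x. x $ j) -` S) \<inter> space M) k) =
        (\<Prod>k\<in>{None, Some i}. prob (case_option A (\<lambda>_. ?D -` ((\<lambda>x. x $ j) -` S) \<inter> space M) k))"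
        using i A S' by (intro indep_setsD[OF indep[OF st]]) auto
      then show "prob (A \<inter> ((\<lambda>\<omega>. ?X t \<omega> - ?X s \<omega>) -` S \<inter> space M)) =
          prob A * prob ((\<lambda>\<omega>. ?X t \<omega> - ?X s \<omega>) -` S \<inter> space M)"
        unfolding eq by simp
    qed
    then show ?thesis using moments(2)[of s t] st by simp
  qed
  show "good_integrator M F a b ?X"
    unfolding good_integrator_def
  proof (intro allI impI)
    fix \<epsilon> :: real assume eps: "0 < \<epsilon>"
    define \<kappa> where "\<kappa> = 1 + (b - a) / \<epsilon>"
    have \<kappa>: "1 \<le> \<kappa>" "(b - a) / \<kappa>\<^sup>2 \<le> \<epsilon>"
    proof -
      show 1: "1 \<le> \<kappa>" using eps ab by (simp add: \<kappa>_def)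
      have "b - a = \<epsilon> * (\<kappa> - 1)" using eps by (simp add: \<kappa>_def)
      also have "\<dots> \<le> \<epsilon> * \<kappa>\<^sup>2"
        using eps 1 self_le_power[OF 1, of 2] by (intro mult_left_mono) auto
      finally show "(b - a) / \<kappa>\<^sup>2 \<le> \<epsilon>" using 1 by (simp add: pos_divide_le_eq)
    qed
    show "\<exists>\<kappa>\<ge>0. \<forall>n c. unit_integrand M F a b n c \<longrightarrow> whp M \<epsilon>
      (\<lambda>\<omega>. \<bar>\<Sum>k<2 ^ n. c k \<omega> \<bullet> (?X (grid a b n (Suc k)) \<omega> - ?X (grid a b n k) \<omega>)\<bar> \<le> \<kappa>)"
    proof (intro exI[of _ \<kappa>] conjI allI impI)
      show "0 \<le> \<kappa>" using \<kappa>(1) by simp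
      fix n and c :: "nat \<Rightarrow> 'a \<Rightarrow> real"
      assume c: "unit_integrand M F a b n c"
      let ?g = "grid a b n"
      let ?\<xi> = "\<lambda>k \<omega>. ?X (?g (Suc k)) \<omega> - ?X (?g k) \<omega>"
      have g: "a \<le> ?g k" "?g k < ?g (Suc k)" "?g (Suc k) \<le> T" if "k < 2 ^ n" for k
      proof -
        have "0 < (b - a) / 2 ^ n" using ab by simp
        then show "?g k < ?g (Suc k)" using grid_Suc_diff[of a b n k] by linarith
        show "a \<le> ?g k" "?g (Suc k) \<le> T"
          using grid_in[of a b k n] grid_in[of a b "Suc k" n] ab that by auto
      qed
      have g_in: "?g k \<in> {a..T}" if "k \<le> 2 ^ n" for k using grid_in[of a b k n] ab that by auto
      have sq: "integrable M (\<lambda>\<omega>. (?\<xi> k \<omega>)\<^sup>2)" "(\<integral>\<omega>. (?\<xi> k \<omega>)\<^sup>2 \<partial>M) = (b - a) / 2 ^ n" if "k < 2 ^ n" for k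
        using moments(3,4)[OF g[OF that]] ab by (auto simp: grid_Suc_diff)
      have *: "integrable M (\<lambda>\<omega>. (\<Sum>k<2 ^ n. c k \<omega> * ?\<xi> k \<omega>)\<^sup>2) \<and>
        (\<integral>\<omega>. (\<Sum>k<2 ^ n. c k \<omega> * ?\<xi> k \<omega>)\<^sup>2 \<partial>M) \<le> (\<Sum>k<2 ^ n. \<integral>\<omega>. (?\<xi> k \<omega>)\<^sup>2 \<partial>M)"
      proof (rule orthogonal_sum_second_moment[where G="\<lambda>k. F (?g k)" and \<xi>="?\<xi>" and c=c and K="2 ^ n" and n="2 ^ n", THEN conjunct2])
        show "subalgebra (F (?g (Suc k))) (F (?g k))" for k
          using grid_mono[of a b k "Suc k" n] ab by (intro subalgebra_F_mono) auto
        show "?\<xi> k \<in> borel_measurable (F (?g (Suc k)))" if "k < 2 ^ n" for k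
          using adX[OF g_in[of "Suc k"]] measurable_F_mono[OF adX[OF g_in[of k]], of "?g (Suc k)"] g(2)[OF that] that
          by auto
        show "(\<integral>\<omega>. H \<omega> * ?\<xi> k \<omega> \<partial>M) = 0" if "k < 2 ^ n" "H \<in> borel_measurable (F (?g k))"
          "integrable M (\<lambda>\<omega>. (H \<omega>)\<^sup>2)" for k H
          using orth[OF g[OF that(1)] that(2,3)] .
      qed (use subalgebra_F sq c in auto)
      moreover have "(\<Sum>k<2 ^ n. \<integral>\<omega>. (?\<xi> k \<omega>)\<^sup>2 \<partial>M) = b - a"
        using sq(2) by simp
      ultimately have "whp M ((b - a) / \<kappa>\<^sup>2) (\<lambda>\<omega>. (\<Sum>k<2 ^ n. c k \<omega> * ?\<xi> k \<omega>)\<^sup>2 \<le> \<kappa>\<^sup>2)"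
        using \<kappa>(1) by (intro whp_of_expectation_le) auto
      then show "whp M \<epsilon> (\<lambda>\<omega>. \<bar>\<Sum>k<2 ^ n. c k \<omega> \<bullet> ?\<xi> k \<omega>\<bar> \<le> \<kappa>)"
      proof (rule whp_mono[OF _ \<kappa>(2)])
        fix \<omega> assume "(\<Sum>k<2 ^ n. c k \<omega> * ?\<xi> k \<omega>)\<^sup>2 \<le> \<kappa>\<^sup>2"
        then show "\<bar>\<Sum>k<2 ^ n. c k \<omega> \<bullet> ?\<xi> k \<omega>\<bar> \<le> \<kappa>"
          using abs_le_square_iff[of "\<Sum>k<2 ^ n. c k \<omega> * ?\<xi> k \<omega>" \<kappa>] \<kappa>(1) by simp
      qed
    qed
  qed
qed

section \<open>The collisional particle system\<close>

text \<open>
  The coefficient of the relative velocity: the factor two arises since both partners move by opposite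
  amounts.
\<close>
definition collision_field :: "real \<Rightarrow> real \<Rightarrow> real ^ 'd \<Rightarrow> real ^ 'd \<Rightarrow> real ^ 'd" where
  "collision_field \<Lambda> \<gamma> x w = 2 *\<^sub>R (sigma_matrix \<Lambda> \<gamma> x *v w)"

lemma collision_field_linear: "linear (collision_field \<Lambda> \<gamma> x)"
  unfolding collision_field_def[abs_def] by (intro linear_compose_scale_right matrix_vector_mul_linear)

lemma measurable_sigma_matrix_vec: "(\<lambda>x. sigma_matrix \<Lambda> \<gamma> x *v w) \<in> borel_measurable borel"
  unfolding sigma_matrix_vec by measurable

lemma collision_field_measurable: "(\<lambda>x. collision_field \<Lambda> \<gamma> x w) \<in> borel_measurable borel"
  unfolding collision_field_def using measurable_sigma_matrix_vec by (intro borel_measurable_scaleR) auto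

lemma collision_field_tangential: "x \<bullet> collision_field \<Lambda> \<gamma> x w = 0"
  unfolding collision_field_def sigma_matrix_vec
  by (simp add: inner_diff_right power2_norm_eq_inner)

text \<open>
  Exponents of both signs occur, so the bounds are taken from compactness of \<open>[p, q]\<close>.
\<close>
lemma powr_bounded_lipschitz:
  fixes e p q :: real
  assumes p: "0 < p"
  obtains K where "0 \<le> K" "\<And>r. p \<le> r \<Longrightarrow> r \<le> q \<Longrightarrow> r powr e \<le> K"
    "\<And>r u. p \<le> r \<Longrightarrow> r \<le> q \<Longrightarrow> p \<le> u \<Longrightarrow> u \<le> q \<Longrightarrow> \<bar>r powr e - u powr e\<bar> \<le> K * \<bar>r - u\<bar>"
proof -
  have "\<exists>B. \<forall>r\<in>{p..q}. \<bar>c * r powr e'\<bar> \<le> B" for c e' :: real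
  proof -
    have "compact ((\<lambda>r. c * r powr e') ` {p..q})"
      using p by (intro compact_continuous_image continuous_intros) auto
    then have "bounded ((\<lambda>r. c * r powr e') ` {p..q})" by (rule compact_imp_bounded)
    then show ?thesis unfolding bounded_iff by auto
  qed
  then obtain B1 B2 where B1: "\<forall>r\<in>{p..q}. \<bar>1 * r powr e\<bar> \<le> B1" and B2: "\<forall>r\<in>{p..q}. \<bar>e * r powr (e - 1)\<bar> \<le> B2"
    by meson
  show ?thesis
  proof (rule that[of "\<bar>B1\<bar> + \<bar>B2\<bar>"])
    show "r powr e \<le> \<bar>B1\<bar> + \<bar>B2\<bar>" if "p \<le> r" "r \<le> q" for r
      using B1[rule_format, of r] that by simp
    fix r u assume ru: "p \<le> r" "r \<le> q" "p \<le> u" "u \<le> q"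
    have "norm (r powr e - u powr e) \<le> (\<bar>B1\<bar> + \<bar>B2\<bar>) * norm (r - u)"
    proof (rule field_differentiable_bound[of "{p..q}" "\<lambda>r. r powr e" "\<lambda>r. e * r powr (e - 1)"])
      show "((\<lambda>r. r powr e) has_field_derivative e * x powr (e - 1)) (at x within {p..q})" if "x \<in> {p..q}" for x
        using that p by (auto intro!: derivative_eq_intros)
      show "norm (e * x powr (e - 1)) \<le> \<bar>B1\<bar> + \<bar>B2\<bar>" if "x \<in> {p..q}" for x
        using B2 that by fastforce
    qed (use ru in auto)
    then show "\<bar>r powr e - u powr e\<bar> \<le> (\<bar>B1\<bar> + \<bar>B2\<bar>) * \<bar>r - u\<bar>" by simp
  qed simp
qed

text \<open>
  Away from the origin the field is a combination of powers of the norm, of the form in which its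
  Lipschitz bound is read off term by term.
\<close>
lemma collision_field_annulus:
  fixes x :: "real ^ 'd"
  assumes "0 < norm x"
  shows "collision_field \<Lambda> \<gamma> x w =
    (2 * sqrt \<Lambda>) *\<^sub>R ((norm x powr (\<gamma> / 2 + 1)) *\<^sub>R w - (norm x powr (\<gamma> / 2 - 1) * (x \<bullet> w)) *\<^sub>R x)"
proof -
  have "norm x powr (\<gamma> / 2 + 1) = norm x powr (\<gamma> / 2 - 1) * norm x powr 2"
  proof -
    have "\<gamma> / 2 + 1 = (\<gamma> / 2 - 1) + 2" by simp
    then show ?thesis by (simp only: powr_add)
  qed
  also have "norm x powr 2 = (norm x)\<^sup>2" using assms by (simp add: powr_numeral)
  finally have "norm x powr (\<gamma> / 2 + 1) * ((x \<bullet> w) / (norm x)\<^sup>2) = norm x powr (\<gamma> / 2 - 1) * (x \<bullet> w)"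
    using assms by simp
  then have "(norm x powr (\<gamma> / 2 + 1)) *\<^sub>R (w - ((x \<bullet> w) / (norm x)\<^sup>2) *\<^sub>R x) =
      (norm x powr (\<gamma> / 2 + 1)) *\<^sub>R w - (norm x powr (\<gamma> / 2 - 1) * (x \<bullet> w)) *\<^sub>R x"
    unfolding scaleR_diff_right scaleR_scaleR by (rule arg_cong)
  moreover have "collision_field \<Lambda> \<gamma> x w =
      (2 * sqrt \<Lambda>) *\<^sub>R ((norm x powr (\<gamma> / 2 + 1)) *\<^sub>R (w - ((x \<bullet> w) / (norm x)\<^sup>2) *\<^sub>R x))"
    unfolding collision_field_def sigma_matrix_vec scaleR_scaleR by (simp only: mult.assoc)
  ultimately show ?thesis by (simp only:)
qed

lemma collision_field_bounded:
  assumes p: "0 < p"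
  shows "\<exists>S. \<forall>(x :: real ^ 'd) w. p \<le> norm x \<longrightarrow> norm x \<le> q \<longrightarrow> norm (collision_field \<Lambda> \<gamma> x w) \<le> S * norm w"
proof -
  obtain K where K: "0 \<le> K" "\<And>r. p \<le> r \<Longrightarrow> r \<le> q \<Longrightarrow> r powr (\<gamma> / 2 + 1) \<le> K"
    using powr_bounded_lipschitz[OF p, of q "\<gamma> / 2 + 1"] by metis
  have "norm (collision_field \<Lambda> \<gamma> x w) \<le> (2 * \<bar>sqrt \<Lambda>\<bar> * K * 2) * norm w"
    if x: "p \<le> norm x" "norm x \<le> q" for x w :: "real ^ 'd"
  proof -
    have nx: "0 < norm x" using p x by linarith
    have "\<bar>x \<bullet> w\<bar> / (norm x)\<^sup>2 * norm x \<le> norm w"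
    proof -
      have "\<bar>x \<bullet> w\<bar> / (norm x)\<^sup>2 * norm x = \<bar>x \<bullet> w\<bar> / norm x" using nx by (simp add: power2_eq_square)
      also have "\<dots> \<le> norm w" using nx Cauchy_Schwarz_ineq2[of x w] by (simp add: pos_divide_le_eq mult.commute)
      finally show ?thesis .
    qed
    then have w: "norm (w - ((x \<bullet> w) / (norm x)\<^sup>2) *\<^sub>R x) \<le> 2 * norm w"
      by (intro order_trans[OF norm_triangle_ineq4]) simp
    have "norm (collision_field \<Lambda> \<gamma> x w) =
        2 * (\<bar>sqrt \<Lambda>\<bar> * norm x powr (\<gamma> / 2 + 1)) * norm (w - ((x \<bullet> w) / (norm x)\<^sup>2) *\<^sub>R x)"
      unfolding collision_field_def sigma_matrix_vec by (simp add: abs_mult)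
    also have "\<dots> \<le> 2 * (\<bar>sqrt \<Lambda>\<bar> * K) * (2 * norm w)"
      using K(1) K(2)[OF x] w by (intro mult_mono mult_left_mono) auto
    finally show ?thesis by (simp add: mult_ac)
  qed
  then show ?thesis by blast
qed

lemma collision_field_lipschitz:
  assumes p: "0 < p"
  shows "\<exists>L\<ge>0. \<forall>(x :: real ^ 'd) y w. p \<le> norm x \<longrightarrow> norm x \<le> q \<longrightarrow> p \<le> norm y \<longrightarrow> norm y \<le> q \<longrightarrow>
    norm (collision_field \<Lambda> \<gamma> x w - collision_field \<Lambda> \<gamma> y w) \<le> L * norm (x - y) * norm w"
proof -
  obtain K where K: "0 \<le> K"
    "\<And>r u. p \<le> r \<Longrightarrow> r \<le> q \<Longrightarrow> p \<le> u \<Longrightarrow> u \<le> q \<Longrightarrow> \<bar>r powr (\<gamma> / 2 + 1) - u powr (\<gamma> / 2 + 1)\<bar> \<le> K * \<bar>r - u\<bar>"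
    using powr_bounded_lipschitz[OF p, of q "\<gamma> / 2 + 1"] by metis
  obtain J where J: "0 \<le> J" "\<And>r. p \<le> r \<Longrightarrow> r \<le> q \<Longrightarrow> r powr (\<gamma> / 2 - 1) \<le> J"
    "\<And>r u. p \<le> r \<Longrightarrow> r \<le> q \<Longrightarrow> p \<le> u \<Longrightarrow> u \<le> q \<Longrightarrow> \<bar>r powr (\<gamma> / 2 - 1) - u powr (\<gamma> / 2 - 1)\<bar> \<le> J * \<bar>r - u\<bar>"
    using powr_bounded_lipschitz[OF p, of q "\<gamma> / 2 - 1"] by metis
  let ?L = "2 * \<bar>sqrt \<Lambda>\<bar> * (K + J * \<bar>q\<bar> * \<bar>q\<bar> + J * \<bar>q\<bar> + J * \<bar>q\<bar>)"
  have "norm (collision_field \<Lambda> \<gamma> x w - collision_field \<Lambda> \<gamma> y w) \<le> ?L * norm (x - y) * norm w"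
    if x: "p \<le> norm x" "norm x \<le> q" and y: "p \<le> norm y" "norm y \<le> q" for x y w :: "real ^ 'd"
  proof -
    let ?f = "\<lambda>x :: real ^ 'd. norm x powr (\<gamma> / 2 + 1)" and ?g = "\<lambda>x :: real ^ 'd. norm x powr (\<gamma> / 2 - 1)"
    let ?D = "norm (x - y) * norm w"
    have nx: "0 < norm x" "0 < norm y" using p x y by (linarith+)
    have q: "norm x \<le> \<bar>q\<bar>" "norm y \<le> \<bar>q\<bar>" using x y by (linarith+)
    have f: "\<bar>?f x - ?f y\<bar> \<le> K * norm (x - y)"
      using K(2)[OF x y] K(1) norm_triangle_ineq3[of x y] by (meson mult_left_mono order_trans)
    have g: "\<bar>?g x - ?g y\<bar> \<le> J * norm (x - y)"
      using J(3)[OF x y] J(1) norm_triangle_ineq3[of x y] by (meson mult_left_mono order_trans)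
    have gy: "\<bar>?g y\<bar> \<le> J" using J(2)[OF y] by simp
    have xw: "\<bar>x \<bullet> w\<bar> \<le> \<bar>q\<bar> * norm w" "\<bar>y \<bullet> w\<bar> \<le> \<bar>q\<bar> * norm w"
      using q by (auto intro!: order_trans[OF Cauchy_Schwarz_ineq2] mult_right_mono)
    have "collision_field \<Lambda> \<gamma> x w - collision_field \<Lambda> \<gamma> y w = (2 * sqrt \<Lambda>) *\<^sub>R
       ((?f x - ?f y) *\<^sub>R w - (((?g x - ?g y) * (x \<bullet> w)) *\<^sub>R x + (?g y * ((x - y) \<bullet> w)) *\<^sub>R x + (?g y * (y \<bullet> w)) *\<^sub>R (x - y)))"
      unfolding collision_field_annulus[OF nx(1)] collision_field_annulus[OF nx(2)]
      by (simp add: algebra_simps inner_diff_left)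
    also have "norm \<dots> \<le> (2 * \<bar>sqrt \<Lambda>\<bar>) * (\<bar>?f x - ?f y\<bar> * norm w + (\<bar>?g x - ?g y\<bar> * \<bar>x \<bullet> w\<bar> * norm x
        + \<bar>?g y\<bar> * \<bar>(x - y) \<bullet> w\<bar> * norm x + \<bar>?g y\<bar> * \<bar>y \<bullet> w\<bar> * norm (x - y)))"
    proof -
      have tri: "norm (a - (b + c + d)) \<le> norm a + (norm b + norm c + norm d)" for a b c d :: "real ^ 'd"
        using norm_triangle_ineq4[of a "b + c + d"] norm_triangle_ineq[of "b + c" d] norm_triangle_ineq[of b c] by linarith
      show ?thesis
        unfolding norm_scaleR abs_mult
        by (intro mult_mono order_trans[OF tri]) (auto simp: abs_mult)
    qed
    also have "\<dots> \<le> (2 * \<bar>sqrt \<Lambda>\<bar>) * (K * norm (x - y) * norm w + (J * norm (x - y) * (\<bar>q\<bar> * norm w) * \<bar>q\<bar>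
        + J * (norm (x - y) * norm w) * \<bar>q\<bar> + J * (\<bar>q\<bar> * norm w) * norm (x - y)))"
    proof (intro mult_left_mono add_mono)
      show "\<bar>?f x - ?f y\<bar> * norm w \<le> K * norm (x - y) * norm w"
        by (rule mult_right_mono[OF f norm_ge_zero])
      show "\<bar>?g x - ?g y\<bar> * \<bar>x \<bullet> w\<bar> * norm x \<le> J * norm (x - y) * (\<bar>q\<bar> * norm w) * \<bar>q\<bar>"
        by (intro mult_mono g xw q mult_nonneg_nonneg J(1) abs_ge_zero norm_ge_zero)
      show "\<bar>?g y\<bar> * \<bar>(x - y) \<bullet> w\<bar> * norm x \<le> J * (norm (x - y) * norm w) * \<bar>q\<bar>"
        by (intro mult_mono gy q Cauchy_Schwarz_ineq2 mult_nonneg_nonneg J(1) abs_ge_zero norm_ge_zero)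
      show "\<bar>?g y\<bar> * \<bar>y \<bullet> w\<bar> * norm (x - y) \<le> J * (\<bar>q\<bar> * norm w) * norm (x - y)"
        by (intro mult_right_mono mult_mono gy xw J(1) abs_ge_zero norm_ge_zero)
    qed simp
    also have "\<dots> = ?L * norm (x - y) * norm w" by (simp add: algebra_simps)
    finally show ?thesis .
  qed
  moreover have "0 \<le> ?L" using K(1) J(1) by simp
  ultimately show ?thesis by blast
qed

lemma good_integrator_uminus:
  assumes "good_integrator P F a b X"
  shows "good_integrator P F a b (\<lambda>t \<omega>. - X t \<omega>)"
proof -
  have eq: "\<bar>\<Sum>k<K. c k \<bullet> (- u k - - v k)\<bar> = \<bar>\<Sum>k<K. c k \<bullet> (u k - v k)\<bar>" for K and c u v :: "nat \<Rightarrow> 'b"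
  proof -
    have "(\<Sum>k<K. c k \<bullet> (- u k - - v k)) = - (\<Sum>k<K. c k \<bullet> (u k - v k))"
      unfolding sum_negf[symmetric] by (intro sum.cong) (auto simp: inner_diff_right)
    then show ?thesis by simp
  qed
  show ?thesis using assms unfolding good_integrator_def eq .
qed

lemma measurable_vec_of_components:
  fixes f :: "'a \<Rightarrow> real ^ 'd"
  assumes "\<And>j. (\<lambda>\<omega>. f \<omega> $ j) \<in> borel_measurable N"
  shows "f \<in> borel_measurable N"
proof (rule borel_measurable_euclidean_space[THEN iffD2], rule ballI)
  fix i :: "real ^ 'd" assume "i \<in> Basis"
  then obtain j where "i = axis j 1" by (auto simp: Basis_vec_def)
  with assms show "(\<lambda>\<omega>. f \<omega> \<bullet> i) \<in> borel_measurable N" by (simp add: inner_axis)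
qed

lemma partition_of_bounds:
  assumes "partition_of a b K p" "k \<le> K"
  shows "p k \<in> {a..b}"
proof -
  have mono: "p i \<le> p j" if "i \<le> j" "j \<le> K" for i j
    using that assms(1) unfolding partition_of_def
    by (induction j rule: dec_induct) (auto intro: order_trans)
  show ?thesis using mono[of 0 k] mono[of k K] assms unfolding partition_of_def by auto
qed

text \<open>
  Here \<open>u\<close> and \<open>v\<close> are the velocities before and after a move.  The total increment equals its own
  negative.  The parallelogram identity expresses the squared norms in a pair by the sum and the
  difference of its two velocities, and summing over the pairs of all particles counts each squared norm
  twice.
\<close>
lemma paired_increments_conserve:
  fixes u v :: "nat \<Rightarrow> 'b::real_inner"
  assumes \<pi>: "\<pi> \<in> pairings N"
    and anti: "\<And>i. i \<in> {1..N} \<Longrightarrow> v i - u i = - (v (\<pi> i) - u (\<pi> i))"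
    and dist: "\<And>i. i \<in> {1..N} \<Longrightarrow> i < \<pi> i \<Longrightarrow> norm (v i - v (\<pi> i)) = norm (u i - u (\<pi> i))"
  shows "(\<Sum>i=1..N. v i) = (\<Sum>i=1..N. u i)"
    and "(\<Sum>i=1..N. (norm (v i))\<^sup>2) = (\<Sum>i=1..N. (norm (u i))\<^sup>2)"
proof -
  have perm: "\<pi> permutes {1..N}" and inv: "\<And>i. i \<in> {1..N} \<Longrightarrow> \<pi> i \<noteq> i \<and> \<pi> (\<pi> i) = i"
    using \<pi> by (auto simp: pairings_def)
  have swap: "(\<Sum>i=1..N. f (\<pi> i)) = (\<Sum>i=1..N. f i)" for f :: "nat \<Rightarrow> 'c::comm_monoid_add"
    using sum.permute[OF perm, of f] by (simp add: comp_def)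
  have "(\<Sum>i=1..N. v i - u i) = (\<Sum>i=1..N. - (v (\<pi> i) - u (\<pi> i)))"
    using anti by (intro sum.cong) auto
  also have "\<dots> = - (\<Sum>i=1..N. v i - u i)"
    unfolding sum_negf swap[of "\<lambda>i. v i - u i"] ..
  finally have "(\<Sum>i=1..N. v i - u i) = 0"
    by (metis add_eq_0_iff2 eq_neg_iff_add_eq_0 scaleR_2 scaleR_eq_0_iff zero_neq_numeral)
  then show "(\<Sum>i=1..N. v i) = (\<Sum>i=1..N. u i)" by (simp add: sum_subtractf)
  have dist': "norm (v i - v (\<pi> i)) = norm (u i - u (\<pi> i))" if i: "i \<in> {1..N}" for i
  proof (cases "i < \<pi> i")
    case False
    have "\<pi> i \<in> {1..N}" using permutes_in_image[OF perm] i by simp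
    moreover have "\<pi> i < \<pi> (\<pi> i)" using False inv[OF i] by simp
    ultimately have "norm (v (\<pi> i) - v (\<pi> (\<pi> i))) = norm (u (\<pi> i) - u (\<pi> (\<pi> i)))" by (rule dist)
    then show ?thesis using inv[OF i] by (simp add: norm_minus_commute)
  qed (use dist i in auto)
  have para: "(norm x)\<^sup>2 + (norm y)\<^sup>2 = ((norm (x + y))\<^sup>2 + (norm (x - y))\<^sup>2) / 2" for x y :: 'b
    by (simp add: power2_norm_eq_inner inner_add_left inner_add_right inner_diff_left inner_diff_right)
  have pair: "(norm (v i))\<^sup>2 + (norm (v (\<pi> i)))\<^sup>2 = (norm (u i))\<^sup>2 + (norm (u (\<pi> i)))\<^sup>2" if i: "i \<in> {1..N}" for i
  proof -
    have "v i + v (\<pi> i) = u i + u (\<pi> i)" using anti[OF i] by (simp add: algebra_simps)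
    then show ?thesis
      unfolding para[of "v i" "v (\<pi> i)"] para[of "u i" "u (\<pi> i)"] dist'[OF i] by simp
  qed
  have "2 * (\<Sum>i=1..N. (norm (w i))\<^sup>2) = (\<Sum>i=1..N. (norm (w i))\<^sup>2 + (norm (w (\<pi> i)))\<^sup>2)" for w :: "nat \<Rightarrow> 'b"
    using swap[of "\<lambda>i. (norm (w i))\<^sup>2"] by (simp add: sum.distrib)
  from this[of v] this[of u] show "(\<Sum>i=1..N. (norm (v i))\<^sup>2) = (\<Sum>i=1..N. (norm (u i))\<^sup>2)"
    using pair by simp
qed

lemma eq_everywhere_of_rationals:
  fixes f :: "real \<Rightarrow> 'b::t1_space"
  assumes "continuous_on {0..} f" "\<And>t. t \<in> \<rat> \<Longrightarrow> 0 \<le> t \<Longrightarrow> f t = c" "0 \<le> t"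
  shows "f t = c"
proof -
  have cl: "closure (\<rat> \<inter> {0..}) = {0::real..}"
  proof
    show "closure (\<rat> \<inter> {0..}) \<subseteq> {0::real..}" by (rule closure_minimal[OF Int_lower2 closed_atLeast])
    show "{0::real..} \<subseteq> closure (\<rat> \<inter> {0..})"
    proof
      fix x :: real assume x: "x \<in> {0..}"
      show "x \<in> closure (\<rat> \<inter> {0..})"
        unfolding closure_approachable
      proof (intro allI impI)
        fix e :: real assume "0 < e"
        then obtain q where "q \<in> \<rat>" "x < q" "q < x + e" using Rats_dense_in_real[of x "x + e"] by auto
        with x show "\<exists>y\<in>\<rat> \<inter> {0..}. dist y x < e" by (intro bexI[of _ q]) (auto simp: dist_real_def)
      qed
    qed
  qed
  show ?thesis
    by (rule continuous_constant_on_closure[of "\<rat> \<inter> {0..}" f]) (use assms cl in auto)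
qed

context collisional_particle_system
begin

sublocale filtered_prob_space M F
  by unfold_locales (use F_events in auto)

lemma finite_pairings: "finite (pairings N)"
  unfolding pairings_def by (rule finite_subset[OF _ finite_permutations[of "{1..N}"]]) auto

lemma pairing_image: "\<pi> \<in> pairings N \<Longrightarrow> i \<in> {1..N} \<Longrightarrow> \<pi> i \<in> {1..N}"
  unfolding pairings_def using permutes_in_image by fastforce

lemma velocity_adapted:
  assumes "i \<in> {1..N}" "0 \<le> t"
  shows "V i t \<in> borel_measurable (F t)"
proof (rule measurable_vec_of_components)
  show "(\<lambda>\<omega>. V i t \<omega> $ j) \<in> borel_measurable (F t)" for j
    using velocity_semimartingale[OF assms(1)] assms(2)
    unfolding continuous_semimartingale_def adapted_def by blast
qed

lemma velocity_continuous:
  assumes "i \<in> {1..N}"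
  shows "AE \<omega> in M. continuous_on {0..} (\<lambda>t. V i t \<omega>)"
proof -
  have "AE \<omega> in M. \<forall>j\<in>UNIV. continuous_on {0..} (\<lambda>t. V i t \<omega> $ j)"
    using velocity_semimartingale[OF assms]
    unfolding continuous_semimartingale_def continuous_paths_def by (intro AE_finite_allI) auto
  then show ?thesis
  proof eventually_elim
    case (elim \<omega>)
    then have "continuous_on {0..} (\<lambda>t. \<chi> j. V i t \<omega> $ j)" by (intro continuous_on_vec_lambda) auto
    then show ?case by simp
  qed
qed

lemma pairing_in: "\<omega> \<in> space M \<Longrightarrow> \<theta> m \<omega> \<in> pairings N"
  using measurable_space[OF pairing_measurable[of m], of \<omega>] by (simp add: space_F)

lemma pairing_event: "{\<omega> \<in> space M. \<theta> m \<omega> = \<pi>} \<in> sets M" if "\<pi> \<in> pairings N"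
proof -
  have "\<theta> m -` {\<pi>} \<inter> space (F (real m * \<Delta>t)) \<in> sets (F (real m * \<Delta>t))"
    using that by (intro measurable_sets[OF pairing_measurable]) auto
  moreover have "\<theta> m -` {\<pi>} \<inter> space (F (real m * \<Delta>t)) = {\<omega> \<in> space M. \<theta> m \<omega> = \<pi>}"
    by (auto simp: space_F)
  ultimately show ?thesis using F_events by auto
qed

text \<open>
  The partner is random, but it takes finitely many values, on each of which the sum is an explicit
  measurable expression.
\<close>
lemma measurable_stratonovich_sum:
  assumes i: "i \<in> {1..N}" and p: "partition_of (real m * \<Delta>t) u K p" and u: "u \<le> real (Suc m) * \<Delta>t" and \<Delta>: "0 < \<Delta>t"
  shows "stratonovich_sum (\<lambda>s \<omega>. sigma_matrix \<Lambda> \<gamma> (V i s \<omega> - V (\<theta> m \<omega> i) s \<omega>)) (W m i) K p \<in> borel_measurable M"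
proof -
  let ?S = "\<lambda>\<pi>. stratonovich_sum (\<lambda>s \<omega>. sigma_matrix \<Lambda> \<gamma> (V i s \<omega> - V (\<pi> i) s \<omega>)) (W m i) K p"
  have S: "?S \<pi> \<in> borel_measurable M" if \<pi>: "\<pi> \<in> pairings N" for \<pi>
  proof -
    have p_in: "p k \<in> {real m * \<Delta>t..u}" if "k \<le> K" for k using partition_of_bounds[OF p that] .
    have p0: "0 \<le> p k" if "k \<le> K" for k
    proof -
      have "0 \<le> real m * \<Delta>t" using \<Delta> by simp
      then show ?thesis using p_in[OF that] by auto
    qed
    have Z: "(\<lambda>\<omega>. V i (p k) \<omega> - V (\<pi> i) (p k) \<omega>) \<in> borel_measurable M" if "k \<le> K" for k
      by (intro borel_measurable_diff measurable_F_M[OF velocity_adapted[OF _ p0[OF that]]] i pairing_image[OF \<pi> i])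
    have dW: "(\<lambda>\<omega>. W m i (p (Suc k)) \<omega> - W m i (p k) \<omega>) \<in> borel_measurable M" if "k < K" for k
      using p_in[of k] p_in[of "Suc k"] u that
      by (intro borel_measurable_diff measurable_F_M[OF noise_adapted[OF i]]) auto
    have field: "(\<lambda>\<omega>. sigma_matrix \<Lambda> \<gamma> (f \<omega>) *v g \<omega>) \<in> borel_measurable M"
      if "f \<in> borel_measurable M" "g \<in> borel_measurable M" for f g :: "'a \<Rightarrow> real ^ 'd"
      by (rule measurable_field[OF _ measurable_sigma_matrix_vec that]) (rule matrix_vector_mul_linear)
    show ?thesis
      unfolding stratonovich_sum_def[abs_def] scaleR_matrix_vec matrix_vector_mult_add_rdistrib
      using Z dW by (intro borel_measurable_sum borel_measurable_scaleR borel_measurable_add field) auto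
  qed
  have "(\<lambda>\<omega>. ?S (\<theta> m \<omega>) \<omega>) \<in> borel_measurable M"
  proof (rule measurable_compose_countable'[where f="?S" and g="\<theta> m" and I="pairings N"])
    show "\<theta> m \<in> M \<rightarrow>\<^sub>M count_space (pairings N)" by (rule measurable_F_M[OF pairing_measurable])
    show "countable (pairings N)" by (rule countable_finite[OF finite_pairings])
  qed (rule S)
  then show ?thesis by (simp add: stratonovich_sum_def[abs_def])
qed

text \<open>
  Under the conditional law \<open>Q\<close> given the pairing, the noise of the smaller member of the pair is a
  Brownian motion and the relative velocity solves the equation with the field \<open>collision_field\<close>.
  Adaptedness refers to the same filtration, while path continuity and the good integrator property of
  the velocities pass from \<open>M\<close> to \<open>Q\<close> by absolute continuity.
\<close>
lemma relative_velocity_norm_constant: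
  assumes \<pi>: "\<pi> \<in> pairings N" and i: "i \<in> {1..N}" "i < \<pi> i" and \<Delta>: "0 < \<Delta>t"
    and t: "t \<in> {real m * \<Delta>t..real (Suc m) * \<Delta>t}"
  shows "AE \<omega> in M. \<theta> m \<omega> = \<pi> \<longrightarrow>
    norm (V i t \<omega> - V (\<pi> i) t \<omega>) = norm (V i (real m * \<Delta>t) \<omega> - V (\<pi> i) (real m * \<Delta>t) \<omega>)"
proof (cases "t = real m * \<Delta>t")
  case False
  define a where "a = real m * \<Delta>t"
  define T where "T = real (Suc m) * \<Delta>t"
  have a0: "0 \<le> a" using \<Delta> by (simp add: a_def)
  have at: "a < t" "t \<le> T" using t False by (auto simp: a_def T_def)
  define E where "E = {\<omega> \<in> space M. \<theta> m \<omega> = \<pi>}"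
  have E: "E \<in> sets M" using pairing_event[OF \<pi>] by (simp add: E_def)
  define Q where "Q = uniform_measure M E"
  have brown: "brownian_family Q F a T {i \<in> {1..N}. i < \<pi> i} (W m)"
    using noise_brownian[OF \<pi>, of m] by (simp add: Q_def E_def a_def T_def)
  have prob_Q: "prob_space Q" using brown by (simp add: brownian_family_def)
  interpret Q: filtered_prob_space Q F
  proof (intro filtered_prob_space.intro filtered_prob_space_axioms.intro)
    show "filtration (space Q) F"
      using space_F sets_F_mono by unfold_locales (auto simp: Q_def)
  qed (use prob_Q F_events in \<open>auto simp: Q_def\<close>)
  have E_pos: "0 < measure M E"
  proof (rule ccontr)
    assume "\<not> 0 < measure M E"
    then have "emeasure M E = 0" using measure_nonneg[of M E] by (simp add: emeasure_eq_measure)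
    then have "emeasure Q (space Q) = 0" using E sets.sets_into_space[OF E]
      by (simp add: Q_def emeasure_uniform_measure Int_absorb2)
    then show False using Q.emeasure_space_1 by simp
  qed
  have E_nz: "emeasure M E \<noteq> 0" "emeasure M E < \<infinity>"
    using E_pos by (auto simp: emeasure_eq_measure)
  have AE_Q: "AE \<omega> in Q. \<omega> \<in> E \<and> P \<omega>" if "AE \<omega> in M. P \<omega>" for P
    unfolding Q_def AE_uniform_measure[OF E_nz] using that by eventually_elim simp
  define j where "j = \<pi> i"
  have j: "j \<in> {1..N}" using pairing_image[OF \<pi> i(1)] by (simp add: j_def)
  define z where "z u \<omega> = V i u \<omega> - V j u \<omega>" for u \<omega>
  have z_adapted: "z u \<in> borel_measurable (F u)" if "u \<in> {a..t}" for u
    unfolding z_def[abs_def] using velocity_adapted i(1) j that a0 by (intro borel_measurable_diff) auto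
  have W_adapted: "W m i u \<in> borel_measurable (F u)" if "u \<in> {a..t}" for u
    using noise_adapted[OF i(1), of u m] that at by (auto simp: a_def T_def)
  have z_cont: "AE \<omega> in Q. continuous_on {a..t} (\<lambda>u. z u \<omega>)"
  proof -
    have "AE \<omega> in M. continuous_on {a..t} (\<lambda>u. z u \<omega>)"
      using velocity_continuous[OF i(1)] velocity_continuous[OF j]
    proof eventually_elim
      case (elim \<omega>)
      have "{a..t} \<subseteq> {0..}" using a0 by auto
      then show ?case unfolding z_def
        by (intro continuous_on_diff continuous_on_subset[OF elim(1)] continuous_on_subset[OF elim(2)])
    qed
    from AE_Q[OF this] show ?thesis by eventually_elim simp
  qed
  have W_cont: "AE \<omega> in Q. continuous_on {a..t} (\<lambda>u. W m i u \<omega>)"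
  proof -
    have "AE \<omega> in Q. continuous_on {a..T} (\<lambda>u. W m i u \<omega>)"
      using brown i unfolding brownian_family_def by auto
    then show ?thesis by eventually_elim (use at in \<open>auto elim: continuous_on_subset\<close>)
  qed
  have z_good: "good_integrator Q F a t z"
  proof (rule Q.good_integrator_vec)
    fix l
    have "good_integrator M F a t (\<lambda>u \<omega>. z u \<omega> $ l)"
    proof (rule good_integrator_add)
      show "good_integrator M F a t (\<lambda>u \<omega>. V i u \<omega> $ l)"
        using at a0 velocity_semimartingale[OF i(1)] by (intro good_integrator_semimartingale) auto
      show "good_integrator M F a t (\<lambda>u \<omega>. - (V j u \<omega> $ l))"
        using at a0 velocity_semimartingale[OF j] by (intro good_integrator_uminus good_integrator_semimartingale) auto
    qed (use at in \<open>auto simp: z_def\<close>)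
    then show "good_integrator Q F a t (\<lambda>u \<omega>. z u \<omega> $ l)"
      unfolding Q_def by (rule good_integrator_uniform_measure[OF finite_measure_axioms E E_pos])
  qed
  have W_good: "good_integrator Q F a t (W m i)"
    using i at by (intro Q.good_integrator_brownian[OF brown]) auto
  have vanish: "vanishing_sums Q (stratonovich_defect (collision_field \<Lambda> \<gamma>) z (W m i)) a u" if u: "u \<in> {a..t}" for u
    unfolding vanishing_sums_def
  proof (intro allI impI)
    fix \<epsilon> \<eta> :: real assume eps: "0 < \<epsilon>" "0 < \<eta>"
    have u': "u \<in> {real m * \<Delta>t..real (Suc m) * \<Delta>t}" using u at by (auto simp: a_def T_def)
    let ?S = "stratonovich_sum (\<lambda>s \<omega>. sigma_matrix \<Lambda> \<gamma> (V i s \<omega> - V (\<theta> m \<omega> i) s \<omega>)) (W m i)"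
    let ?I = "\<lambda>\<omega>. V i u \<omega> - V i a \<omega>"
    have "has_stratonovich_integral M
        (\<lambda>s \<omega>. sigma_matrix \<Lambda> \<gamma> (V i s \<omega> - V (\<theta> m \<omega> i) s \<omega>)) (W m i) a u ?I"
      using velocity_sde[OF i(1) u'] by (simp add: a_def)
    moreover have "0 < \<epsilon> / 2" "0 < \<eta> * measure M E" using eps E_pos by auto
    ultimately obtain \<delta> where \<delta>: "0 < \<delta>" "\<And>K p. partition_of a u K p \<Longrightarrow> (\<forall>k<K. p (Suc k) - p k < \<delta>) \<Longrightarrow>
        measure M {\<omega> \<in> space M. dist (?S K p \<omega>) (?I \<omega>) > \<epsilon> / 2} < \<eta> * measure M E"
      unfolding has_stratonovich_integral_def by blast
    show "\<exists>\<delta>>0. \<forall>K p. partition_of a u K p \<longrightarrow> (\<forall>k<K. p (Suc k) - p k < \<delta>) \<longrightarrow>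
      whp Q \<eta> (\<lambda>\<omega>. norm (\<Sum>k<K. stratonovich_defect (collision_field \<Lambda> \<gamma>) z (W m i) (p k) (p (Suc k)) \<omega>) \<le> \<epsilon>)"
    proof (intro exI[of _ \<delta>] conjI \<delta>(1) allI impI)
      fix K p assume p: "partition_of a u K p" "\<forall>k<K. p (Suc k) - p k < \<delta>"
      have [measurable]: "?S K p \<in> borel_measurable M"
        using p u' by (intro measurable_stratonovich_sum i \<Delta>) (auto simp: a_def)
      have [measurable]: "?I \<in> borel_measurable M"
        using u a0 by (intro borel_measurable_diff measurable_F_M[OF velocity_adapted[OF i(1)]]) auto
      have "whp M (\<eta> * measure M E) (\<lambda>\<omega>. dist (?S K p \<omega>) (?I \<omega>) \<le> \<epsilon> / 2)"
      proof (rule whp_of_prob_le)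
        show "{\<omega> \<in> space M. \<not> dist (?S K p \<omega>) (?I \<omega>) \<le> \<epsilon> / 2} \<in> sets M" by measurable
        show "measure M {\<omega> \<in> space M. \<not> dist (?S K p \<omega>) (?I \<omega>) \<le> \<epsilon> / 2} \<le> \<eta> * measure M E"
          using \<delta>(2)[OF p] by (simp add: not_le)
      qed
      from whp_uniform_measure[OF this E finite_measure_axioms]
      have 1: "whp Q \<eta> (\<lambda>\<omega>. dist (?S K p \<omega>) (?I \<omega>) \<le> \<epsilon> / 2)"
        using E_pos by (simp add: Q_def)
      have 2: "whp Q 0 (\<lambda>\<omega>. \<omega> \<in> E \<and> V i u \<omega> - V i a \<omega> = - (V (\<theta> m \<omega> i) u \<omega> - V (\<theta> m \<omega> i) a \<omega>))"
        using velocity_antisym[OF i(1) u'] by (intro Q.whp_of_AE AE_Q) (auto simp: a_def)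
      from Q.whp_conj[OF 1 2]
      show "whp Q \<eta> (\<lambda>\<omega>. norm (\<Sum>k<K. stratonovich_defect (collision_field \<Lambda> \<gamma>) z (W m i) (p k) (p (Suc k)) \<omega>) \<le> \<epsilon>)"
      proof (rule whp_mono)
        fix \<omega> assume *: "dist (?S K p \<omega>) (?I \<omega>) \<le> \<epsilon> / 2 \<and>
          \<omega> \<in> E \<and> V i u \<omega> - V i a \<omega> = - (V (\<theta> m \<omega> i) u \<omega> - V (\<theta> m \<omega> i) a \<omega>)"
        then have th: "\<theta> m \<omega> i = j" by (simp add: E_def j_def)
        have "z u \<omega> - z a \<omega> = (V i u \<omega> - V i a \<omega>) - (V j u \<omega> - V j a \<omega>)" by (simp add: z_def)
        also have "\<dots> = 2 *\<^sub>R ?I \<omega>" using * unfolding th by (simp add: scaleR_2)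
        finally have zI: "z u \<omega> - z a \<omega> = 2 *\<^sub>R ?I \<omega>" .
        have "(\<Sum>k<K. stratonovich_defect (collision_field \<Lambda> \<gamma>) z (W m i) (p k) (p (Suc k)) \<omega>) =
          (\<Sum>k<K. z (p (Suc k)) \<omega> - z (p k) \<omega>) - 2 *\<^sub>R ?S K p \<omega>"
          unfolding stratonovich_sum_def scaleR_sum_right sum_subtractf[symmetric] th z_def[symmetric]
            scaleR_matrix_vec matrix_vector_mult_add_rdistrib stratonovich_defect_def collision_field_def
          by (intro sum.cong refl) (simp add: scaleR_add_right[symmetric] del: scaleR_add_right)
        also have "(\<Sum>k<K. z (p (Suc k)) \<omega> - z (p k) \<omega>) = z u \<omega> - z a \<omega>"
          using p(1) sum_lessThan_telescope[of "\<lambda>k. z (p k) \<omega>" K] by (simp add: partition_of_def)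
        also have "z u \<omega> - z a \<omega> - 2 *\<^sub>R ?S K p \<omega> = 2 *\<^sub>R (?I \<omega> - ?S K p \<omega>)"
          unfolding zI scaleR_diff_right ..
        also have "norm \<dots> \<le> \<epsilon>" using conjunct1[OF *] by (simp add: dist_norm norm_minus_commute)
        finally show "norm (\<Sum>k<K. stratonovich_defect (collision_field \<Lambda> \<gamma>) z (W m i) (p k) (p (Suc k)) \<omega>) \<le> \<epsilon>" .
      qed simp
    qed
  qed
  have "AE \<omega> in Q. norm (z t \<omega>) = norm (z a \<omega>)"
    using at by (intro Q.tangential_stratonovich_norm_constant[OF _ z_adapted W_adapted z_cont W_cont z_good W_good
          collision_field_linear collision_field_measurable collision_field_tangential
          collision_field_bounded collision_field_lipschitz vanish]) auto
  then have "AE \<omega> in M. \<omega> \<in> E \<longrightarrow> norm (z t \<omega>) = norm (z a \<omega>)"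
    unfolding Q_def AE_uniform_measure[OF E_nz] .
  then show ?thesis
    using AE_space by eventually_elim (auto simp: E_def z_def j_def a_def)
qed simp

lemma conserved_during_step:
  assumes \<Delta>: "0 < \<Delta>t" and t: "t \<in> {real m * \<Delta>t..real (Suc m) * \<Delta>t}"
  shows "AE \<omega> in M. total_momentum N V t \<omega> = total_momentum N V (real m * \<Delta>t) \<omega> \<and>
    total_energy N V t \<omega> = total_energy N V (real m * \<Delta>t) \<omega>"
proof -
  let ?a = "real m * \<Delta>t"
  have "AE \<omega> in M. \<forall>i\<in>{1..N}. V i t \<omega> - V i ?a \<omega> = - (V (\<theta> m \<omega> i) t \<omega> - V (\<theta> m \<omega> i) ?a \<omega>)"
    using velocity_antisym t by (intro AE_finite_allI) auto
  moreover have "AE \<omega> in M. \<forall>\<pi>\<in>pairings N. \<forall>i\<in>{i \<in> {1..N}. i < \<pi> i}. \<theta> m \<omega> = \<pi> \<longrightarrow>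
      norm (V i t \<omega> - V (\<pi> i) t \<omega>) = norm (V i ?a \<omega> - V (\<pi> i) ?a \<omega>)"
    using relative_velocity_norm_constant \<Delta> t finite_pairings by (intro AE_finite_allI) auto
  ultimately show ?thesis
    using AE_space
  proof eventually_elim
    case (elim \<omega>)
    have anti: "V i t \<omega> - V i ?a \<omega> = - (V (\<theta> m \<omega> i) t \<omega> - V (\<theta> m \<omega> i) ?a \<omega>)" if "i \<in> {1..N}" for i
      using elim(1) that by blast
    have dist: "norm (V i t \<omega> - V (\<theta> m \<omega> i) t \<omega>) = norm (V i ?a \<omega> - V (\<theta> m \<omega> i) ?a \<omega>)"
      if "i \<in> {1..N}" "i < \<theta> m \<omega> i" for i
      using elim(2) pairing_in[OF elim(3), of m] that by blast
    show ?case
      using paired_increments_conserve[where \<pi>="\<theta> m \<omega>" and N=N and v="\<lambda>i. V i t \<omega>" and u="\<lambda>i. V i ?a \<omega>",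
          OF pairing_in[OF elim(3)] anti dist]
      by (simp add: total_momentum_def total_energy_def)
  qed
qed

lemma conserved_at:
  assumes \<Delta>: "0 < \<Delta>t" and t: "0 \<le> t"
  shows "AE \<omega> in M. total_momentum N V t \<omega> = total_momentum N V 0 \<omega> \<and>
    total_energy N V t \<omega> = total_energy N V 0 \<omega>"
proof -
  have grid_times: "AE \<omega> in M. total_momentum N V (real m * \<Delta>t) \<omega> = total_momentum N V 0 \<omega> \<and>
    total_energy N V (real m * \<Delta>t) \<omega> = total_energy N V 0 \<omega>" for m
  proof (induction m)
    case (Suc m)
    have "real (Suc m) * \<Delta>t \<in> {real m * \<Delta>t..real (Suc m) * \<Delta>t}" using \<Delta> by simp
    from Suc conserved_during_step[OF \<Delta> this] show ?case by eventually_elim simp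
  qed simp
  define m where "m = nat \<lfloor>t / \<Delta>t\<rfloor>"
  have "0 \<le> t / \<Delta>t" using \<Delta> t by simp
  then have "real m \<le> t / \<Delta>t" "t / \<Delta>t \<le> real (Suc m)" unfolding m_def by (linarith+)
  then have "t \<in> {real m * \<Delta>t..real (Suc m) * \<Delta>t}"
    using \<Delta> by (simp add: pos_le_divide_eq pos_divide_le_eq)
  from grid_times[of m] conserved_during_step[OF \<Delta> this] show ?thesis by eventually_elim simp
qed

lemma conserved:
  assumes \<Delta>: "0 < \<Delta>t"
  shows "AE \<omega> in M. \<forall>t\<ge>0. total_momentum N V t \<omega> = total_momentum N V 0 \<omega> \<and>
    total_energy N V t \<omega> = total_energy N V 0 \<omega>"
proof -
  have "AE \<omega> in M. \<forall>t\<in>\<rat> \<inter> {0..}. total_momentum N V t \<omega> = total_momentum N V 0 \<omega> \<and>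
      total_energy N V t \<omega> = total_energy N V 0 \<omega>"
    using conserved_at[OF \<Delta>] countable_rat by (intro AE_ball_countable[THEN iffD2]) (auto intro: countable_subset)
  moreover have "AE \<omega> in M. \<forall>i\<in>{1..N}. continuous_on {0..} (\<lambda>t. V i t \<omega>)"
    using velocity_continuous by (intro AE_finite_allI) auto
  ultimately show ?thesis
  proof eventually_elim
    case (elim \<omega>)
    have "continuous_on {0..} (\<lambda>t. total_momentum N V t \<omega>)" "continuous_on {0..} (\<lambda>t. total_energy N V t \<omega>)"
      unfolding total_momentum_def total_energy_def using elim(2) by (auto intro!: continuous_intros)
    note cont = this
    show ?case
    proof (intro allI impI conjI)
      fix t :: real assume t: "0 \<le> t"
      show "total_momentum N V t \<omega> = total_momentum N V 0 \<omega>"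
        by (rule eq_everywhere_of_rationals[OF cont(1) _ t]) (use elim(1) in blast)
      show "total_energy N V t \<omega> = total_energy N V 0 \<omega>"
        by (rule eq_everywhere_of_rationals[OF cont(2) _ t]) (use elim(1) in blast)
    qed
  qed
qed

end

theorem proposition2p1:
  fixes M :: "'a measure" and F :: "real \<Rightarrow> 'a measure"
    and \<Lambda> \<gamma> \<Delta>t :: real and N :: nat
    and f0 :: "real ^ 'd \<Rightarrow> real"
    and \<theta> :: "nat \<Rightarrow> 'a \<Rightarrow> nat \<Rightarrow> nat"
    and W :: "nat \<Rightarrow> nat \<Rightarrow> real \<Rightarrow> 'a \<Rightarrow> real ^ 'd"
    and V :: "nat \<Rightarrow> real \<Rightarrow> 'a \<Rightarrow> real ^ 'd"
  assumes "CARD('d) \<ge> 2"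
    and "\<Lambda> > 0"
    and "- real CARD('d) - 1 < \<gamma>" and "\<gamma> \<le> 1"
    and "\<Delta>t > 0"
    and "even N" and "N > 0"
    and "\<And>x. f0 x \<ge> 0"
    and "collisional_particle_system M F \<Lambda> \<gamma> \<Delta>t N f0 \<theta> W V"
  shows "AE \<omega> in M. \<forall>t\<ge>0.
           total_momentum N V t \<omega> = total_momentum N V 0 \<omega> \<and>
           total_energy N V t \<omega> = total_energy N V 0 \<omega>"
proof -
  interpret collisional_particle_system M F \<Lambda> \<gamma> \<Delta>t N f0 \<theta> W V by (rule assms(9))
  show ?thesis by (rule conserved[OF assms(5)])
qed

end
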